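(* The composite functor $\mathrm{qua}\circ\mathrm{tri}:\hat\square\to\hat\square$ is cocontinuous (preserves small colimits).
   Context: $\mathscr Q$ is the category of preordered sets and monotone functions; $[n]=\{0<\dots<n\}$. $\square_1$ is the full subcategory of $\mathscr Q$ on $[0],[1]$; $\square$ is the smallest subcategory of $\mathscr Q$ containing $\square_1$ and closed under binary $\mathscr Q$-products (of objects and of morphisms), with objects $[1]^{\otimes n}$, $n\ge0$. $\hat\square$ is the category of presheaves of sets on $\square$ (cubical sets), $\square[1]^{\otimes n}$ the representable cubical set of $[1]^{\otimes n}$. $\hat\Delta$ is the category of simplicial sets. For a preordered set $P$, $\mathrm{ner}^\Delta P$ is the simplicial set $\mathscr Q(-,P)$ restricted to $\Delta^{op}$. $\mathrm{tri}:\hat\square\to\hat\Delta$ is the unique cocontinuous functor naturally sending $\square[1]^{\otimes n}$ to $\mathrm{ner}^\Delta([1]^{\otimes n})$, and $\mathrm{qua}:\hat\Delta\to\hat\square$ is its right adjoint. *)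

theory Defs
  imports Main "HOL-Library.FuncSet"
begin
record ('o, 'a) category =
  Obj :: "'o set"
  Arr :: "'a set"
  Dom :: "'a \<Rightarrow> 'o"
  Cod :: "'a \<Rightarrow> 'o"
  Id :: "'o \<Rightarrow> 'a"
  Comp :: "'a \<Rightarrow> 'a \<Rightarrow> 'a"  \<comment> \<open>\<open>Comp C g f\<close> is \<open>g\<close> after \<open>f\<close>\<close>

definition Hom :: "('o, 'a) category \<Rightarrow> 'o \<Rightarrow> 'o \<Rightarrow> 'a set" where
  "Hom C a b = {f \<in> Arr C. Dom C f = a \<and> Cod C f = b}"

definition is_category :: "('o, 'a) category \<Rightarrow> bool" where
  "is_category C \<longleftrightarrow>
     (\<forall>f\<in>Arr C. Dom C f \<in> Obj C \<and> Cod C f \<in> Obj C) \<and>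
     (\<forall>a\<in>Obj C. Id C a \<in> Hom C a a) \<and>
     (\<forall>f\<in>Arr C. \<forall>g\<in>Arr C. Dom C g = Cod C f \<longrightarrow> Comp C g f \<in> Hom C (Dom C f) (Cod C g)) \<and>
     (\<forall>f\<in>Arr C. Comp C f (Id C (Dom C f)) = f \<and> Comp C (Id C (Cod C f)) f = f) \<and>
     (\<forall>f\<in>Arr C. \<forall>g\<in>Arr C. \<forall>h\<in>Arr C. Dom C g = Cod C f \<longrightarrow> Dom C h = Cod C g \<longrightarrow>
        Comp C h (Comp C g f) = Comp C (Comp C h g) f)"

record ('o, 'a, 'p, 'b) fctr =
  fobj :: "'o \<Rightarrow> 'p"
  farr :: "'a \<Rightarrow> 'b"

definition is_functor :: "('o, 'a) category \<Rightarrow> ('p, 'b) category \<Rightarrow> ('o, 'a, 'p, 'b) fctr \<Rightarrow> bool" where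
  "is_functor C D F \<longleftrightarrow>
     (\<forall>a\<in>Obj C. fobj F a \<in> Obj D) \<and>
     (\<forall>f\<in>Arr C. farr F f \<in> Hom D (fobj F (Dom C f)) (fobj F (Cod C f))) \<and>
     (\<forall>a\<in>Obj C. farr F (Id C a) = Id D (fobj F a)) \<and>
     (\<forall>f\<in>Arr C. \<forall>g\<in>Arr C. Dom C g = Cod C f \<longrightarrow>
        farr F (Comp C g f) = Comp D (farr F g) (farr F f))"

definition fcomp :: "('p, 'b, 'q, 'c) fctr \<Rightarrow> ('o, 'a, 'p, 'b) fctr \<Rightarrow> ('o, 'a, 'q, 'c) fctr"
    (infixr "\<circ>\<^sub>F" 55) where
  "G \<circ>\<^sub>F F = \<lparr>fobj = fobj G \<circ> fobj F, farr = farr G \<circ> farr F\<rparr>"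

definition is_cocone ::
    "('j, 'k) category \<Rightarrow> ('o, 'a) category \<Rightarrow> ('j, 'k, 'o, 'a) fctr \<Rightarrow> 'o \<Rightarrow> ('j \<Rightarrow> 'a) \<Rightarrow> bool" where
  "is_cocone J C D L \<iota> \<longleftrightarrow>
     L \<in> Obj C \<and>
     (\<forall>j\<in>Obj J. \<iota> j \<in> Hom C (fobj D j) L) \<and>
     (\<forall>u\<in>Arr J. Comp C (\<iota> (Cod J u)) (farr D u) = \<iota> (Dom J u))"

definition is_colimit ::
    "('j, 'k) category \<Rightarrow> ('o, 'a) category \<Rightarrow> ('j, 'k, 'o, 'a) fctr \<Rightarrow> 'o \<Rightarrow> ('j \<Rightarrow> 'a) \<Rightarrow> bool" where
  "is_colimit J C D L \<iota> \<longleftrightarrow>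
     is_cocone J C D L \<iota> \<and>
     (\<forall>M \<mu>. is_cocone J C D M \<mu> \<longrightarrow>
        (\<exists>!h. h \<in> Hom C L M \<and> (\<forall>j\<in>Obj J. Comp C h (\<iota> j) = \<mu> j)))"

text \<open>
  The type argument is the universe that determines which diagrams are small: a diagram is small
  if the objects and the arrows of its shape form sets of elements of the universe.
\<close>

definition cocontinuous ::
    "'u itself \<Rightarrow> ('o, 'a) category \<Rightarrow> ('p, 'b) category \<Rightarrow> ('o, 'a, 'p, 'b) fctr \<Rightarrow> bool" where
  "cocontinuous (_ :: 'u itself) C D F \<longleftrightarrow>
     is_functor C D F \<and>
     (\<forall>(J :: ('u, 'u) category) K L \<iota>.
        is_category J \<longrightarrow> is_functor J C K \<longrightarrow> is_colimit J C K L \<iota> \<longrightarrow>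
        is_colimit J D (F \<circ>\<^sub>F K) (fobj F L) (\<lambda>j. farr F (\<iota> j)))"

text \<open>\<open>F : C \<rightarrow> D\<close> is left adjoint to \<open>G : D \<rightarrow> C\<close>.\<close>

definition adjunction ::
    "('o, 'a) category \<Rightarrow> ('p, 'b) category \<Rightarrow> ('o, 'a, 'p, 'b) fctr \<Rightarrow> ('p, 'b, 'o, 'a) fctr \<Rightarrow> bool"
  where
  "adjunction C D F G \<longleftrightarrow>
     is_functor C D F \<and> is_functor D C G \<and>
     (\<exists>\<phi> :: 'o \<Rightarrow> 'p \<Rightarrow> 'b \<Rightarrow> 'a.
        (\<forall>a\<in>Obj C. \<forall>b\<in>Obj D. bij_betw (\<phi> a b) (Hom D (fobj F a) b) (Hom C a (fobj G b))) \<and>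
        (\<forall>f\<in>Arr C. \<forall>b\<in>Obj D. \<forall>k\<in>Hom D (fobj F (Cod C f)) b.
           \<phi> (Dom C f) b (Comp D k (farr F f)) = Comp C (\<phi> (Cod C f) b k) f) \<and>
        (\<forall>a\<in>Obj C. \<forall>g\<in>Arr D. \<forall>k\<in>Hom D (fobj F a) (Dom D g).
           \<phi> a (Cod D g) (Comp D g k) = Comp C (farr G g) (\<phi> a (Dom D g) k)))"

datatype ('o, 'm) arrow = Arrow (src: 'o) (tgt: 'o) (fn: 'm)

record ('o, 'a, 'x) presheaf =
  sec :: "'o \<Rightarrow> 'x set"
  act :: "'a \<Rightarrow> 'x \<Rightarrow> 'x"

definition is_presheaf :: "('o, 'a) category \<Rightarrow> ('o, 'a, 'x) presheaf \<Rightarrow> bool" where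
  "is_presheaf C X \<longleftrightarrow>
     (\<forall>f\<in>Arr C. act X f \<in> sec X (Cod C f) \<rightarrow> sec X (Dom C f)) \<and>
     (\<forall>a\<in>Obj C. \<forall>x\<in>sec X a. act X (Id C a) x = x) \<and>
     (\<forall>f\<in>Arr C. \<forall>g\<in>Arr C. Dom C g = Cod C f \<longrightarrow>
        (\<forall>x\<in>sec X (Cod C g). act X (Comp C g f) x = act X f (act X g x)))"

text \<open>
  Natural transformations, extensional so that equality of functions is equality of natural
  transformations. The two presheaves may take their values in different types.
\<close>

definition psh_maps ::
    "('o, 'a) category \<Rightarrow> ('o, 'a, 'x) presheaf \<Rightarrow> ('o, 'a, 'y) presheaf \<Rightarrow> ('o \<Rightarrow> 'x \<Rightarrow> 'y) set" where
  "psh_maps C X Y =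
     {\<eta> \<in> (\<Pi>\<^sub>E c\<in>Obj C. sec X c \<rightarrow>\<^sub>E sec Y c).
        \<forall>f\<in>Arr C. \<forall>x\<in>sec X (Cod C f). \<eta> (Dom C f) (act X f x) = act Y f (\<eta> (Cod C f) x)}"

definition presheaves ::
    "('o, 'a) category \<Rightarrow>
     (('o, 'a, 'x) presheaf, (('o, 'a, 'x) presheaf, 'o \<Rightarrow> 'x \<Rightarrow> 'x) arrow) category" where
  "presheaves C =
     \<lparr>Obj = {X. is_presheaf C X},
      Arr = {Arrow X Y \<eta> |X Y \<eta>. is_presheaf C X \<and> is_presheaf C Y \<and> \<eta> \<in> psh_maps C X Y},
      Dom = src,
      Cod = tgt,
      Id = (\<lambda>X. Arrow X X (\<lambda>c\<in>Obj C. \<lambda>x\<in>sec X c. x)),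
      Comp = (\<lambda>\<theta> \<eta>. Arrow (src \<eta>) (tgt \<theta>) (\<lambda>c\<in>Obj C. compose (sec (src \<eta>) c) (fn \<theta> c) (fn \<eta> c)))\<rparr>"

text \<open>
  Natural isomorphism of two functors from \<open>C\<close> to presheaves on \<open>D\<close>, where the values of the two
  functors may be presheaves with values in different types.
\<close>

definition psh_nat_iso ::
    "('o, 'a) category \<Rightarrow> ('p, 'b) category \<Rightarrow>
     ('o, 'a, ('p, 'b, 'x) presheaf, (('p, 'b, 'x) presheaf, 'p \<Rightarrow> 'x \<Rightarrow> 'x) arrow) fctr \<Rightarrow>
     ('o, 'a, ('p, 'b, 'y) presheaf, (('p, 'b, 'y) presheaf, 'p \<Rightarrow> 'y \<Rightarrow> 'y) arrow) fctr \<Rightarrow> bool" where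
  "psh_nat_iso C D F G \<longleftrightarrow>
     (\<exists>\<alpha> :: 'o \<Rightarrow> 'p \<Rightarrow> 'x \<Rightarrow> 'y.
        (\<forall>c\<in>Obj C. \<alpha> c \<in> psh_maps D (fobj F c) (fobj G c) \<and>
           (\<forall>d\<in>Obj D. bij_betw (\<alpha> c d) (sec (fobj F c) d) (sec (fobj G c) d))) \<and>
        (\<forall>f\<in>Arr C. \<forall>d\<in>Obj D. \<forall>x\<in>sec (fobj F (Dom C f)) d.
           \<alpha> (Cod C f) d (fn (farr F f) d x) = fn (farr G f) d (\<alpha> (Dom C f) d x)))"

definition yoneda ::
    "('o, 'a) category \<Rightarrow>
     ('o, 'a, ('o, 'a, 'a) presheaf, (('o, 'a, 'a) presheaf, 'o \<Rightarrow> 'a \<Rightarrow> 'a) arrow) fctr" where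
  "yoneda C =
     (let rep = \<lambda>c. \<lparr>sec = (\<lambda>a. Hom C a c), act = (\<lambda>f g. Comp C g f)\<rparr> in
      \<lparr>fobj = rep,
       farr = (\<lambda>g. Arrow (rep (Dom C g)) (rep (Cod C g))
                     (\<lambda>a\<in>Obj C. \<lambda>h\<in>Hom C a (Dom C g). Comp C g h))\<rparr>)"

record 'p proset =
  pts :: "'p set"
  leq :: "'p \<Rightarrow> 'p \<Rightarrow> bool"

definition mono_maps :: "'p proset \<Rightarrow> 'q proset \<Rightarrow> ('p \<Rightarrow> 'q) set" where
  "mono_maps P Q = {f \<in> pts P \<rightarrow>\<^sub>E pts Q. monotone_on (pts P) (leq P) (leq Q) f}"

definition ordinal :: "nat \<Rightarrow> nat proset" where
  "ordinal n = \<lparr>pts = {0..n}, leq = (\<le>)\<rparr>"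

text \<open>
  The \<open>n\<close>-fold power of \<open>[1]\<close> with its product order; \<open>False < True\<close> are the elements of \<open>[1]\<close>.
  With products of powers of \<open>[1]\<close> formed by concatenation, the product is strictly associative
  and unital, \<open>[0]\<close> being the one-point preordered set \<open>cube 0\<close>.
\<close>

definition cube :: "nat \<Rightarrow> bool list proset" where
  "cube n = \<lparr>pts = {v. length v = n}, leq = list_all2 (\<le>)\<rparr>"

definition Simplex :: "(nat, (nat, nat \<Rightarrow> nat) arrow) category" where
  "Simplex =
     \<lparr>Obj = UNIV,
      Arr = {Arrow m n f |m n f. f \<in> mono_maps (ordinal m) (ordinal n)},
      Dom = src,
      Cod = tgt,
      Id = (\<lambda>n. Arrow n n (\<lambda>i\<in>pts (ordinal n). i)),
      Comp = (\<lambda>g f. Arrow (src f) (tgt g) (compose (pts (ordinal (src f))) (fn g) (fn f)))\<rparr>"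

inductive box_map :: "nat \<Rightarrow> nat \<Rightarrow> (bool list \<Rightarrow> bool list) \<Rightarrow> bool" where
  base: "m \<le> 1 \<Longrightarrow> n \<le> 1 \<Longrightarrow> f \<in> mono_maps (cube m) (cube n) \<Longrightarrow> box_map m n f"
| ident: "box_map n n (\<lambda>v\<in>pts (cube n). v)"
| comp: "box_map l m f \<Longrightarrow> box_map m n g \<Longrightarrow> box_map l n (compose (pts (cube l)) g f)"
| prod: "box_map m n f \<Longrightarrow> box_map m' n' g \<Longrightarrow>
    box_map (m + m') (n + n') (\<lambda>v\<in>pts (cube (m + m')). f (take m v) @ g (drop m v))"

definition Box :: "(nat, (nat, bool list \<Rightarrow> bool list) arrow) category" where
  "Box =
     \<lparr>Obj = UNIV,
      Arr = {Arrow m n f |m n f. box_map m n f},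
      Dom = src,
      Cod = tgt,
      Id = (\<lambda>n. Arrow n n (\<lambda>v\<in>pts (cube n). v)),
      Comp = (\<lambda>g f. Arrow (src f) (tgt g) (compose (pts (cube (src f))) (fn g) (fn f)))\<rparr>"

type_synonym 'x sset = "(nat, (nat, nat \<Rightarrow> nat) arrow, 'x) presheaf"
type_synonym 'x sset_map = "('x sset, nat \<Rightarrow> 'x \<Rightarrow> 'x) arrow"
type_synonym 'x cset = "(nat, (nat, bool list \<Rightarrow> bool list) arrow, 'x) presheaf"
type_synonym 'x cset_map = "('x cset, nat \<Rightarrow> 'x \<Rightarrow> 'x) arrow"

text \<open>
  Simplicial and cubical sets in the universe \<open>'u\<close>: their sets of simplices and cubes are subsets
  of the type \<open>'u\<close>. If \<open>'u\<close> is infinite, these categories have all colimits of small diagrams,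
  and the colimits are those of the underlying sets, computed pointwise.
\<close>

definition simplicial_sets :: "('u sset, 'u sset_map) category" where
  "simplicial_sets = presheaves Simplex"

definition cubical_sets :: "('u cset, 'u cset_map) category" where
  "cubical_sets = presheaves Box"

definition nerve :: "'p proset \<Rightarrow> (nat \<Rightarrow> 'p) sset" where
  "nerve P =
     \<lparr>sec = (\<lambda>n. mono_maps (ordinal n) P),
      act = (\<lambda>f s. compose (pts (ordinal (src f))) s (fn f))\<rparr>"

definition cube_nerve ::
    "(nat, (nat, bool list \<Rightarrow> bool list) arrow, (nat \<Rightarrow> bool list) sset, (nat \<Rightarrow> bool list) sset_map) fctr"
  where
  "cube_nerve =
     \<lparr>fobj = (\<lambda>n. nerve (cube n)),
      farr = (\<lambda>g. Arrow (nerve (cube (src g))) (nerve (cube (tgt g)))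
                    (\<lambda>k\<in>Obj Simplex. \<lambda>s\<in>sec (nerve (cube (src g))) k.
                       compose (pts (ordinal k)) (fn g) s))\<rparr>"

text \<open>
  The representable cubical sets have cubes in the type of arrows of the box category, so \<open>Y\<close> is a
  copy of the Yoneda embedding in the universe \<open>'u\<close>. Any two choices of \<open>Y\<close> are naturally
  isomorphic, and these conditions determine \<open>tri\<close> up to natural isomorphism.
\<close>

definition is_tri :: "('u cset, 'u cset_map, 'u sset, 'u sset_map) fctr \<Rightarrow> bool" where
  "is_tri tri \<longleftrightarrow>
     cocontinuous TYPE('u) cubical_sets simplicial_sets tri \<and>
     (\<exists>Y. is_functor Box (cubical_sets :: ('u cset, 'u cset_map) category) Y \<and>
          psh_nat_iso Box Box (yoneda Box) Y \<and>
          psh_nat_iso Box Simplex cube_nerve (tri \<circ>\<^sub>F Y))"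

definition is_qua ::
    "('u cset, 'u cset_map, 'u sset, 'u sset_map) fctr \<Rightarrow>
     ('u sset, 'u sset_map, 'u cset, 'u cset_map) fctr \<Rightarrow> bool" where
  "is_qua tri qua \<longleftrightarrow> adjunction cubical_sets simplicial_sets tri qua"

end

theory Submission
  imports Defs "HOL-Library.Countable"
begin

text \<open>
  By adjunction an \<open>n\<close>-cube of \<open>qua (tri L)\<close> is a simplicial map from the nerve of \<open>[1]\<^sup>n\<close> to
  \<open>tri L\<close>. Every simplex of \<open>tri L\<close> is \<open>(c, t)\<close> for a unique nondegenerate cube \<open>c\<close> of \<open>L\<close> and a
  unique chain \<open>t\<close> in \<open>[1]\<^sup>m\<close> that starts at the bottom and ends at the top. The edge from the first
  to the last vertex of such a simplex has the same carrier \<open>c\<close>. Hence all simplices of a cube that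
  contain its long diagonal have the same carrier under a map \<open>\<sigma>\<close> to \<open>tri L\<close>, and \<open>\<sigma>\<close> factors
  uniquely as \<open>c\<close> after a monotone map \<open>[1]\<^sup>n \<rightarrow> [1]\<^sup>m\<close> that preserves bottom and top. So the cubes of
  \<open>qua (tri L)\<close> are pairs of a nondegenerate cube of \<open>L\<close> and such a map, and colimits, being
  pointwise, lift along \<open>L\<close>. Uniqueness of \<open>(c, t)\<close> holds since normal forms make the pairs
  \<open>(c, t)\<close> into a simplicial set to which \<open>tri L\<close> maps by its universal property.
\<close>

section \<open>Presheaves and their pointwise colimits\<close>

text \<open>A right adjoint such as \<open>qua\<close> has no general reason to preserve colimits,
  so its values on \<open>tri L\<close> have to be computed. They exceed \<open>L\<close>: a box map
  uses each input at most once and in order, so there are no diagonals and no connections, whereas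
  the monotone maps that occur in the cubes of \<open>qua (tri L)\<close> are arbitrary apart from
  fixing bottom and top. That condition makes the pairs unique: a monotone map of cubes factors
  through the face spanned by the images of the two end vertices, and this face is charged to the
  cube of \<open>L\<close>.

  Maps of cubical sets do not preserve nondegeneracy. Cubes over different objects of a diagram are
  therefore compared by reducing their images in the colimit to nondegenerate cubes, and the common
  nondegenerate cube is lifted back.

  Colimits and maps out of \<open>tri L\<close> are accessible only through universal properties
  that test against objects with values in \<open>'u\<close>. The quotient by zigzags and the
  simplicial set of normal forms consist of tuples and have to be coded inside \<open>'u\<close>,
  which is possible since \<open>'u\<close> is infinite.\<close>

lemma Hom_presheaves:
  "f \<in> Hom (presheaves C) X Y \<longleftrightarrow>
     is_presheaf C X \<and> is_presheaf C Y \<and> src f = X \<and> tgt f = Y \<and> fn f \<in> psh_maps C X Y"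
  by (cases f) (auto simp: Hom_def presheaves_def)

lemma Obj_presheaves [simp]: "X \<in> Obj (presheaves C) \<longleftrightarrow> is_presheaf C X"
  by (simp add: presheaves_def)

lemma Dom_presheaves [simp]: "Dom (presheaves C) = src"
  and Cod_presheaves [simp]: "Cod (presheaves C) = tgt"
  by (simp_all add: presheaves_def)

lemma src_Comp_presheaves [simp]: "src (Comp (presheaves C) g f) = src f"
  and tgt_Comp_presheaves [simp]: "tgt (Comp (presheaves C) g f) = tgt g"
  by (simp_all add: presheaves_def)

lemma fn_Comp_presheaves [simp]:
  "c \<in> Obj C \<Longrightarrow> x \<in> sec (src f) c \<Longrightarrow> fn (Comp (presheaves C) g f) c x = fn g c (fn f c x)"
  by (simp add: presheaves_def compose_def)

lemma act_in_sec:
  "is_presheaf C X \<Longrightarrow> f \<in> Arr C \<Longrightarrow> x \<in> sec X (Cod C f) \<Longrightarrow> act X f x \<in> sec X (Dom C f)"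
  unfolding is_presheaf_def by blast

lemma act_Id: "is_presheaf C X \<Longrightarrow> a \<in> Obj C \<Longrightarrow> x \<in> sec X a \<Longrightarrow> act X (Id C a) x = x"
  unfolding is_presheaf_def by blast

lemma act_Comp:
  "is_presheaf C X \<Longrightarrow> f \<in> Arr C \<Longrightarrow> g \<in> Arr C \<Longrightarrow> Dom C g = Cod C f \<Longrightarrow> x \<in> sec X (Cod C g) \<Longrightarrow>
     act X (Comp C g f) x = act X f (act X g x)"
  unfolding is_presheaf_def by blast

lemma psh_maps_in_sec: "\<eta> \<in> psh_maps C X Y \<Longrightarrow> c \<in> Obj C \<Longrightarrow> x \<in> sec X c \<Longrightarrow> \<eta> c x \<in> sec Y c"
  unfolding psh_maps_def by (auto simp: PiE_iff)

lemma psh_maps_act: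
  "\<eta> \<in> psh_maps C X Y \<Longrightarrow> f \<in> Arr C \<Longrightarrow> x \<in> sec X (Cod C f) \<Longrightarrow>
     \<eta> (Dom C f) (act X f x) = act Y f (\<eta> (Cod C f) x)"
  unfolding psh_maps_def by blast

lemma psh_maps_eqI:
  assumes "\<eta> \<in> psh_maps C X Y" "\<theta> \<in> psh_maps C X Z"
    and "\<And>c x. c \<in> Obj C \<Longrightarrow> x \<in> sec X c \<Longrightarrow> \<eta> c x = \<theta> c x"
  shows "\<eta> = \<theta>"
proof (rule extensionalityI[of _ "Obj C"])
  show "\<eta> \<in> extensional (Obj C)" "\<theta> \<in> extensional (Obj C)"
    using assms by (auto simp: psh_maps_def PiE_iff)
  fix c assume c: "c \<in> Obj C"
  then have "\<eta> c \<in> sec X c \<rightarrow>\<^sub>E sec Y c" "\<theta> c \<in> sec X c \<rightarrow>\<^sub>E sec Z c"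
    using assms by (auto simp: psh_maps_def PiE_iff)
  then show "\<eta> c = \<theta> c" using assms(3) c by (intro extensionalityI[of _ "sec X c"]) (auto simp: PiE_iff)
qed

lemma psh_mapsI:
  assumes "\<And>f. f \<in> Arr C \<Longrightarrow> Dom C f \<in> Obj C \<and> Cod C f \<in> Obj C"
    and "is_presheaf C X"
    and "\<And>c x. c \<in> Obj C \<Longrightarrow> x \<in> sec X c \<Longrightarrow> h c x \<in> sec Y c"
    and "\<And>f x. f \<in> Arr C \<Longrightarrow> x \<in> sec X (Cod C f) \<Longrightarrow> h (Dom C f) (act X f x) = act Y f (h (Cod C f) x)"
  shows "(\<lambda>c\<in>Obj C. \<lambda>x\<in>sec X c. h c x) \<in> psh_maps C X Y"
  using assms by (auto simp: psh_maps_def act_in_sec)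

lemma Hom_presheaves_eqI:
  assumes "f \<in> Hom (presheaves C) X Y" "g \<in> Hom (presheaves C) X Y"
    and "\<And>c x. c \<in> Obj C \<Longrightarrow> x \<in> sec X c \<Longrightarrow> fn f c x = fn g c x"
  shows "f = g"
  using assms psh_maps_eqI[of "fn f" C X Y "fn g" Y] unfolding Hom_presheaves
  by (simp add: arrow.expand)

lemma Hom_in_sec:
  "f \<in> Hom (presheaves C) X Y \<Longrightarrow> c \<in> Obj C \<Longrightarrow> x \<in> sec X c \<Longrightarrow> fn f c x \<in> sec Y c"
  unfolding Hom_presheaves by (metis psh_maps_in_sec)

lemma Hom_act:
  "h \<in> Hom (presheaves C) X Y \<Longrightarrow> f \<in> Arr C \<Longrightarrow> x \<in> sec X (Cod C f) \<Longrightarrow>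
     fn h (Dom C f) (act X f x) = act Y f (fn h (Cod C f) x)"
  unfolding Hom_presheaves by (metis psh_maps_act)

lemma is_category_Dom_Cod: "is_category C \<Longrightarrow> f \<in> Arr C \<Longrightarrow> Dom C f \<in> Obj C \<and> Cod C f \<in> Obj C"
  unfolding is_category_def by blast

lemma Comp_psh_maps:
  assumes C: "is_category C" and X: "is_presheaf C X"
    and \<eta>: "\<eta> \<in> psh_maps C X Y" and \<theta>: "\<theta> \<in> psh_maps C Y Z"
  shows "(\<lambda>c\<in>Obj C. compose (sec X c) (\<theta> c) (\<eta> c)) \<in> psh_maps C X Z"
proof -
  have "(\<lambda>c\<in>Obj C. \<lambda>x\<in>sec X c. \<theta> c (\<eta> c x)) \<in> psh_maps C X Z"
  proof (rule psh_mapsI[OF is_category_Dom_Cod[OF C] X])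
    fix f x assume f: "f \<in> Arr C" and x: "x \<in> sec X (Cod C f)"
    have "\<eta> (Cod C f) x \<in> sec Y (Cod C f)"
      using psh_maps_in_sec[OF \<eta>] x is_category_Dom_Cod[OF C f] by blast
    then show "\<theta> (Dom C f) (\<eta> (Dom C f) (act X f x)) = act Z f (\<theta> (Cod C f) (\<eta> (Cod C f) x))"
      using psh_maps_act[OF \<eta> f x] psh_maps_act[OF \<theta> f] by simp
  qed (auto intro: psh_maps_in_sec[OF \<theta>] psh_maps_in_sec[OF \<eta>])
  then show ?thesis by (simp add: compose_def)
qed

lemma Comp_in_Hom_presheaves:
  assumes "is_category C" and "f \<in> Hom (presheaves C) X Y" "g \<in> Hom (presheaves C) Y Z"
  shows "Comp (presheaves C) g f \<in> Hom (presheaves C) X Z"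
  using assms Comp_psh_maps[of C X "fn f" Y "fn g" Z] unfolding Hom_presheaves
  by (simp add: presheaves_def)

lemma Comp_assoc_presheaves:
  assumes C: "is_category C" and f: "f \<in> Hom (presheaves C) W X" and g: "g \<in> Hom (presheaves C) X Y"
    and h: "h \<in> Hom (presheaves C) Y Z"
  shows "Comp (presheaves C) h (Comp (presheaves C) g f) = Comp (presheaves C) (Comp (presheaves C) h g) f"
proof (rule Hom_presheaves_eqI)
  show "Comp (presheaves C) h (Comp (presheaves C) g f) \<in> Hom (presheaves C) W Z"
    "Comp (presheaves C) (Comp (presheaves C) h g) f \<in> Hom (presheaves C) W Z"
    using assms by (blast intro: Comp_in_Hom_presheaves)+
  fix c x assume "c \<in> Obj C" "x \<in> sec W c"
  moreover have "src f = W" "src g = X" using f g by (auto simp: Hom_presheaves)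
  moreover have "fn f c x \<in> sec X c" using calculation Hom_in_sec[OF f] by blast
  ultimately show "fn (Comp (presheaves C) h (Comp (presheaves C) g f)) c x =
    fn (Comp (presheaves C) (Comp (presheaves C) h g) f) c x" by simp
qed

text \<open>For \<open>D = X\<close> this is the identity. Generation arguments below compare the
  inclusion of a subpresheaf with this case by the uniqueness part of a universal property.\<close>

definition sub_inc :: "('o, 'a) category \<Rightarrow> ('o, 'a, 'x) presheaf \<Rightarrow> ('o, 'a, 'x) presheaf \<Rightarrow>
    (('o, 'a, 'x) presheaf, 'o \<Rightarrow> 'x \<Rightarrow> 'x) arrow" where
  "sub_inc C D X = Arrow D X (\<lambda>c\<in>Obj C. \<lambda>x\<in>sec D c. x)"

lemma sub_presheaf:
  assumes C: "is_category C" and X: "is_presheaf C X"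
    and sub: "\<And>c. c \<in> Obj C \<Longrightarrow> S c \<subseteq> sec X c"
    and closed: "\<And>f x. f \<in> Arr C \<Longrightarrow> x \<in> S (Cod C f) \<Longrightarrow> act X f x \<in> S (Dom C f)"
  shows "is_presheaf C \<lparr>sec = S, act = act X\<rparr>"
    and "sub_inc C \<lparr>sec = S, act = act X\<rparr> X \<in> Hom (presheaves C) \<lparr>sec = S, act = act X\<rparr> X"
proof -
  show D: "is_presheaf C \<lparr>sec = S, act = act X\<rparr>"
    unfolding is_presheaf_def
  proof (intro conjI ballI impI, simp_all add: closed)
    show "act X (Id C a) x = x" if "a \<in> Obj C" "x \<in> S a" for a x
      using that sub act_Id[OF X] by blast
    show "act X (Comp C g f) x = act X f (act X g x)"
      if "f \<in> Arr C" "g \<in> Arr C" "Dom C g = Cod C f" "x \<in> S (Cod C g)" for f g x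
      using that sub is_category_Dom_Cod[OF C] act_Comp[OF X] by blast
  qed
  show "sub_inc C \<lparr>sec = S, act = act X\<rparr> X \<in> Hom (presheaves C) \<lparr>sec = S, act = act X\<rparr> X"
    using D X sub C closed
    by (auto simp: sub_inc_def Hom_presheaves psh_maps_def is_category_Dom_Cod subset_iff)
qed

lemma fn_sub_inc [simp]: "c \<in> Obj C \<Longrightarrow> x \<in> sec D c \<Longrightarrow> fn (sub_inc C D X) c x = x"
  by (simp add: sub_inc_def)

lemma sub_inc_refl: "is_category C \<Longrightarrow> is_presheaf C X \<Longrightarrow> sub_inc C X X \<in> Hom (presheaves C) X X"
  by (auto simp: sub_inc_def Hom_presheaves psh_maps_def is_category_Dom_Cod act_in_sec)

lemma functor_obj: "is_functor C D F \<Longrightarrow> a \<in> Obj C \<Longrightarrow> fobj F a \<in> Obj D"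
  unfolding is_functor_def by blast

lemma functor_arr: "is_functor C D F \<Longrightarrow> f \<in> Hom C a b \<Longrightarrow> farr F f \<in> Hom D (fobj F a) (fobj F b)"
  unfolding is_functor_def Hom_def by blast

lemma functor_Comp:
  "is_functor C D F \<Longrightarrow> f \<in> Hom C a b \<Longrightarrow> g \<in> Hom C b c \<Longrightarrow>
     farr F (Comp C g f) = Comp D (farr F g) (farr F f)"
  unfolding is_functor_def Hom_def by blast

lemma functor_fcomp:
  assumes F: "is_functor C D F" and G: "is_functor D E G"
  shows "is_functor C E (G \<circ>\<^sub>F F)"
  unfolding is_functor_def fcomp_def
proof (intro conjI ballI impI; simp)
  fix f assume "f \<in> Arr C"
  then have "f \<in> Hom C (Dom C f) (Cod C f)" by (simp add: Hom_def)
  then show "farr G (farr F f) \<in> Hom E (fobj G (fobj F (Dom C f))) (fobj G (fobj F (Cod C f)))"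
    by (intro functor_arr[OF G] functor_arr[OF F])
next
  fix a assume "a \<in> Obj C"
  then show "farr G (farr F (Id C a)) = Id E (fobj G (fobj F a))"
    using F G unfolding is_functor_def by simp
next
  fix f g assume "f \<in> Arr C" "g \<in> Arr C" "Dom C g = Cod C f"
  then have "f \<in> Hom C (Dom C f) (Cod C f)" "g \<in> Hom C (Cod C f) (Cod C g)"
    by (simp_all add: Hom_def)
  then show "farr G (farr F (Comp C g f)) = Comp E (farr G (farr F g)) (farr G (farr F f))"
    using functor_Comp[OF F] functor_Comp[OF G] functor_arr[OF F] by metis
qed (auto intro: functor_obj[OF F] functor_obj[OF G])

section \<open>Colimits of presheaves as quotients by zigzags\<close>

inductive zigzag :: "('j, 'k) category \<Rightarrow>
    ('j, 'k, ('o, 'a, 'x) presheaf, (('o, 'a, 'x) presheaf, 'o \<Rightarrow> 'x \<Rightarrow> 'x) arrow) fctr \<Rightarrow>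
    'o \<Rightarrow> 'j \<times> 'x \<Rightarrow> 'j \<times> 'x \<Rightarrow> bool" for J K c where
  step: "u \<in> Arr J \<Longrightarrow> x \<in> sec (fobj K (Dom J u)) c \<Longrightarrow>
    zigzag J K c (Dom J u, x) (Cod J u, fn (farr K u) c x)"
| refl: "zigzag J K c p p"
| sym: "zigzag J K c p q \<Longrightarrow> zigzag J K c q p"
| trans: "zigzag J K c p q \<Longrightarrow> zigzag J K c q r \<Longrightarrow> zigzag J K c p r"

lemma zigzag_cocone:
  assumes cc: "is_cocone J (presheaves C) K L \<iota>" and K: "is_functor J (presheaves C) K" and c: "c \<in> Obj C"
    and zz: "zigzag J K c p q"
  shows "fn (\<iota> (fst p)) c (snd p) = fn (\<iota> (fst q)) c (snd q)"
  using zz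
proof (induction rule: zigzag.induct)
  case (step u x)
  have "src (farr K u) = fobj K (Dom J u)"
    using functor_arr[OF K, of u] step by (auto simp: Hom_def presheaves_def)
  with step cc c show ?case
    unfolding is_cocone_def by (metis fn_Comp_presheaves fst_conv snd_conv)
qed auto

text \<open>Zigzag classes are the elements of the colimit of the sets
  \<open>sec (fobj K j) c\<close>. Only the implication from equality to a zigzag is recorded,
  because \<open>zigzag_cocone\<close> gives the other one for every cocone.\<close>

definition pointwise_colimit :: "('o, 'a) category \<Rightarrow> ('j, 'k) category \<Rightarrow>
    ('j, 'k, ('o, 'a, 'x) presheaf, (('o, 'a, 'x) presheaf, 'o \<Rightarrow> 'x \<Rightarrow> 'x) arrow) fctr \<Rightarrow>
    ('o, 'a, 'x) presheaf \<Rightarrow> ('j \<Rightarrow> (('o, 'a, 'x) presheaf, 'o \<Rightarrow> 'x \<Rightarrow> 'x) arrow) \<Rightarrow> bool" where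
  "pointwise_colimit C J K L \<iota> \<longleftrightarrow>
     (\<forall>c\<in>Obj C. \<forall>z\<in>sec L c. \<exists>j\<in>Obj J. \<exists>x\<in>sec (fobj K j) c. z = fn (\<iota> j) c x) \<and>
     (\<forall>c\<in>Obj C. \<forall>i\<in>Obj J. \<forall>j\<in>Obj J. \<forall>x\<in>sec (fobj K i) c. \<forall>y\<in>sec (fobj K j) c.
        fn (\<iota> i) c x = fn (\<iota> j) c y \<longrightarrow> zigzag J K c (i, x) (j, y))"

lemma pointwise_colimit_is_colimit:
  assumes C: "is_category C" and K: "is_functor J (presheaves C) K"
    and cc: "is_cocone J (presheaves C) K L \<iota>" and pw: "pointwise_colimit C J K L \<iota>"
  shows "is_colimit J (presheaves C) K L \<iota>"
  unfolding is_colimit_def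
proof (intro conjI allI impI cc)
  fix M \<mu> assume ccM: "is_cocone J (presheaves C) K M \<mu>"
  have \<iota>: "\<iota> j \<in> Hom (presheaves C) (fobj K j) L" and \<mu>: "\<mu> j \<in> Hom (presheaves C) (fobj K j) M"
    if "j \<in> Obj J" for j using that cc ccM by (auto simp: is_cocone_def)
  have L: "is_presheaf C L" and M: "is_presheaf C M" using cc ccM by (auto simp: is_cocone_def)
  \<comment> \<open>Any preimage in the diagram will do: two preimages are joined by a zigzag, along
    which the cocone \<open>\<mu>\<close> is constant.\<close>
  define h where "h = (\<lambda>c z. let p = SOME p. fst p \<in> Obj J \<and> snd p \<in> sec (fobj K (fst p)) c \<and> z = fn (\<iota> (fst p)) c (snd p)
    in fn (\<mu> (fst p)) c (snd p))"
  have h: "h c (fn (\<iota> j) c x) = fn (\<mu> j) c x"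
    if c: "c \<in> Obj C" and j: "j \<in> Obj J" and x: "x \<in> sec (fobj K j) c" for c j x
  proof -
    define P where "P = (\<lambda>p. fst p \<in> Obj J \<and> snd p \<in> sec (fobj K (fst p)) c \<and> fn (\<iota> j) c x = fn (\<iota> (fst p)) c (snd p))"
    have "P (j, x)" using that by (simp add: P_def)
    then have "P (SOME p. P p)" by (rule someI)
    then have "zigzag J K c (j, x) (fst (SOME p. P p), snd (SOME p. P p))"
      using pw c j x unfolding pointwise_colimit_def P_def by blast
    then have "fn (\<mu> j) c x = fn (\<mu> (fst (SOME p. P p))) c (snd (SOME p. P p))"
      using zigzag_cocone[OF ccM K c] by fastforce
    then show ?thesis unfolding h_def P_def Let_def by simp
  qed
  have surj: "\<exists>j\<in>Obj J. \<exists>x\<in>sec (fobj K j) c. z = fn (\<iota> j) c x" if "c \<in> Obj C" "z \<in> sec L c" for c z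
    using pw that unfolding pointwise_colimit_def by blast
  define H where "H = Arrow L M (\<lambda>c\<in>Obj C. \<lambda>x\<in>sec L c. h c x)"
  have "(\<lambda>c\<in>Obj C. \<lambda>x\<in>sec L c. h c x) \<in> psh_maps C L M"
  proof (rule psh_mapsI[OF is_category_Dom_Cod[OF C] L])
    fix c x assume "c \<in> Obj C" "x \<in> sec L c"
    then show "h c x \<in> sec M c" using surj h Hom_in_sec[OF \<mu>] by metis
  next
    fix f z assume f: "f \<in> Arr C" and z: "z \<in> sec L (Cod C f)"
    note o = is_category_Dom_Cod[OF C f]
    obtain j x where j: "j \<in> Obj J" and x: "x \<in> sec (fobj K j) (Cod C f)" and zx: "z = fn (\<iota> j) (Cod C f) x"
      using surj o z by blast
    have "is_presheaf C (fobj K j)" using functor_obj[OF K j] by simp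
    then have "act (fobj K j) f x \<in> sec (fobj K j) (Dom C f)" using act_in_sec f x by metis
    moreover have "act L f z = fn (\<iota> j) (Dom C f) (act (fobj K j) f x)"
      using Hom_act[OF \<iota>[OF j] f x] zx by simp
    ultimately show "h (Dom C f) (act L f z) = act M f (h (Cod C f) z)"
      using h j o x zx Hom_act[OF \<mu>[OF j] f x] by simp
  qed auto
  then have H: "H \<in> Hom (presheaves C) L M" using L M by (simp add: H_def Hom_presheaves)
  show "\<exists>!h. h \<in> Hom (presheaves C) L M \<and> (\<forall>j\<in>Obj J. Comp (presheaves C) h (\<iota> j) = \<mu> j)"
  proof (rule ex1I[of _ H], intro conjI H ballI)
    fix j assume j: "j \<in> Obj J"
    have s: "src (\<iota> j) = fobj K j" using \<iota>[OF j] by (simp add: Hom_presheaves)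
    show "Comp (presheaves C) H (\<iota> j) = \<mu> j"
    proof (rule Hom_presheaves_eqI[OF Comp_in_Hom_presheaves[OF C \<iota>[OF j] H] \<mu>[OF j]])
      fix c x assume "c \<in> Obj C" "x \<in> sec (fobj K j) c"
      then show "fn (Comp (presheaves C) H (\<iota> j)) c x = fn (\<mu> j) c x"
        using h j s Hom_in_sec[OF \<iota>[OF j]] by (simp add: H_def)
    qed
  next
    fix G assume G: "G \<in> Hom (presheaves C) L M \<and> (\<forall>j\<in>Obj J. Comp (presheaves C) G (\<iota> j) = \<mu> j)"
    show "G = H"
    proof (rule Hom_presheaves_eqI[OF conjunct1[OF G] H])
      fix c z assume c: "c \<in> Obj C" and z: "z \<in> sec L c"
      obtain j x where j: "j \<in> Obj J" and x: "x \<in> sec (fobj K j) c" and zx: "z = fn (\<iota> j) c x"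
        using surj c z by blast
      have s: "src (\<iota> j) = fobj K j" using \<iota>[OF j] by (simp add: Hom_presheaves)
      have "fn G c z = fn (Comp (presheaves C) G (\<iota> j)) c x" using c x s zx by simp
      also have "\<dots> = fn H c z" using G j h[OF c j x] zx c z by (simp add: H_def)
      finally show "fn G c z = fn H c z" .
    qed
  qed
qed

text \<open>The images of the \<iota> \<open>j\<close> form a subpresheaf \<open>D\<close> of
  \<open>L\<close>, and the cocone factors through it. The composite of the induced map
  \<open>L\<close> to \<open>D\<close> with the inclusion agrees with the identity on the cocone,
  hence everywhere, so \<open>D\<close> is all of \<open>L\<close>.\<close>

lemma jointly_surjective:
  assumes C: "is_category C" and K: "is_functor J (presheaves C) K"
    and col: "is_colimit J (presheaves C) K L \<iota>" and c: "c \<in> Obj C" and z: "z \<in> sec L c"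
  shows "\<exists>j\<in>Obj J. \<exists>x\<in>sec (fobj K j) c. z = fn (\<iota> j) c x"
proof -
  have cc: "is_cocone J (presheaves C) K L \<iota>" using col by (simp add: is_colimit_def)
  then have \<iota>: "\<And>j. j \<in> Obj J \<Longrightarrow> \<iota> j \<in> Hom (presheaves C) (fobj K j) L" and L: "is_presheaf C L"
    by (auto simp: is_cocone_def)
  have s: "src (\<iota> j) = fobj K j" if "j \<in> Obj J" for j using \<iota>[OF that] by (simp add: Hom_presheaves)
  have Kp: "is_presheaf C (fobj K j)" if "j \<in> Obj J" for j using functor_obj[OF K that] by simp
  define S where "S = (\<lambda>c. {z. \<exists>j\<in>Obj J. \<exists>x\<in>sec (fobj K j) c. z = fn (\<iota> j) c x})"
  define D where "D = \<lparr>sec = S, act = act L\<rparr>"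
  have D: "is_presheaf C D" and inc: "sub_inc C D L \<in> Hom (presheaves C) D L"
  proof -
    have 1: "S c \<subseteq> sec L c" if "c \<in> Obj C" for c using Hom_in_sec[OF \<iota>] that by (auto simp: S_def)
    have 2: "act L f x \<in> S (Dom C f)" if f: "f \<in> Arr C" and x: "x \<in> S (Cod C f)" for f x
    proof -
      obtain j y where "j \<in> Obj J" "y \<in> sec (fobj K j) (Cod C f)" "x = fn (\<iota> j) (Cod C f) y"
        using x unfolding S_def by auto
      then have "act L f x = fn (\<iota> j) (Dom C f) (act (fobj K j) f y)" "act (fobj K j) f y \<in> sec (fobj K j) (Dom C f)"
        using Hom_act[OF \<iota> f] act_in_sec[OF Kp f] by simp_all
      then show ?thesis unfolding S_def using \<open>j \<in> Obj J\<close> by blast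
    qed
    show "is_presheaf C D" "sub_inc C D L \<in> Hom (presheaves C) D L"
      unfolding D_def using sub_presheaf[OF C L 1 2] by auto
  qed
  define \<mu> where "\<mu> = (\<lambda>j. Arrow (fobj K j) D (fn (\<iota> j)))"
  have \<mu>: "\<mu> j \<in> Hom (presheaves C) (fobj K j) D" if j: "j \<in> Obj J" for j
  proof -
    have "fn (\<iota> j) \<in> psh_maps C (fobj K j) L" using \<iota>[OF j] by (simp add: Hom_presheaves)
    then have "fn (\<iota> j) \<in> psh_maps C (fobj K j) D"
      using j by (auto simp: psh_maps_def PiE_iff D_def S_def)
    then show ?thesis using Kp[OF j] D by (simp add: \<mu>_def Hom_presheaves)
  qed
  have "is_cocone J (presheaves C) K D \<mu>"
    unfolding is_cocone_def
  proof (intro conjI ballI)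
    fix u assume u: "u \<in> Arr J"
    have "Comp (presheaves C) (\<iota> (Cod J u)) (farr K u) = \<iota> (Dom J u)" using cc u by (simp add: is_cocone_def)
    moreover have "src (farr K u) = fobj K (Dom J u)"
      using functor_arr[OF K, of u] u by (auto simp: Hom_def presheaves_def)
    ultimately show "Comp (presheaves C) (\<mu> (Cod J u)) (farr K u) = \<mu> (Dom J u)"
      by (cases "\<iota> (Dom J u)") (simp add: \<mu>_def presheaves_def)
  qed (use D \<mu> in auto)
  then obtain h where h: "h \<in> Hom (presheaves C) L D" and h\<mu>: "\<forall>j\<in>Obj J. Comp (presheaves C) h (\<iota> j) = \<mu> j"
    using col unfolding is_colimit_def by blast
  have "Comp (presheaves C) (Comp (presheaves C) (sub_inc C D L) h) (\<iota> j) = \<iota> j" if j: "j \<in> Obj J" for j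
  proof -
    have "Comp (presheaves C) (sub_inc C D L) (\<mu> j) = \<iota> j"
    proof (rule Hom_presheaves_eqI[OF Comp_in_Hom_presheaves[OF C \<mu>[OF j] inc] \<iota>[OF j]])
      fix c x assume "c \<in> Obj C" "x \<in> sec (fobj K j) c"
      then show "fn (Comp (presheaves C) (sub_inc C D L) (\<mu> j)) c x = fn (\<iota> j) c x"
        using Hom_in_sec[OF \<mu>[OF j]] by (simp add: \<mu>_def)
    qed
    then show ?thesis using Comp_assoc_presheaves[OF C \<iota>[OF j] h inc] h\<mu> j by simp
  qed
  moreover have "Comp (presheaves C) (sub_inc C L L) (\<iota> j) = \<iota> j" if j: "j \<in> Obj J" for j
  proof (rule Hom_presheaves_eqI[OF Comp_in_Hom_presheaves[OF C \<iota>[OF j] sub_inc_refl[OF C L]] \<iota>[OF j]])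
    fix c x assume "c \<in> Obj C" "x \<in> sec (fobj K j) c"
    then show "fn (Comp (presheaves C) (sub_inc C L L) (\<iota> j)) c x = fn (\<iota> j) c x"
      using Hom_in_sec[OF \<iota>[OF j]] s[OF j] by simp
  qed
  ultimately have "Comp (presheaves C) (sub_inc C D L) h = sub_inc C L L"
    using col cc Comp_in_Hom_presheaves[OF C h inc] sub_inc_refl[OF C L] unfolding is_colimit_def by blast
  then have "z = fn (Comp (presheaves C) (sub_inc C D L) h) c z" using c z by simp
  also have "\<dots> = fn h c z"
    using h c z Hom_in_sec[OF h c z] by (simp add: Hom_presheaves)
  finally have "z \<in> S c" using Hom_in_sec[OF h c z] by (simp add: D_def)
  then show ?thesis by (simp add: S_def)
qed

lemma infinite_pair_inj:
  assumes "infinite (UNIV :: 'u set)"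
  shows "\<exists>e :: 'u \<times> 'u \<Rightarrow> 'u. inj e"
proof -
  have "(card_of (UNIV \<times> UNIV :: ('u \<times> 'u) set), card_of (UNIV :: 'u set)) \<in> ordIso"
    using card_of_Times_same_infinite[OF assms] .
  then obtain e :: "'u \<times> 'u \<Rightarrow> 'u" where "bij_betw e (UNIV \<times> UNIV) UNIV"
    using card_of_ordIso by blast
  then show ?thesis by (auto simp: bij_betw_def)
qed

lemma zigzag_act:
  assumes C: "is_category C" and K: "is_functor J (presheaves C) K" and f: "f \<in> Arr C"
    and zz: "zigzag J K (Cod C f) p q"
  shows "zigzag J K (Dom C f) (fst p, act (fobj K (fst p)) f (snd p)) (fst q, act (fobj K (fst q)) f (snd q))"
  using zz
proof (induction rule: zigzag.induct)
  case (step u x)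
  have u: "farr K u \<in> Hom (presheaves C) (fobj K (Dom J u)) (fobj K (Cod J u))"
    using functor_arr[OF K] step by (simp add: Hom_def)
  then have P: "is_presheaf C (fobj K (Dom J u))" by (simp add: Hom_presheaves)
  show ?case using zigzag.step[OF step(1) act_in_sec[OF P f step(2)]] Hom_act[OF u f step(2)] by simp
qed (auto intro: zigzag.intros)

text \<open>Zigzag classes are separated by a map from \<open>L\<close> to their quotient
  \<open>Q\<close>. The colimit property applies only to presheaves with values in
  \<open>'u\<close>; as the objects of \<open>J\<close> lie in \<open>'u\<close> too, a
  representative \<open>(j, x)\<close> is a pair of elements of \<open>'u\<close> and has a code
  there.\<close>

lemma is_colimit_pointwise:
  fixes L :: "('o, 'a, 'u) presheaf" and J :: "('u, 'k) category"
  assumes inf: "infinite (UNIV :: 'u set)" and C: "is_category C"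
    and J: "is_category J" and K: "is_functor J (presheaves C) K"
    and col: "is_colimit J (presheaves C) K L \<iota>"
  shows "pointwise_colimit C J K L \<iota>"
  unfolding pointwise_colimit_def
proof (intro conjI ballI impI)
  show "\<exists>j\<in>Obj J. \<exists>x\<in>sec (fobj K j) c. z = fn (\<iota> j) c x" if "c \<in> Obj C" "z \<in> sec L c" for c z
    using jointly_surjective[OF C K col that] .
next
  fix c i j x y
  assume c: "c \<in> Obj C" and i: "i \<in> Obj J" and j: "j \<in> Obj J" and x: "x \<in> sec (fobj K i) c"
    and y: "y \<in> sec (fobj K j) c" and eq: "fn (\<iota> i) c x = fn (\<iota> j) c y"
  obtain e :: "'u \<times> 'u \<Rightarrow> 'u" where e: "inj e" using infinite_pair_inj[OF inf] by blast
  text \<open>The quotient by zigzags, with classes represented by coded elements, is a cocone in the universe.\<close>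
  define N where "N = (\<lambda>c p. e (SOME q. zigzag J K c p q))"
  have N: "N c p = N c q \<longleftrightarrow> zigzag J K c p q" for c p q
  proof
    assume *: "N c p = N c q"
    have "zigzag J K c p (SOME r. zigzag J K c p r)" "zigzag J K c q (SOME r. zigzag J K c q r)"
      by (rule someI, rule zigzag.refl)+
    moreover have "(SOME r. zigzag J K c p r) = (SOME r. zigzag J K c q r)"
      using * e unfolding N_def by (auto dest: injD)
    ultimately show "zigzag J K c p q" by (metis zigzag.trans zigzag.sym)
  next
    assume "zigzag J K c p q"
    then have "zigzag J K c p = zigzag J K c q" by (blast intro: zigzag.trans zigzag.sym)
    then show "N c p = N c q" by (simp add: N_def)
  qed
  define A where "A = (\<lambda>f p. (fst p, act (fobj K (fst p)) f (snd p)))"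
  define P where "P = (\<lambda>c. {p. fst p \<in> Obj J \<and> snd p \<in> sec (fobj K (fst p)) c})"
  define Q where "Q = \<lparr>sec = (\<lambda>c. N c ` P c),
    act = (\<lambda>f z. N (Dom C f) (A f (SOME p. p \<in> P (Cod C f) \<and> z = N (Cod C f) p)))\<rparr>"
  have Kp: "is_presheaf C (fobj K j)" if "j \<in> Obj J" for j using functor_obj[OF K that] by simp
  have Q_act: "act Q f (N (Cod C f) p) = N (Dom C f) (A f p)" if f: "f \<in> Arr C" and p: "p \<in> P (Cod C f)" for f p
  proof -
    define q where "q = (SOME q. q \<in> P (Cod C f) \<and> N (Cod C f) p = N (Cod C f) q)"
    have "q \<in> P (Cod C f) \<and> N (Cod C f) p = N (Cod C f) q"
      unfolding q_def by (rule someI[of _ p]) (simp add: p)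
    then have "zigzag J K (Dom C f) (A f p) (A f q)"
      using zigzag_act[OF C K f] N unfolding A_def by blast
    then have "N (Dom C f) (A f p) = N (Dom C f) (A f q)" using N by blast
    then show ?thesis unfolding Q_def q_def by simp
  qed
  have A_P: "A f p \<in> P (Dom C f)" if "f \<in> Arr C" "p \<in> P (Cod C f)" for f p
    using that act_in_sec[OF Kp] by (auto simp: A_def P_def)
  have Q: "is_presheaf C Q"
    unfolding is_presheaf_def
  proof (intro conjI ballI impI Pi_I)
    fix f z assume f: "f \<in> Arr C" and "z \<in> sec Q (Cod C f)"
    then obtain p where "p \<in> P (Cod C f)" "z = N (Cod C f) p" by (auto simp: Q_def)
    then show "act Q f z \<in> sec Q (Dom C f)" using Q_act[OF f] A_P[OF f] by (auto simp: Q_def)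
  next
    fix a z assume a: "a \<in> Obj C" and "z \<in> sec Q a"
    then obtain p where p: "p \<in> P a" "z = N a p" by (auto simp: Q_def)
    have I: "Id C a \<in> Arr C" "Dom C (Id C a) = a" "Cod C (Id C a) = a"
      using C a by (auto simp: is_category_def Hom_def)
    have "A (Id C a) p = p" using p act_Id[OF Kp] a by (cases p) (auto simp: A_def P_def)
    then show "act Q (Id C a) z = z" using Q_act[OF I(1), of p] I p by simp
  next
    fix f g z assume f: "f \<in> Arr C" and g: "g \<in> Arr C" and gf: "Dom C g = Cod C f" and "z \<in> sec Q (Cod C g)"
    then obtain p where p: "p \<in> P (Cod C g)" "z = N (Cod C g) p" by (auto simp: Q_def)
    have I: "Comp C g f \<in> Arr C" "Dom C (Comp C g f) = Dom C f" "Cod C (Comp C g f) = Cod C g"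
      using C f g gf by (auto simp: is_category_def Hom_def)
    have "A (Comp C g f) p = A f (A g p)" using p act_Comp[OF Kp f g gf] by (auto simp: A_def P_def)
    then show "act Q (Comp C g f) z = act Q f (act Q g z)"
      using Q_act[OF I(1), of p] Q_act[OF g, of p] Q_act[OF f, of "A g p"] A_P[OF g, of p] I p gf by simp
  qed
  define \<mu> where "\<mu> = (\<lambda>j. Arrow (fobj K j) Q (\<lambda>c\<in>Obj C. \<lambda>x\<in>sec (fobj K j) c. N c (j, x)))"
  have \<mu>: "\<mu> j \<in> Hom (presheaves C) (fobj K j) Q" if j: "j \<in> Obj J" for j
  proof -
    have "(\<lambda>c\<in>Obj C. \<lambda>x\<in>sec (fobj K j) c. N c (j, x)) \<in> psh_maps C (fobj K j) Q"
    proof (rule psh_mapsI[OF is_category_Dom_Cod[OF C] Kp[OF j]])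
      fix f x assume "f \<in> Arr C" "x \<in> sec (fobj K j) (Cod C f)"
      then show "N (Dom C f) (j, act (fobj K j) f x) = act Q f (N (Cod C f) (j, x))"
        using Q_act[of f "(j, x)"] j by (simp add: A_def P_def)
    qed (use j in \<open>auto simp: Q_def P_def\<close>)
    then show ?thesis using Kp[OF j] Q by (simp add: \<mu>_def Hom_presheaves)
  qed
  have "is_cocone J (presheaves C) K Q \<mu>"
    unfolding is_cocone_def
  proof (intro conjI ballI)
    fix u assume u: "u \<in> Arr J"
    have o: "Dom J u \<in> Obj J" "Cod J u \<in> Obj J" using is_category_Dom_Cod[OF J u] by auto
    have Ku: "farr K u \<in> Hom (presheaves C) (fobj K (Dom J u)) (fobj K (Cod J u))"
      using functor_arr[OF K, of u] u by (auto simp: Hom_def)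
    show "Comp (presheaves C) (\<mu> (Cod J u)) (farr K u) = \<mu> (Dom J u)"
    proof (rule Hom_presheaves_eqI[OF Comp_in_Hom_presheaves[OF C Ku \<mu>[OF o(2)]] \<mu>[OF o(1)]])
      fix c x assume c: "c \<in> Obj C" and x: "x \<in> sec (fobj K (Dom J u)) c"
      have "src (farr K u) = fobj K (Dom J u)" using Ku by (simp add: Hom_presheaves)
      then show "fn (Comp (presheaves C) (\<mu> (Cod J u)) (farr K u)) c x = fn (\<mu> (Dom J u)) c x"
        using N zigzag.sym[OF zigzag.step[OF u x]] c x Hom_in_sec[OF Ku c x] by (simp add: \<mu>_def)
    qed
  qed (use Q \<mu> in auto)
  then obtain h where h: "h \<in> Hom (presheaves C) L Q" and h\<mu>: "\<forall>j\<in>Obj J. Comp (presheaves C) h (\<iota> j) = \<mu> j"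
    using col unfolding is_colimit_def by blast
  have *: "fn h c (fn (\<iota> j) c x) = N c (j, x)" if "j \<in> Obj J" "x \<in> sec (fobj K j) c" for j x
  proof -
    have "\<iota> j \<in> Hom (presheaves C) (fobj K j) L" using col that by (auto simp: is_colimit_def is_cocone_def)
    then have "src (\<iota> j) = fobj K j" by (simp add: Hom_presheaves)
    then have "fn h c (fn (\<iota> j) c x) = fn (\<mu> j) c x"
      using h\<mu> that c by (metis fn_Comp_presheaves)
    then show ?thesis using that c by (simp add: \<mu>_def)
  qed
  show "zigzag J K c (i, x) (j, y)"
    using *[OF i x] *[OF j y] eq N by metis
qed

section \<open>Box maps as words\<close>

text \<open>
  A word is read from left to right along the input coordinates: \<open>Del\<close> drops the next input,
  \<open>Keep\<close> outputs it, and \<open>Const b\<close> outputs \<open>b\<close> without reading. A box map may have several words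
  (\<open>Del\<close> commutes with \<open>Const b\<close>), but faces and degeneracies have only one.
\<close>

datatype letter = Del | Keep | Const bool

fun run :: "letter list \<Rightarrow> bool list \<Rightarrow> bool list" where
  "run (Del # w) v = run w (tl v)"
| "run (Keep # w) v = hd v # run w (tl v)"
| "run (Const b # w) v = b # run w v"
| "run [] v = []"

fun din :: "letter list \<Rightarrow> nat" where
  "din (Const b # w) = din w"
| "din (_ # w) = Suc (din w)"
| "din [] = 0"

fun dout :: "letter list \<Rightarrow> nat" where
  "dout (Del # w) = dout w"
| "dout (_ # w) = Suc (dout w)"
| "dout [] = 0"

definition wmap :: "letter list \<Rightarrow> (nat, bool list \<Rightarrow> bool list) arrow" where
  "wmap w = Arrow (din w) (dout w) (\<lambda>v\<in>pts (cube (din w)). run w v)"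

lemma length_run [simp]: "length (run w v) = dout w"
  by (induction w v rule: run.induct) auto

lemma din_append [simp]: "din (u @ w) = din u + din w"
  by (induction u rule: din.induct) auto
lemma dout_append [simp]: "dout (u @ w) = dout u + dout w"
  by (induction u rule: dout.induct) auto

lemma run_append: "din u \<le> length v \<Longrightarrow> run (u @ w) v = run u (take (din u) v) @ run w (drop (din u) v)"
  by (induction u v rule: run.induct)
     (auto simp: drop_Suc tl_take)

lemma run_Keep: "length v = n \<Longrightarrow> run (replicate n Keep) v = v"
  by (induction n arbitrary: v) (auto simp: length_Suc_conv)
lemma din_Keep [simp]: "din (replicate n Keep) = n" by (induction n) auto
lemma dout_Keep [simp]: "dout (replicate n Keep) = n" by (induction n) auto

text \<open>The outputs of \<open>w\<close> are matched with the inputs of \<open>u\<close>; a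
  \<open>Const\<close> of \<open>w\<close> that meets a \<open>Del\<close> of \<open>u\<close>
  disappears. For composable words the last two clauses are reached only when both words are
  empty.\<close>

fun wcomp :: "letter list \<Rightarrow> letter list \<Rightarrow> letter list" where
  "wcomp u (Del # w) = Del # wcomp u w"
| "wcomp (Const b # u) w = Const b # wcomp u w"
| "wcomp (Keep # u) (x # w) = x # wcomp u w"
| "wcomp (Del # u) (Keep # w) = Del # wcomp u w"
| "wcomp (Del # u) (Const b # w) = wcomp u w"
| "wcomp u [] = u"
| "wcomp [] w = w"

lemma din_wcomp [simp]: "din u = dout w \<Longrightarrow> din (wcomp u w) = din w"
  by (induction u w rule: wcomp.induct) auto

lemma dout_wcomp [simp]: "din u = dout w \<Longrightarrow> dout (wcomp u w) = dout u"
  by (induction u w rule: wcomp.induct) auto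

lemma run_wcomp [simp]: "din u = dout w \<Longrightarrow> length v = din w \<Longrightarrow> run (wcomp u w) v = run u (run w v)"
  by (induction u w arbitrary: v rule: wcomp.induct) auto

lemma pts_cube [simp]: "pts (cube n) = {v. length v = n}"
  by (simp add: cube_def)

lemma leq_cube [simp]: "leq (cube n) = list_all2 (\<le>)"
  by (simp add: cube_def)

lemma cube_cases: "m \<le> 1 \<Longrightarrow> length v = m \<Longrightarrow> v = [] \<and> m = 0 \<or> v = [False] \<and> m = 1 \<or> v = [True] \<and> m = 1"
  by (cases v) auto

text \<open>Monotonicity excludes the negation, the only endomap of the set \<open>[1]\<close> that
  no word expresses. What remains is the identity \<open>[Keep]\<close> and the constants
  \<open>[Del, Const a]\<close>; maps out of \<open>[0]\<close> are words of constants.\<close>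

lemma box_base_word:
  assumes "m \<le> 1" "n \<le> 1" "f \<in> mono_maps (cube m) (cube n)"
  shows "\<exists>w. din w = m \<and> dout w = n \<and> f = fn (wmap w)"
proof -
  have ext: "f \<in> extensional {v. length v = m}"
    using assms(3) by (auto simp: mono_maps_def PiE_iff)
  have len: "length (f v) = n" if "length v = m" for v
    using assms(3) that by (auto simp: mono_maps_def)
  have fin: "f = fn (wmap w)" if "din w = m" "\<And>v. length v = m \<Longrightarrow> f v = run w v" for w
    using ext that by (auto simp: wmap_def extensional_def restrict_def fun_eq_iff)
  consider "m = 0" | "m = 1" using assms(1) by linarith
  then show ?thesis
  proof cases
    case 1
    define w where "w = map Const (f [])"
    have "din (map Const x) = 0 \<and> dout (map Const x) = length x \<and> run (map Const x) [] = x" for x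
      by (induction x) auto
    then have "din w = m \<and> dout w = n \<and> run w [] = f []" using len[of "[]"] 1 by (simp add: w_def)
    then show ?thesis using fin[of w] 1 by auto
  next
    case 2
    consider "n = 0" | "n = 1" using assms(2) by linarith
    then show ?thesis
    proof cases
      case 1
      then have "f = fn (wmap [Del])" using fin[of "[Del]"] 2 len by simp
      then show ?thesis using 1 2 by (intro exI[of _ "[Del]"]) simp
    next
      case n: 2
      obtain a b where a: "f [False] = [a]" and b: "f [True] = [b]"
        using len[of "[False]"] len[of "[True]"] 2 n by (auto simp: length_Suc_conv)
      have ab: "a \<le> b"
      proof -
        have "list_all2 (\<le>) (f [False]) (f [True])"
          using assms(3) 2 n by (simp add: mono_maps_def monotone_on_def)
        then show ?thesis by (simp add: a b)
      qed
      have val: "f v = (if v = [True] then [b] else [a])" if "length v = 1" for v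
        using that a b cube_cases[of 1 v] by auto
      show ?thesis
      proof (cases "a = b")
        case True
        show ?thesis using fin[of "[Del, Const a]"] 2 n val True
          by (intro exI[of _ "[Del, Const a]"]) auto
      next
        case False
        then have "a = False" "b = True" using ab by auto
        then have "f v = v" if "length v = 1" for v
          using val that cube_cases[of 1 v] by auto
        then have "f v = run [Keep] v" if "length v = m" for v
          using that 2 by (auto simp: length_Suc_conv)
        then show ?thesis using 2 n
          using fin[of "[Keep]"] by (intro exI[of _ "[Keep]"]) (auto simp: length_Suc_conv)
      qed
    qed
  qed
qed

text \<open>Composition of box maps becomes \<open>wcomp\<close>, and their product becomes
  concatenation of words.\<close>

lemma box_map_word: "box_map m n f \<Longrightarrow> \<exists>w. din w = m \<and> dout w = n \<and> f = fn (wmap w)"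
proof (induction rule: box_map.induct)
  case (base m n f)
  then show ?case by (rule box_base_word)
next
  case (ident n)
  show ?case by (rule exI[of _ "replicate n Keep"]) (auto simp: wmap_def run_Keep)
next
  case (comp l m f n g)
  then obtain u w where "din w = l \<and> dout w = m \<and> f = fn (wmap w)" "din u = m \<and> dout u = n \<and> g = fn (wmap u)"
    by blast
  then show ?case
    by (intro exI[of _ "wcomp u w"]) (auto simp: wmap_def compose_def fun_eq_iff)
next
  case (prod m n f m' n' g)
  then obtain u w where "din w = m \<and> dout w = n \<and> f = fn (wmap w)" "din u = m' \<and> dout u = n' \<and> g = fn (wmap u)"
    by blast
  then show ?case
    by (intro exI[of _ "w @ u"]) (auto simp: wmap_def run_append fun_eq_iff)
qed

lemma list_all2_le_refl: "list_all2 (\<le>) (v :: bool list) v" by (simp add: list_all2_refl)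

text \<open>A word is the product of its letters, and each letter is a monotone map between
  \<open>[0]\<close> and \<open>[1]\<close>.\<close>

lemma box_map_run: "box_map (din w) (dout w) (fn (wmap w))"
proof (induction w)
  case Nil
  have "fn (wmap []) = (\<lambda>v\<in>pts (cube 0). v)" by (auto simp: wmap_def)
  then show ?case using box_map.ident[of 0] by (metis din.simps(4) dout.simps(4))
next
  case (Cons x w)
  have "box_map (din [x]) (dout [x]) (fn (wmap [x]))"
    by (rule box_map.base; cases x)
       (auto simp: wmap_def mono_maps_def monotone_on_def length_Suc_conv list_all2_le_refl)
  from box_map.prod[OF this Cons] show ?case
    using run_append[of "[x]" _ w] din_append[of "[x]" w] dout_append[of "[x]" w]
    by (simp add: wmap_def restrict_def cong: if_cong)
qed

lemma Obj_Box [simp]: "Obj Box = UNIV" and Dom_Box [simp]: "Dom Box = src" and Cod_Box [simp]: "Cod Box = tgt"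
  by (simp_all add: Box_def)

lemma Arr_Box: "f \<in> Arr Box \<longleftrightarrow> (\<exists>w. f = wmap w)"
proof
  assume "f \<in> Arr Box"
  then obtain m n g where "f = Arrow m n g" "box_map m n g" by (auto simp: Box_def)
  with box_map_word show "\<exists>w. f = wmap w" by (metis arrow.collapse arrow.sel wmap_def)
next
  assume "\<exists>w. f = wmap w"
  then show "f \<in> Arr Box" using box_map_run by (auto simp: Box_def wmap_def)
qed

lemma src_wmap [simp]: "src (wmap w) = din w" and tgt_wmap [simp]: "tgt (wmap w) = dout w"
  and fn_wmap [simp]: "length v = din w \<Longrightarrow> fn (wmap w) v = run w v"
  and wmap_Arr [simp]: "wmap w \<in> Arr Box"
  by (auto simp: wmap_def Arr_Box[unfolded wmap_def])

lemma wmap_eqI: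
  assumes "din u = din w" "dout u = dout w" "\<And>v. length v = din w \<Longrightarrow> run u v = run w v"
  shows "wmap u = wmap w"
  using assms by (auto simp: wmap_def fun_eq_iff restrict_def)

lemma Comp_wmap: "din u = dout w \<Longrightarrow> Comp Box (wmap u) (wmap w) = wmap (wcomp u w)"
  by (auto simp: Box_def wmap_def compose_def fun_eq_iff restrict_def)

lemma Id_Box: "Id Box n = wmap (replicate n Keep)"
  by (auto simp: Box_def wmap_def run_Keep)

lemma category_Box: "is_category Box"
  unfolding is_category_def
proof (intro conjI ballI impI)
  fix f g assume "f \<in> Arr Box" "g \<in> Arr Box" "Dom Box g = Cod Box f"
  then obtain u w where "f = wmap w" "g = wmap u" "din u = dout w" by (auto simp: Arr_Box)
  then show "Comp Box g f \<in> Hom Box (Dom Box f) (Cod Box g)"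
    by (simp add: Comp_wmap Hom_def)
next
  fix f assume "f \<in> Arr Box"
  then obtain w where w: "f = wmap w" by (auto simp: Arr_Box)
  show "Comp Box f (Id Box (Dom Box f)) = f" "Comp Box (Id Box (Cod Box f)) f = f"
    by (auto simp: w Id_Box Comp_wmap run_Keep intro!: wmap_eqI)
next
  fix f g h assume "f \<in> Arr Box" "g \<in> Arr Box" "h \<in> Arr Box" "Dom Box g = Cod Box f" "Dom Box h = Cod Box g"
  then obtain u w v where "f = wmap w" "g = wmap u" "h = wmap v" "din u = dout w" "din v = dout u"
    by (auto simp: Arr_Box)
  then show "Comp Box h (Comp Box g f) = Comp Box (Comp Box h g) f"
    by (simp add: Comp_wmap) (rule wmap_eqI, simp_all)
qed (auto simp: Id_Box Hom_def)

section \<open>Faces, degeneracies and the factorisation of box maps\<close>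

definition face :: "letter list \<Rightarrow> bool" where "face w \<longleftrightarrow> Del \<notin> set w"
definition degeneracy :: "letter list \<Rightarrow> bool" where "degeneracy w \<longleftrightarrow> range Const \<inter> set w = {}"

abbreviation bot_pt :: "nat \<Rightarrow> bool list" where "bot_pt n \<equiv> replicate n False"
abbreviation top_pt :: "nat \<Rightarrow> bool list" where "top_pt n \<equiv> replicate n True"

lemma bot_pt_le: "length v = n \<Longrightarrow> list_all2 (\<le>) (bot_pt n) v"
  and le_top_pt: "length v = n \<Longrightarrow> list_all2 (\<le>) v (top_pt n)"
  by (auto simp: list_all2_conv_all_nth)

lemma run_mono: "list_all2 (\<le>) v v' \<Longrightarrow> length v = din w \<Longrightarrow> list_all2 (\<le>) (run w v) (run w v')"
  by (induction w arbitrary: v v' rule: din.induct) (auto simp: list_all2_Cons1 length_Suc_conv)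

text \<open>A letter \<open>Const b\<close> outputs the wrong bit at one of the two end vertices.
  The criterion depends only on the function that the word describes, so it is insensitive to the
  choice of word and passes to composites.\<close>

lemma degeneracy_iff: "degeneracy w \<longleftrightarrow> run w (bot_pt (din w)) = bot_pt (dout w) \<and> run w (top_pt (din w)) = top_pt (dout w)"
proof (induction w)
  case (Cons x w)
  then show ?case by (cases x) (auto simp: degeneracy_def)
qed (simp add: degeneracy_def)

lemma degeneracy_le: "degeneracy w \<Longrightarrow> dout w \<le> din w"
proof (induction w)
  case (Cons x w)
  then show ?case by (cases x) (auto simp: degeneracy_def)
qed simp

text \<open>Inputs count the letters \<open>Keep\<close> and \<open>Del\<close>, outputs of a
  degeneracy only \<open>Keep\<close>; equal dimensions leave no \<open>Del\<close>.\<close>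

lemma degeneracy_id: "degeneracy w \<Longrightarrow> dout w = din w \<Longrightarrow> w = replicate (din w) Keep"
proof (induction w)
  case (Cons x w)
  then have "degeneracy w" by (simp add: degeneracy_def)
  with Cons show ?case using degeneracy_le[of w] by (cases x) (auto simp: degeneracy_def)
qed simp

lemma face_le: "face w \<Longrightarrow> din w \<le> dout w"
proof (induction w)
  case (Cons x w)
  then show ?case by (cases x) (auto simp: face_def)
qed simp

lemma face_id: "face w \<Longrightarrow> dout w = din w \<Longrightarrow> w = replicate (din w) Keep"
proof (induction w)
  case (Cons x w)
  then have "face w" by (simp add: face_def)
  with Cons show ?case using face_le[of w] by (cases x) (auto simp: face_def)
qed simp

lemma face_Keep [simp]: "face (replicate n Keep)" and degeneracy_Keep [simp]: "degeneracy (replicate n Keep)"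
  by (auto simp: face_def degeneracy_def)

text \<open>The section of the degeneracy \<open>w\<close> through the vertex \<open>v\<close>.\<close>

fun sect :: "letter list \<Rightarrow> bool list \<Rightarrow> letter list" where
  "sect (Del # w) v = Const (hd v) # sect w (tl v)"
| "sect (x # w) v = x # sect w (tl v)"
| "sect [] v = []"

text \<open>A degeneracy has a section through every vertex, not just one section. This freedom is
  what allows two degeneracies to be compared vertex by vertex in \<open>EZ_unique\<close>.\<close>

lemma sect:
  assumes "degeneracy w" "length v = din w"
  shows "face (sect w v) \<and> din (sect w v) = dout w \<and> dout (sect w v) = din w \<and>
    run (sect w v) (run w v) = v \<and> (\<forall>u. length u = dout w \<longrightarrow> run w (run (sect w v) u) = u)"
  using assms
proof (induction w arbitrary: v)
  case (Cons x w)
  then have "degeneracy w" by (simp add: degeneracy_def)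
  with Cons show ?case by (cases x) (auto simp: face_def degeneracy_def length_Suc_conv)
qed (simp add: face_def)

text \<open>The face spanned by the interval from \<open>lo\<close> to \<open>hi\<close>, and the projection onto it.\<close>

definition span :: "bool list \<Rightarrow> bool list \<Rightarrow> letter list" where
  "span lo hi = map2 (\<lambda>a b. if a = b then Const a else Keep) lo hi"

definition retr :: "bool list \<Rightarrow> bool list \<Rightarrow> letter list" where
  "retr lo hi = map2 (\<lambda>a b. if a = b then Del else Keep) lo hi"

lemma span_retr:
  assumes "length lo = n" "length hi = n"
  shows "face (span lo hi)" "degeneracy (retr lo hi)" "dout (span lo hi) = n" "din (retr lo hi) = n"
    "dout (retr lo hi) = din (span lo hi)"
proof -
  have "face (span lo hi) \<and> degeneracy (retr lo hi) \<and> dout (span lo hi) = n \<and> din (retr lo hi) = n \<and>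
    dout (retr lo hi) = din (span lo hi)"
    using assms
  proof (induction lo arbitrary: hi n)
    case (Cons a lo)
    then obtain b hi' m where "hi = b # hi'" "n = Suc m" "length lo = m" "length hi' = m"
      by (auto simp: length_Suc_conv)
    then show ?case using Cons.IH[of m hi'] by (auto simp: span_def retr_def face_def degeneracy_def)
  qed (simp add: span_def retr_def face_def degeneracy_def)
  then show "face (span lo hi)" "degeneracy (retr lo hi)" "dout (span lo hi) = n" "din (retr lo hi) = n"
    "dout (retr lo hi) = din (span lo hi)" by auto
qed

text \<open>Where \<open>lo\<close> and \<open>hi\<close> agree, every \<open>v\<close> between them
  has the same coordinate, so the constant restores what the projection forgot.\<close>

lemma run_span_retr:
  assumes "list_all2 (\<le>) lo v" "list_all2 (\<le>) v hi"
  shows "run (span lo hi) (run (retr lo hi) v) = v"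
  using assms
proof (induction lo v arbitrary: hi rule: list_all2_induct)
  case (Cons a lo b v)
  then show ?case by (cases hi) (auto simp: span_def retr_def)
qed (auto simp: span_def retr_def)

lemma run_retr_span:
  assumes "length lo = length hi" "length u = din (span lo hi)"
  shows "run (retr lo hi) (run (span lo hi) u) = u"
  using assms
proof (induction lo hi arbitrary: u rule: list_induct2)
  case (Cons a lo b hi)
  then show ?case by (auto simp: span_def retr_def length_Suc_conv)
qed (auto simp: span_def retr_def)

lemma run_retr_ends:
  assumes "list_all2 (\<le>) lo hi"
  shows "run (retr lo hi) lo = bot_pt (din (span lo hi))" "run (retr lo hi) hi = top_pt (din (span lo hi))"
  using assms by (induction lo hi rule: list_all2_induct) (auto simp: span_def retr_def)

text \<open>A face word can be read off from the images of the end vertices. This is why a simplex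
  determines the face in whose interior it lies.\<close>

lemma span_face: "face w \<Longrightarrow> span (run w (bot_pt (din w))) (run w (top_pt (din w))) = w"
proof (induction w)
  case (Cons x w)
  then show ?case by (cases x) (auto simp: face_def span_def)
qed (simp add: span_def)

text \<open>The image of \<open>w\<close> lies in the interval between the images of bottom and top.
  Projecting onto the face spanned by this interval turns \<open>w\<close> into a map that fixes the
  end vertices, which is a degeneracy by \<open>degeneracy_iff\<close>. Only the functions are
  equal, since a box map may have several words.\<close>

lemma word_factor: "\<exists>d p. face d \<and> degeneracy p \<and> din d = dout p \<and> din p = din w \<and> dout d = dout w \<and>
   wmap w = wmap (wcomp d p)"
proof -
  let ?lo = "run w (bot_pt (din w))" and ?hi = "run w (top_pt (din w))"
  have le: "list_all2 (\<le>) ?lo (run w v)" "list_all2 (\<le>) (run w v) ?hi" if "length v = din w" for v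
    using that by (auto intro!: run_mono bot_pt_le le_top_pt)
  note sr = span_retr[of ?lo "dout w" ?hi, simplified]
  define p where "p = wcomp (retr ?lo ?hi) w"
  have p: "din p = din w" "dout p = din (span ?lo ?hi)" by (simp_all add: p_def sr)
  have "list_all2 (\<le>) ?lo ?hi" using le(1)[of "top_pt (din w)"] by simp
  then have "degeneracy p" unfolding degeneracy_iff p by (simp add: p_def sr run_retr_ends)
  moreover have "wmap w = wmap (wcomp (span ?lo ?hi) p)"
    by (rule wmap_eqI) (simp_all add: p sr, simp add: p_def sr run_span_retr[OF le])
  ultimately show ?thesis using p sr by metis
qed

abbreviation pull :: "'x cset \<Rightarrow> letter list \<Rightarrow> 'x \<Rightarrow> 'x" where
  "pull L w \<equiv> act L (wmap w)"

lemma pull_in_sec: "is_presheaf Box L \<Longrightarrow> x \<in> sec L (dout w) \<Longrightarrow> pull L w x \<in> sec L (din w)"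
  using act_in_sec[of Box L "wmap w"] by simp

lemma pull_wcomp: "is_presheaf Box L \<Longrightarrow> din u = dout w \<Longrightarrow> x \<in> sec L (dout u) \<Longrightarrow>
    pull L w (pull L u x) = pull L (wcomp u w) x"
  using act_Comp[of Box L "wmap w" "wmap u" x] by (simp add: Comp_wmap)

lemma pull_Keep: "is_presheaf Box L \<Longrightarrow> x \<in> sec L n \<Longrightarrow> pull L (replicate n Keep) x = x"
  using act_Id[of Box L n x] by (simp add: Id_Box)

section \<open>The Eilenberg--Zilber lemma and normal forms of simplices\<close>

text \<open>By \<open>degeneracy_id\<close>, the condition \<open>dout p = n\<close> makes
  \<open>p\<close> the identity word.\<close>

definition nondegenerate :: "'x cset \<Rightarrow> nat \<Rightarrow> 'x \<Rightarrow> bool" where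
  "nondegenerate L n c \<longleftrightarrow> c \<in> sec L n \<and>
     (\<forall>p d. degeneracy p \<longrightarrow> din p = n \<longrightarrow> d \<in> sec L (dout p) \<longrightarrow> c = pull L p d \<longrightarrow> dout p = n)"

definition EZ_decomposition :: "'x cset \<Rightarrow> nat \<Rightarrow> 'x \<Rightarrow> letter list \<Rightarrow> 'x \<Rightarrow> bool" where
  "EZ_decomposition L n x p c \<longleftrightarrow> degeneracy p \<and> din p = n \<and> nondegenerate L (dout p) c \<and> x = pull L p c"

lemma degeneracy_wcomp: "degeneracy u \<Longrightarrow> degeneracy w \<Longrightarrow> din u = dout w \<Longrightarrow> degeneracy (wcomp u w)"
  by (simp add: degeneracy_iff)

lemma EZ_exists:
  assumes L: "is_presheaf Box L" and "x \<in> sec L n"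
  shows "\<exists>p c. EZ_decomposition L n x p c"
  using assms(2)
proof (induction n arbitrary: x rule: less_induct)
  case (less n)
  show ?case
  proof (cases "nondegenerate L n x")
    case True
    then show ?thesis using pull_Keep[OF L less.prems]
      by (intro exI[of _ "replicate n Keep"] exI[of _ x]) (simp add: EZ_decomposition_def)
  next
    case False
    then obtain q d where q: "degeneracy q" "din q = n" "d \<in> sec L (dout q)" "x = pull L q d" "dout q \<noteq> n"
      using less.prems unfolding nondegenerate_def by blast
    then have "dout q < n" using degeneracy_le[of q] by simp
    then obtain p c where p: "EZ_decomposition L (dout q) d p c" using less.IH q by blast
    then have "EZ_decomposition L n x (wcomp p q) c"
      using q by (auto simp: EZ_decomposition_def degeneracy_wcomp pull_wcomp[OF L] nondegenerate_def)
    then show ?thesis by blast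
  qed
qed

text \<open>Pulling back along a section of \<open>p\<close> turns \<open>x\<close> into \<open>c\<close>, and nondegeneracy forces the
  composite of \<open>q\<close> with that section to be a face.\<close>

lemma EZ_section:
  assumes L: "is_presheaf Box L" and p: "EZ_decomposition L n x p c" and q: "EZ_decomposition L n x q d" and v: "length v = n"
  shows "\<exists>f. face f \<and> wmap (wcomp q (sect p v)) = wmap f"
    and "c = pull L (wcomp q (sect p v)) d"
proof -
  let ?s = "sect p v"
  have s: "face ?s" "din ?s = dout p" "dout ?s = n" "\<And>u. length u = dout p \<Longrightarrow> run p (run ?s u) = u"
    using sect[of p v] p v by (auto simp: EZ_decomposition_def)
  have c: "c \<in> sec L (dout p)" "din p = n" "x = pull L p c" and d: "d \<in> sec L (dout q)" "din q = n" "x = pull L q d"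
    using p q by (auto simp: EZ_decomposition_def nondegenerate_def)
  have "wmap (wcomp p ?s) = wmap (replicate (dout p) Keep)"
    using s c by (intro wmap_eqI) (simp_all add: run_Keep)
  then have "c = pull L ?s x"
    using pull_wcomp[OF L, of p ?s c] c s pull_Keep[OF L c(1)] by simp
  also have "\<dots> = pull L (wcomp q ?s) d"
    using pull_wcomp[OF L, of q ?s d] d s by simp
  finally show cd: "c = pull L (wcomp q ?s) d" .
  obtain f r where f: "face f" "degeneracy r" "din f = dout r" "din r = din (wcomp q ?s)" "dout f = dout (wcomp q ?s)"
    "wmap (wcomp q ?s) = wmap (wcomp f r)" using word_factor by blast
  have dim: "din (wcomp q ?s) = dout p" "dout (wcomp q ?s) = dout q" using d s by simp_all
  have "c = pull L r (pull L f d)" using cd f pull_wcomp[OF L, of f r d] d dim by simp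
  then have "dout r = dout p"
    using p f dim d pull_in_sec[OF L, of d f] unfolding EZ_decomposition_def nondegenerate_def by metis
  then have "r = replicate (dout p) Keep" using degeneracy_id[OF f(2)] f dim by simp
  then have "wmap (wcomp f r) = wmap f" using f by (intro wmap_eqI) (simp_all add: run_Keep)
  with f show "\<exists>f. face f \<and> wmap (wcomp q ?s) = wmap f" by auto
qed

text \<open>Composing \<open>q\<close> with a section of \<open>p\<close> gives a face from
  dimension \<open>dout p\<close> to \<open>dout q\<close>, hence an inequality; by symmetry the
  dimensions agree, and a face between equal dimensions is the identity. Thus \<open>c = d\<close>.
  The words \<open>p\<close> and \<open>q\<close> themselves are compared only as functions.\<close>

lemma EZ_unique:
  assumes L: "is_presheaf Box L" and p: "EZ_decomposition L n x p c" and q: "EZ_decomposition L n x q d"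
  shows "dout p = dout q" "c = d" "\<And>v. length v = n \<Longrightarrow> run p v = run q v"
proof -
  have le: "dout p \<le> dout q" if p: "EZ_decomposition L n x p c" and q: "EZ_decomposition L n x q d" for p q c d
  proof -
    let ?v = "bot_pt n"
    have s: "din (sect p ?v) = dout p" "dout (sect p ?v) = n" using sect[of p ?v] p by (auto simp: EZ_decomposition_def)
    have "din q = n" using q by (simp add: EZ_decomposition_def)
    then have dims: "din (wcomp q (sect p ?v)) = dout p" "dout (wcomp q (sect p ?v)) = dout q" using s by simp_all
    obtain f where "face f" "wmap (wcomp q (sect p ?v)) = wmap f" using EZ_section(1)[OF L p q, of ?v] by auto
    then show ?thesis using face_le[of f] dims by (metis src_wmap tgt_wmap)
  qed
  show pq: "dout p = dout q" using le[OF p q] le[OF q p] by simp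
  have id: "wmap (wcomp q (sect p v)) = wmap (replicate (dout q) Keep)" if v: "length v = n" for v
  proof -
    have s: "din (sect p v) = dout p" "dout (sect p v) = n" using sect[of p v] p v by (auto simp: EZ_decomposition_def)
    have "din q = n" using q by (simp add: EZ_decomposition_def)
    then have dims: "din (wcomp q (sect p v)) = dout p" "dout (wcomp q (sect p v)) = dout q" using s by simp_all
    obtain f where f: "face f" "wmap (wcomp q (sect p v)) = wmap f" using EZ_section(1)[OF L p q v] by auto
    then have "din f = dout q" "dout f = dout q" using dims pq by (metis src_wmap, metis tgt_wmap)
    then show ?thesis using face_id[OF f(1)] f(2) by simp
  qed
  show "c = d" using EZ_section(2)[OF L p q, of "bot_pt n"] id[of "bot_pt n"] pull_Keep[OF L, of d] q
    by (simp add: EZ_decomposition_def nondegenerate_def)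
  show "run p v = run q v" if v: "length v = n" for v
  proof -
    have s: "din (sect p v) = dout p" "dout (sect p v) = n" "run (sect p v) (run p v) = v"
      using sect[of p v] p v by (auto simp: EZ_decomposition_def)
    have q': "din q = n" using q by (simp add: EZ_decomposition_def)
    \<comment> \<open>Evaluated at \<open>run p v\<close>, the section through \<open>v\<close>
      returns \<open>v\<close>, so the left side is \<open>run q v\<close>.\<close>
    have "fn (wmap (wcomp q (sect p v))) (run p v) = fn (wmap (replicate (dout q) Keep)) (run p v)"
      using id[OF v] by simp
    then show ?thesis using s q' pq by (simp add: run_Keep)
  qed
qed

section \<open>Chains in cubes\<close>

lemma pts_ordinal [simp]: "pts (ordinal n) = {0..n}" and leq_ordinal [simp]: "leq (ordinal n) = (\<le>)"
  by (simp_all add: ordinal_def)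

definition cube_chains :: "nat \<Rightarrow> nat \<Rightarrow> (nat \<Rightarrow> bool list) set" where
  "cube_chains k m = mono_maps (ordinal k) (cube m)"

lemma chains_iff: "s \<in> cube_chains k m \<longleftrightarrow> s \<in> extensional {0..k} \<and> (\<forall>i\<le>k. length (s i) = m) \<and>
    (\<forall>i j. i \<le> j \<longrightarrow> j \<le> k \<longrightarrow> list_all2 (\<le>) (s i) (s j))"
  unfolding cube_chains_def mono_maps_def by (auto simp: monotone_on_def PiE_iff)

lemma chains_eqI: "s \<in> cube_chains k m \<Longrightarrow> t \<in> cube_chains k n \<Longrightarrow> (\<And>i. i \<le> k \<Longrightarrow> s i = t i) \<Longrightarrow> s = t"
  by (rule extensionalityI[of _ "{0..k}"]) (auto simp: chains_iff)

definition post :: "nat \<Rightarrow> letter list \<Rightarrow> (nat \<Rightarrow> bool list) \<Rightarrow> nat \<Rightarrow> bool list" where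
  "post k w s = (\<lambda>i\<in>{0..k}. run w (s i))"

lemma post_apply [simp]: "i \<le> k \<Longrightarrow> post k w s i = run w (s i)"
  by (simp add: post_def)

lemma post_chains: "s \<in> cube_chains k (din w) \<Longrightarrow> post k w s \<in> cube_chains k (dout w)"
  by (auto simp: chains_iff run_mono) (simp add: post_def)

lemma post_post: "s \<in> cube_chains k (din w) \<Longrightarrow> din u = dout w \<Longrightarrow> post k u (post k w s) = post k (wcomp u w) s"
  by (auto simp: post_def chains_iff fun_eq_iff)

definition pre :: "nat \<Rightarrow> (nat \<Rightarrow> 'p) \<Rightarrow> (nat \<Rightarrow> nat) \<Rightarrow> nat \<Rightarrow> 'p" where
  "pre k s \<theta> = (\<lambda>i\<in>{0..k}. s (\<theta> i))"

lemma pre_apply [simp]: "i \<le> k \<Longrightarrow> pre k s \<theta> i = s (\<theta> i)"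
  by (simp add: pre_def)

abbreviation simplicial_op :: "nat \<Rightarrow> nat \<Rightarrow> (nat \<Rightarrow> nat) \<Rightarrow> bool" where
  "simplicial_op j k \<theta> \<equiv> \<theta> \<in> mono_maps (ordinal j) (ordinal k)"

lemma simplicial_op_iff: "simplicial_op j k \<theta> \<longleftrightarrow> \<theta> \<in> extensional {0..j} \<and> (\<forall>i\<le>j. \<theta> i \<le> k) \<and>
    (\<forall>i i'. i \<le> i' \<longrightarrow> i' \<le> j \<longrightarrow> \<theta> i \<le> \<theta> i')"
  unfolding mono_maps_def by (auto simp: monotone_on_def PiE_iff)

lemma pre_chains: "s \<in> cube_chains k m \<Longrightarrow> simplicial_op j k \<theta> \<Longrightarrow> pre j s \<theta> \<in> cube_chains j m"
  unfolding simplicial_op_iff by (auto simp: chains_iff) (simp add: pre_def)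

lemma pre_post: "simplicial_op j k \<theta> \<Longrightarrow> pre j (post k w s) \<theta> = post j w (pre j s \<theta>)"
  by (auto simp: pre_def post_def simplicial_op_iff fun_eq_iff)

text \<open>These are the simplices of the cube that lie in no proper face: a constant coordinate is
  incompatible with one of the two ends.\<close>

definition bchains :: "nat \<Rightarrow> nat \<Rightarrow> (nat \<Rightarrow> bool list) set" where
  "bchains k m = {s \<in> cube_chains k m. s 0 = bot_pt m \<and> s k = top_pt m}"

lemma post_bchains: "s \<in> bchains k (din w) \<Longrightarrow> degeneracy w \<Longrightarrow> post k w s \<in> bchains k (dout w)"
  by (auto simp: bchains_def post_chains degeneracy_iff)

lemma chain_span:
  assumes s: "s \<in> cube_chains k m"
  shows "post k (retr (s 0) (s k)) s \<in> bchains k (din (span (s 0) (s k)))"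
    and "post k (span (s 0) (s k)) (post k (retr (s 0) (s k)) s) = s"
proof -
  have l: "length (s 0) = m" "length (s k) = m" "list_all2 (\<le>) (s 0) (s k)" using s by (auto simp: chains_iff)
  note sr = span_retr[OF l(1,2)]
  show b: "post k (retr (s 0) (s k)) s \<in> bchains k (din (span (s 0) (s k)))"
    using post_chains[of s k "retr (s 0) (s k)"] s by (simp add: bchains_def sr run_retr_ends[OF l(3)])
  have 1: "post k (span (s 0) (s k)) (post k (retr (s 0) (s k)) s) \<in> cube_chains k m"
    using post_chains[of _ k "span (s 0) (s k)"] b sr by (simp add: bchains_def)
  show "post k (span (s 0) (s k)) (post k (retr (s 0) (s k)) s) = s"
    using s by (intro chains_eqI[OF 1 s]) (auto simp: run_span_retr chains_iff)
qed

text \<open>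
  The simplex \<open>s\<close> of the cube \<open>x\<close> lies in the interior of the face spanned by its end points; the
  normal form pushes it down to the nondegenerate cube from which that face of \<open>x\<close> degenerates.
\<close>

definition normal_form :: "'x cset \<Rightarrow> nat \<Rightarrow> 'x \<Rightarrow> nat \<Rightarrow> (nat \<Rightarrow> bool list) \<Rightarrow> nat \<times> 'x \<times> (nat \<Rightarrow> bool list)" where
  "normal_form L m x k s =
     (let d = span (s 0) (s k); (p, c) = (SOME (p, c). EZ_decomposition L (din d) (pull L d x) p c)
      in (dout p, c, post k p (post k (retr (s 0) (s k)) s)))"

text \<open>Neither the face nor the decomposition chosen by \<open>SOME\<close> matters:
  \<open>span_face\<close> recovers \<open>d\<close> from the ends of the simplex, and
  \<open>EZ_unique\<close> identifies any two decompositions. Every presentation of the simplex may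
  therefore be used to compute its normal form.\<close>

lemma normal_form_eqI:
  assumes L: "is_presheaf Box L" and d: "face d" "dout d = m" and s: "s \<in> bchains k (din d)"
    and p: "EZ_decomposition L (din d) (pull L d x) p c"
  shows "normal_form L m x k (post k d s) = (dout p, c, post k p s)"
proof -
  let ?s = "post k d s"
  have d_eq: "span (?s 0) (?s k) = d"
    using s span_face[OF d(1)] by (auto simp: bchains_def)
  have r: "post k (retr (?s 0) (?s k)) ?s = s"
  proof (rule chains_eqI)
    show "s \<in> cube_chains k (din d)" using s by (simp add: bchains_def)
    have "?s \<in> cube_chains k m" using s post_chains[of s k d] d by (simp add: bchains_def)
    then show "post k (retr (?s 0) (?s k)) ?s \<in> cube_chains k (din d)"
      using chain_span(1) d_eq by (fastforce simp: bchains_def)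
    show "post k (retr (?s 0) (?s k)) ?s i = s i" if i: "i \<le> k" for i
    proof -
      have "length (s i) = din d" using s i by (auto simp: bchains_def chains_iff)
      then show ?thesis using run_retr_span[of "?s 0" "?s k" "s i"] i d_eq by simp
    qed
  qed
  obtain q e where q: "(SOME (p, c). EZ_decomposition L (din d) (pull L d x) p c) = (q, e)" by fastforce
  have "case (SOME (p, c). EZ_decomposition L (din d) (pull L d x) p c) of (p, c) \<Rightarrow> EZ_decomposition L (din d) (pull L d x) p c"
    by (rule someI[of _ "(p, c)"]) (simp add: p)
  then have q': "EZ_decomposition L (din d) (pull L d x) q e" by (simp add: q)
  have "post k q s = post k p s"
    using s EZ_unique(3)[OF L q' p] by (auto simp: post_def fun_eq_iff bchains_def chains_iff)
  then show ?thesis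
    unfolding normal_form_def d_eq Let_def r q using EZ_unique(1,2)[OF L q' p] by simp
qed

lemma normal_form_cases:
  assumes L: "is_presheaf Box L" and x: "x \<in> sec L m" and s: "s \<in> cube_chains k m"
  obtains d s' p c where "face d" "dout d = m" "s' \<in> bchains k (din d)" "s = post k d s'"
    "EZ_decomposition L (din d) (pull L d x) p c" "normal_form L m x k s = (dout p, c, post k p s')"
proof -
  let ?d = "span (s 0) (s k)" and ?s = "post k (retr (s 0) (s k)) s"
  have l: "length (s 0) = m" "length (s k) = m" using s by (auto simp: chains_iff)
  note sr = span_retr[OF l] and cs = chain_span[OF s]
  obtain p c where p: "EZ_decomposition L (din ?d) (pull L ?d x) p c"
    using EZ_exists[OF L pull_in_sec[OF L, of x ?d]] x sr by auto
  show ?thesis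
    using that[OF sr(1,3) cs(1) cs(2)[symmetric] p] normal_form_eqI[OF L sr(1,3) cs(1) p] cs(2) by simp
qed

lemma EZ_wcomp: "is_presheaf Box L \<Longrightarrow> EZ_decomposition L (dout w) y p c \<Longrightarrow> degeneracy w \<Longrightarrow>
    EZ_decomposition L (din w) (pull L w y) (wcomp p w) c"
  using pull_wcomp[of L p w c] by (auto simp: EZ_decomposition_def degeneracy_wcomp nondegenerate_def)

lemma pull_cong: "wmap u = wmap w \<Longrightarrow> pull L u x = pull L w x" by simp

text \<open>In \<open>tri L\<close> the simplex \<open>s\<close> of a pulled back cube is identified
  with the simplex \<open>post k w s\<close> of the cube itself; normal forms have to respect this.
  Factoring \<open>w\<close> after \<open>d\<close> as a face \<open>d'\<close> after a degeneracy
  \<open>r\<close> presents both sides over the same nondegenerate cube.\<close>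

lemma normal_form_pull:
  assumes L: "is_presheaf Box L" and x: "x \<in> sec L (dout w)" and s: "s \<in> cube_chains k (din w)"
  shows "normal_form L (din w) (pull L w x) k s = normal_form L (dout w) x k (post k w s)"
proof -
  obtain d s' p c where d: "face d" "dout d = din w" and s': "s' \<in> bchains k (din d)" and ss': "s = post k d s'"
    and p: "EZ_decomposition L (din d) (pull L d (pull L w x)) p c"
    and N: "normal_form L (din w) (pull L w x) k s = (dout p, c, post k p s')"
    using normal_form_cases[OF L pull_in_sec[OF L x] s] by metis
  obtain d' r where d': "face d'" "degeneracy r" "din d' = dout r" "din r = din d" "dout d' = dout w"
    and wd: "wmap (wcomp w d) = wmap (wcomp d' r)"
    using word_factor[of "wcomp w d"] d by auto
  have xd': "pull L d' x \<in> sec L (dout r)" using pull_in_sec[OF L, of x d'] x d' by simp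
  obtain p' c' where p': "EZ_decomposition L (dout r) (pull L d' x) p' c'" using EZ_exists[OF L xd'] by blast
  have "pull L d (pull L w x) = pull L r (pull L d' x)"
    using pull_wcomp[OF L, of w d x] pull_wcomp[OF L, of d' r x] d d' x pull_cong[OF wd] by simp
  \<comment> \<open>Together with \<open>p\<close> this is a second decomposition of one and the
    same cube, and \<open>EZ_unique\<close> compares the two.\<close>
  then have p'r: "EZ_decomposition L (din d) (pull L d (pull L w x)) (wcomp p' r) c'"
    using EZ_wcomp[OF L p' d'(2)] d' by simp
  note u = EZ_unique[OF L p p'r]
  have dp': "din p' = dout r" using p' by (simp add: EZ_decomposition_def)
  have s'c: "s' \<in> cube_chains k (din d)" using s' by (simp add: bchains_def)
  have pr: "post k w s = post k d' (post k r s')"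
  proof -
    have "run w (run d v) = run d' (run r v)" if "length v = din d" for v
      using arg_cong[OF wd, of "\<lambda>f. fn f v"] that d d' by simp
    then show ?thesis using s'c by (auto simp: ss' post_def fun_eq_iff chains_iff)
  qed
  have rs: "post k r s' \<in> bchains k (din d')" using post_bchains[of s' k r] s' d' by simp
  have "normal_form L (dout w) x k (post k w s) = (dout p', c', post k p' (post k r s'))"
    unfolding pr using normal_form_eqI[OF L d'(1,5) rs, of x p' c'] p' d' by simp
  also have "\<dots> = (dout p, c, post k p s')"
    using u dp' d' post_post[of s' k r p'] s'c by (auto simp: post_def fun_eq_iff chains_iff)
  finally show ?thesis using N by simp
qed

definition normals :: "'x cset \<Rightarrow> nat \<Rightarrow> (nat \<times> 'x \<times> (nat \<Rightarrow> bool list)) set" where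
  "normals L k = {(n, c, t). nondegenerate L n c \<and> t \<in> bchains k n}"

lemma normal_form_normals:
  assumes "is_presheaf Box L" "x \<in> sec L m" "s \<in> cube_chains k m"
  shows "normal_form L m x k s \<in> normals L k"
proof -
  obtain d s' p c where "face d" "dout d = m" "s' \<in> bchains k (din d)" "s = post k d s'"
    "EZ_decomposition L (din d) (pull L d x) p c" "normal_form L m x k s = (dout p, c, post k p s')"
    using normal_form_cases[OF assms] by metis
  then show ?thesis using post_bchains[of s' k p] by (auto simp: normals_def EZ_decomposition_def)
qed

lemma post_Keep: "s \<in> cube_chains k n \<Longrightarrow> post k (replicate n Keep) s = s"
  using post_chains[of s k "replicate n Keep"]
  by (intro chains_eqI[of _ k n]) (auto simp: chains_iff run_Keep)

lemma normal_form_normal: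
  assumes L: "is_presheaf Box L" and "nondegenerate L n c" "t \<in> bchains k n"
  shows "normal_form L n c k t = (n, c, t)"
proof -
  have "c \<in> sec L n" using assms by (simp add: nondegenerate_def)
  then show ?thesis
    using normal_form_eqI[OF L, of "replicate n Keep" n t k c "replicate n Keep" c] assms
    by (simp add: EZ_decomposition_def pull_Keep[OF L] post_Keep bchains_def)
qed

text \<open>A face of a simplex may drop into a proper face of its cube, so restriction has to be
  followed by renormalisation. Normalising beforehand changes nothing, since it only moves the
  simplex along \<open>d\<close> and \<open>p\<close>, which \<open>normal_form_pull\<close>
  permits.\<close>

lemma normal_form_pre:
  assumes L: "is_presheaf Box L" and x: "x \<in> sec L m" and s: "s \<in> cube_chains k m" and \<theta>: "simplicial_op j k \<theta>"
    and N: "normal_form L m x k s = (n, c, t)"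
  shows "normal_form L n c j (pre j t \<theta>) = normal_form L m x j (pre j s \<theta>)"
proof -
  obtain d s' p where d: "face d" "dout d = m" and s': "s' \<in> bchains k (din d)" and ss': "s = post k d s'"
    and p: "EZ_decomposition L (din d) (pull L d x) p c" and n: "n = dout p" and t: "t = post k p s'"
    using normal_form_cases[OF L x s] N by (metis prod.inject)
  have s'c: "pre j s' \<theta> \<in> cube_chains j (din d)" using s' pre_chains[OF _ \<theta>] by (simp add: bchains_def)
  have p': "din p = din d" "c \<in> sec L (dout p)" "pull L d x = pull L p c"
    using p by (auto simp: EZ_decomposition_def nondegenerate_def)
  have "normal_form L m x j (pre j s \<theta>) = normal_form L m x j (post j d (pre j s' \<theta>))"
    using pre_post[OF \<theta>] by (simp add: ss')
  also have "\<dots> = normal_form L (din d) (pull L p c) j (pre j s' \<theta>)"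
    using normal_form_pull[OF L, of x d] x d s'c p' by simp
  also have "\<dots> = normal_form L n c j (post j p (pre j s' \<theta>))"
    using normal_form_pull[OF L, of c p] p' s'c n by simp
  also have "\<dots> = normal_form L n c j (pre j t \<theta>)"
    using pre_post[OF \<theta>] by (simp add: t)
  finally show ?thesis by simp
qed

section \<open>The simplex category and the nerves of cubes\<close>

lemma Obj_Simplex [simp]: "Obj Simplex = UNIV" and Dom_Simplex [simp]: "Dom Simplex = src"
  and Cod_Simplex [simp]: "Cod Simplex = tgt"
  by (simp_all add: Simplex_def)

lemma Arr_Simplex: "f \<in> Arr Simplex \<longleftrightarrow> simplicial_op (src f) (tgt f) (fn f)"
  by (cases f) (auto simp: Simplex_def)

lemma fn_Id_Simplex: "fn (Id Simplex k) = (\<lambda>i\<in>{0..k}. i)" "src (Id Simplex k) = k" "tgt (Id Simplex k) = k"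
  by (simp_all add: Simplex_def)

lemma fn_Comp_Simplex: "fn (Comp Simplex g f) = pre (src f) (fn g) (fn f)"
  "src (Comp Simplex g f) = src f" "tgt (Comp Simplex g f) = tgt g"
  by (simp_all add: Simplex_def pre_def compose_def)

lemma category_Simplex: "is_category Simplex"
  unfolding is_category_def
proof (intro conjI ballI impI)
  fix f assume "f \<in> Arr Simplex"
  then show "Comp Simplex f (Id Simplex (Dom Simplex f)) = f" "Comp Simplex (Id Simplex (Cod Simplex f)) f = f"
    by (auto intro!: arrow.expand simp: fn_Comp_Simplex fn_Id_Simplex Arr_Simplex simplicial_op_iff pre_def
        extensional_def fun_eq_iff)
next
  fix f g h assume "f \<in> Arr Simplex" "g \<in> Arr Simplex" "h \<in> Arr Simplex"
    "Dom Simplex g = Cod Simplex f" "Dom Simplex h = Cod Simplex g"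
  then show "Comp Simplex h (Comp Simplex g f) = Comp Simplex (Comp Simplex h g) f"
    by (intro arrow.expand) (auto simp: fn_Comp_Simplex Arr_Simplex simplicial_op_iff pre_def fun_eq_iff)
next
  fix f g assume "f \<in> Arr Simplex" "g \<in> Arr Simplex" "Dom Simplex g = Cod Simplex f"
  then show "Comp Simplex g f \<in> Hom Simplex (Dom Simplex f) (Cod Simplex g)"
    by (simp add: Hom_def fn_Comp_Simplex Arr_Simplex simplicial_op_iff) (simp add: pre_def)
qed (auto simp: Hom_def fn_Id_Simplex Arr_Simplex simplicial_op_iff)

lemma sec_nerve [simp]: "sec (nerve (cube m)) k = cube_chains k m"
  by (simp add: nerve_def cube_chains_def)

lemma act_nerve [simp]: "act (nerve P) f s = pre (src f) s (fn f)"
  by (simp add: nerve_def pre_def compose_def)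

lemma pre_pre: "simplicial_op j k \<theta> \<Longrightarrow> pre j (pre k s \<psi>) \<theta> = pre j s (pre j \<psi> \<theta>)"
  by (auto simp: pre_def simplicial_op_iff fun_eq_iff)

lemma pre_id: "s \<in> cube_chains k m \<Longrightarrow> pre k s (\<lambda>i\<in>{0..k}. i) = s"
  by (auto simp: pre_def chains_iff extensional_def fun_eq_iff)

lemma presheaf_nerve: "is_presheaf Simplex (nerve (cube m))"
  unfolding is_presheaf_def
  by (auto simp: fn_Id_Simplex fn_Comp_Simplex pre_pre pre_id Arr_Simplex intro: pre_chains)

section \<open>The simplicial set of normal forms\<close>

lemma pre_bchains_normal:
  "(n, c, t) \<in> normals L k \<Longrightarrow> nondegenerate L n c \<and> c \<in> sec L n \<and> t \<in> cube_chains k n"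
  by (auto simp: normals_def bchains_def nondegenerate_def)

text \<open>An extensional chain is determined by its \<open>k + 1\<close> values, so the dimension
  and the chain form countable data and embed into \<open>'u\<close>; the cube \<open>c\<close>
  already lies there, and the two codes are paired. This puts normal forms into the universe that
  maps out of \<open>tri L\<close> can see.\<close>

lemma chains_code:
  assumes "infinite (UNIV :: 'u set)"
  shows "\<exists>e :: nat \<times> 'u \<times> (nat \<Rightarrow> bool list) \<Rightarrow> 'u. inj_on e {(n, c, t). t \<in> extensional {0..k}}"
proof -
  obtain i :: "nat \<Rightarrow> 'u" where i: "inj i" using infinite_countable_subset[OF assms] by blast
  obtain e :: "'u \<times> 'u \<Rightarrow> 'u" where e: "inj e" using infinite_pair_inj[OF assms] by blast
  let ?e = "\<lambda>(n, c, t). e (i (to_nat (n :: nat, map t [0..<Suc k] :: bool list list)), c)"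
  have "inj_on ?e {(n, c, t). t \<in> extensional {0..k}}"
  proof (rule inj_onI)
    fix p p' :: "nat \<times> 'u \<times> (nat \<Rightarrow> bool list)"
    assume pp': "p \<in> {(n, c, t). t \<in> extensional {0..k}}" "p' \<in> {(n, c, t). t \<in> extensional {0..k}}" "?e p = ?e p'"
    obtain n c t n' c' t' where p: "p = (n, c, t)" "p' = (n', c', t')" by (metis prod_cases3)
    then have t: "t \<in> extensional {0..k}" "t' \<in> extensional {0..k}"
      and *: "e (i (to_nat (n, map t [0..<Suc k])), c) = e (i (to_nat (n', map t' [0..<Suc k])), c')"
      using pp' by (simp_all del: upt_Suc)
    have "to_nat (n, map t [0..<Suc k]) = to_nat (n', map t' [0..<Suc k])" "c = c'"
      using * injD[OF e] injD[OF i] by blast+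
    then have "n = n'" "map t [0..<Suc k] = map t' [0..<Suc k]" by (simp_all del: upt_Suc)
    then have "n = n'" "\<forall>j\<in>set [0..<Suc k]. t j = t' j" by (simp_all only: map_eq_conv)
    moreover have "t = t'"
      by (rule extensionalityI[OF t]) (use calculation(2) in auto)
    ultimately show "p = p'" using \<open>c = c'\<close> p by simp
  qed
  then show ?thesis by blast
qed

text \<open>The model \<open>S\<close> serves to tell simplices of \<open>tri L\<close> apart. Its
  simplices are coded normal forms, \<Psi> sends a simplex of a cube to its normal form, the third
  clause is the compatibility that lets \<Psi> descend to \<open>tri L\<close>, and the last one
  holds because a normal pair is its own normal form.\<close>

lemma normal_form_model:
  fixes L :: "'u cset"
  assumes inf: "infinite (UNIV :: 'u set)" and L: "is_presheaf Box L"
  shows "\<exists>(S :: 'u sset) \<Psi>. is_presheaf Simplex S \<and>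
    (\<forall>m. \<forall>x\<in>sec L m. \<Psi> m x \<in> psh_maps Simplex (nerve (cube m)) S) \<and>
    (\<forall>w. \<forall>x\<in>sec L (dout w). \<forall>k. \<forall>s\<in>cube_chains k (din w). \<Psi> (din w) (pull L w x) k s = \<Psi> (dout w) x k (post k w s)) \<and>
    (\<forall>n c m d k. \<forall>t\<in>bchains k n. \<forall>t'\<in>bchains k m. nondegenerate L n c \<longrightarrow> nondegenerate L m d \<longrightarrow>
       \<Psi> n c k t = \<Psi> m d k t' \<longrightarrow> n = m \<and> c = d \<and> t = t')"
proof -
  obtain e :: "nat \<Rightarrow> nat \<times> 'u \<times> (nat \<Rightarrow> bool list) \<Rightarrow> 'u"
    where e: "\<And>k. inj_on (e k) {(n, c, t). t \<in> extensional {0..k}}"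
    using chains_code[OF inf] by metis
  have eN: "inj_on (e k) (normals L k)" for k
    by (rule inj_on_subset[OF e]) (auto simp: normals_def bchains_def chains_iff)
  \<comment> \<open>Restriction followed by renormalisation; functoriality is
    \<open>normal_form_pre\<close>.\<close>
  define A where "A = (\<lambda>f (n, c, t). normal_form L n c (src f) (pre (src f) t (fn f)))"
  define S where "S = \<lparr>sec = (\<lambda>k. e k ` normals L k),
    act = (\<lambda>f z. e (src f) (A f (inv_into (normals L (tgt f)) (e (tgt f)) z)))\<rparr>"
  have act_S: "act S f (e (tgt f) p) = e (src f) (A f p)" if "p \<in> normals L (tgt f)" for f p
    using inv_into_f_f[OF eN that] by (simp add: S_def)
  have A_normal: "A f p \<in> normals L (src f)" if f: "f \<in> Arr Simplex" and p: "p \<in> normals L (tgt f)" for f p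
    using p normal_form_normals[OF L] pre_bchains_normal f pre_chains
    by (cases p) (fastforce simp: A_def Arr_Simplex)
  have A_nf: "A f (normal_form L m x (tgt f) s) = normal_form L m x (src f) (pre (src f) s (fn f))"
    if "f \<in> Arr Simplex" "x \<in> sec L m" "s \<in> cube_chains (tgt f) m" for f m x s
    using normal_form_pre[OF L that(2,3)] that(1)
    by (cases "normal_form L m x (tgt f) s") (auto simp: A_def Arr_Simplex)
  have S: "is_presheaf Simplex S"
    unfolding is_presheaf_def
  proof (intro conjI ballI impI Pi_I)
    fix f z assume f: "f \<in> Arr Simplex" and "z \<in> sec S (Cod Simplex f)"
    then obtain p where "p \<in> normals L (tgt f)" "z = e (tgt f) p" by (auto simp: S_def)
    then show "act S f z \<in> sec S (Dom Simplex f)" using act_S A_normal[OF f] by (simp add: S_def)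
  next
    fix k z assume "z \<in> sec S k"
    then obtain p where p: "p \<in> normals L k" "z = e k p" by (auto simp: S_def)
    obtain n c t where "p = (n, c, t)" by (cases p)
    with p have "A (Id Simplex k) p = p"
      by (auto simp: A_def fn_Id_Simplex pre_id normals_def bchains_def normal_form_normal[OF L, unfolded bchains_def])
    then show "act S (Id Simplex k) z = z"
      using act_S[of p "Id Simplex k"] p by (simp add: fn_Id_Simplex)
  next
    fix f g z assume f: "f \<in> Arr Simplex" and g: "g \<in> Arr Simplex" and gf: "Dom Simplex g = Cod Simplex f"
      and "z \<in> sec S (Cod Simplex g)"
    then obtain p where p: "p \<in> normals L (tgt g)" "z = e (tgt g) p" by (auto simp: S_def)
    obtain n c t where pn: "p = (n, c, t)" by (cases p)
    note n = pre_bchains_normal[OF p(1)[unfolded pn]]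
    have "A f (A g p) = A (Comp Simplex g f) p"
      using A_nf[OF f, of c n "pre (src g) t (fn g)"] n pre_chains[of t "tgt g" n "fn g" "src g"] f g gf
      by (simp add: pn A_def fn_Comp_Simplex pre_pre Arr_Simplex)
    then show "act S (Comp Simplex g f) z = act S f (act S g z)"
      using act_S[of p g] act_S[of p "Comp Simplex g f"] act_S[of "A g p" f] A_normal[OF g] p gf
      by (simp add: fn_Comp_Simplex)
  qed
  define \<Psi> where "\<Psi> = (\<lambda>m x. \<lambda>k\<in>UNIV. \<lambda>s\<in>cube_chains k m. e k (normal_form L m x k s))"
  have "\<Psi> m x \<in> psh_maps Simplex (nerve (cube m)) S" if x: "x \<in> sec L m" for m x
  proof -
    have "(\<lambda>k\<in>Obj Simplex. \<lambda>s\<in>sec (nerve (cube m)) k. e k (normal_form L m x k s)) \<in> psh_maps Simplex (nerve (cube m)) S"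
    proof (rule psh_mapsI[OF is_category_Dom_Cod[OF category_Simplex] presheaf_nerve])
      fix k s assume "s \<in> sec (nerve (cube m)) k"
      then show "e k (normal_form L m x k s) \<in> sec S k"
        using normal_form_normals[OF L x] by (simp add: S_def)
    next
      fix f s assume "f \<in> Arr Simplex" "s \<in> sec (nerve (cube m)) (Cod Simplex f)"
      then show "e (Dom Simplex f) (normal_form L m x (Dom Simplex f) (act (nerve (cube m)) f s)) =
          act S f (e (Cod Simplex f) (normal_form L m x (Cod Simplex f) s))"
        using act_S[OF normal_form_normals[OF L x, of s "tgt f"]] A_nf x by simp
    qed auto
    then show ?thesis by (simp add: \<Psi>_def)
  qed
  moreover have "\<Psi> (din w) (pull L w x) k s = \<Psi> (dout w) x k (post k w s)"
    if "x \<in> sec L (dout w)" "s \<in> cube_chains k (din w)" for w x k s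
    using that post_chains normal_form_pull[OF L that] by (simp add: \<Psi>_def)
  moreover have "n = m \<and> c = d \<and> t = t'"
    if "t \<in> bchains k n" "t' \<in> bchains k m" "nondegenerate L n c" "nondegenerate L m d"
      "\<Psi> n c k t = \<Psi> m d k t'" for n c m d k t t'
  proof -
    have "e k (n, c, t) = e k (m, d, t')"
      using that normal_form_normal[OF L that(3,1)] normal_form_normal[OF L that(4,2)]
      by (simp add: \<Psi>_def bchains_def)
    then show ?thesis using inj_onD[OF eN, of k "(n, c, t)" "(m, d, t')"] that by (simp add: normals_def)
  qed
  ultimately show ?thesis using S by blast
qed

section \<open>The triangulation as a left adjoint\<close>

text \<open>\<open>X\<close> and \<open>Z\<close> may take values in different types, so \<eta> need
  not be an arrow that could be inverted in a presheaf category; \<sigma> after the inverse of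
  \<eta> is written out pointwise. It transports maps from the Yoneda embedding to its copy
  \<open>Y\<close>, and from nerves to their copies in \<open>'u\<close>.\<close>

lemma psh_maps_along_iso:
  assumes C: "is_category C" and Z: "is_presheaf C Z" and X: "is_presheaf C X"
    and \<eta>: "\<eta> \<in> psh_maps C X Z" and bij: "\<And>c. c \<in> Obj C \<Longrightarrow> bij_betw (\<eta> c) (sec X c) (sec Z c)"
    and \<sigma>: "\<sigma> \<in> psh_maps C X S"
  shows "(\<lambda>c\<in>Obj C. \<lambda>y\<in>sec Z c. \<sigma> c (inv_into (sec X c) (\<eta> c) y)) \<in> psh_maps C Z S"
proof (rule psh_mapsI[OF is_category_Dom_Cod[OF C] Z])
  fix c y assume "c \<in> Obj C" "y \<in> sec Z c"
  then show "\<sigma> c (inv_into (sec X c) (\<eta> c) y) \<in> sec S c"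
    using psh_maps_in_sec[OF \<sigma>] bij bij_betw_apply bij_betw_inv_into by metis
next
  fix f y assume f: "f \<in> Arr C" and y: "y \<in> sec Z (Cod C f)"
  note o = is_category_Dom_Cod[OF C f]
  obtain x where x: "x \<in> sec X (Cod C f)" "y = \<eta> (Cod C f) x"
    using bij[of "Cod C f"] o y unfolding bij_betw_def by blast
  have "act Z f y = \<eta> (Dom C f) (act X f x)" using psh_maps_act[OF \<eta> f x(1)] x by simp
  moreover have "act X f x \<in> sec X (Dom C f)" using act_in_sec[OF X f x(1)] .
  moreover have "inv_into (sec X (Dom C f)) (\<eta> (Dom C f)) (\<eta> (Dom C f) (act X f x)) = act X f x"
    "inv_into (sec X (Cod C f)) (\<eta> (Cod C f)) y = x"
    using bij o x calculation(2) by (auto intro: bij_betw_inv_into_left)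
  ultimately show "\<sigma> (Dom C f) (inv_into (sec X (Dom C f)) (\<eta> (Dom C f)) (act Z f y)) =
      act S f (\<sigma> (Cod C f) (inv_into (sec X (Cod C f)) (\<eta> (Cod C f)) y))"
    using psh_maps_act[OF \<sigma> f x(1)] by simp
qed auto

lemma sec_yoneda: "sec (fobj (yoneda C) c) a = Hom C a c" and act_yoneda: "act (fobj (yoneda C) c) f g = Comp C g f"
  by (simp_all add: yoneda_def Let_def)

lemma presheaf_yoneda: "is_category C \<Longrightarrow> is_presheaf C (fobj (yoneda C) c)"
  unfolding is_presheaf_def sec_yoneda act_yoneda by (auto simp: is_category_def Hom_def)

lemma farr_yoneda: "a \<in> Obj C \<Longrightarrow> h \<in> Hom C a (Dom C g) \<Longrightarrow> fn (farr (yoneda C) g) a h = Comp C g h"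
  by (simp add: yoneda_def Let_def)

abbreviation CS :: "('u cset, 'u cset_map) category" where "CS \<equiv> cubical_sets"
abbreviation SS :: "('u sset, 'u sset_map) category" where "SS \<equiv> simplicial_sets"

text \<open>The witnesses hidden in \<open>is_tri\<close> and \<open>is_qua\<close> are fixed so
  that constructions can refer to them: \<alpha> identifies \<open>Y\<close> with the Yoneda
  embedding, \<beta> identifies \<open>tri\<close> of a representable with the nerve of the cube,
  and \<phi> is the adjunction bijection.\<close>

locale tri_qua =
  fixes tri :: "('u cset, 'u cset_map, 'u sset, 'u sset_map) fctr"
    and qua :: "('u sset, 'u sset_map, 'u cset, 'u cset_map) fctr"
    and Y :: "(nat, (nat, bool list \<Rightarrow> bool list) arrow, 'u cset, 'u cset_map) fctr"
    and \<alpha> :: "nat \<Rightarrow> nat \<Rightarrow> (nat, bool list \<Rightarrow> bool list) arrow \<Rightarrow> 'u"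
    and \<beta> :: "nat \<Rightarrow> nat \<Rightarrow> (nat \<Rightarrow> bool list) \<Rightarrow> 'u"
    and \<phi> :: "'u cset \<Rightarrow> 'u sset \<Rightarrow> 'u sset_map \<Rightarrow> 'u cset_map"
  assumes tri: "is_functor CS SS tri" and qua: "is_functor SS CS qua" and Y: "is_functor Box CS Y"
    and \<alpha>_map: "\<alpha> m \<in> psh_maps Box (fobj (yoneda Box) m) (fobj Y m)"
    and \<alpha>_bij: "bij_betw (\<alpha> m n) (Hom Box n m) (sec (fobj Y m) n)"
    and \<alpha>_nat: "u \<in> Arr Box \<Longrightarrow> v \<in> Hom Box n (src u) \<Longrightarrow>
      \<alpha> (tgt u) n (Comp Box u v) = fn (farr Y u) n (\<alpha> (src u) n v)"
    and \<beta>_map: "\<beta> m \<in> psh_maps Simplex (nerve (cube m)) (fobj tri (fobj Y m))"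
    and \<beta>_bij: "bij_betw (\<beta> m k) (cube_chains k m) (sec (fobj tri (fobj Y m)) k)"
    and \<beta>_nat: "s \<in> cube_chains k (din w) \<Longrightarrow>
      \<beta> (dout w) k (post k w s) = fn (farr tri (farr Y (wmap w))) k (\<beta> (din w) k s)"
    and \<phi>_bij: "is_presheaf Box L \<Longrightarrow> is_presheaf Simplex S \<Longrightarrow>
      bij_betw (\<phi> L S) (Hom SS (fobj tri L) S) (Hom CS L (fobj qua S))"
    and \<phi>_nat_left: "f \<in> Hom CS L L' \<Longrightarrow> is_presheaf Simplex S \<Longrightarrow> g \<in> Hom SS (fobj tri L') S \<Longrightarrow>
      \<phi> L S (Comp SS g (farr tri f)) = Comp CS (\<phi> L' S g) f"
    and \<phi>_nat_right: "is_presheaf Box L \<Longrightarrow> h \<in> Hom SS S S' \<Longrightarrow> g \<in> Hom SS (fobj tri L) S \<Longrightarrow>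
      \<phi> L S' (Comp SS h g) = Comp CS (farr qua h) (\<phi> L S g)"
begin

lemmas HomC_eqI = Hom_presheaves_eqI[where C = Box, folded cubical_sets_def, simplified]
lemmas HomS_eqI = Hom_presheaves_eqI[where C = Simplex, folded simplicial_sets_def, simplified]
lemmas HomC = Hom_presheaves[where C = Box, folded cubical_sets_def]
lemmas HomS = Hom_presheaves[where C = Simplex, folded simplicial_sets_def]
lemmas CompC = Comp_in_Hom_presheaves[OF category_Box, folded cubical_sets_def]
lemmas CompS = Comp_in_Hom_presheaves[OF category_Simplex, folded simplicial_sets_def]
lemmas fn_CompC = fn_Comp_presheaves[where C = Box, folded cubical_sets_def, simplified]
lemmas fn_CompS = fn_Comp_presheaves[where C = Simplex, folded simplicial_sets_def, simplified]
lemmas HomC_in_sec = Hom_in_sec[where C = Box, folded cubical_sets_def, simplified]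
lemmas HomS_in_sec = Hom_in_sec[where C = Simplex, folded simplicial_sets_def, simplified]

section \<open>The Yoneda lemma for the copy \<open>Y\<close>\<close>

lemma Y_psh: "is_presheaf Box (fobj Y m)"
  using functor_obj[OF Y, of m] by (simp add: cubical_sets_def)
lemma tri_psh: "is_presheaf Box L \<Longrightarrow> is_presheaf Simplex (fobj tri L)"
  using functor_obj[OF tri, of L] by (simp add: cubical_sets_def simplicial_sets_def)
lemma qua_psh: "is_presheaf Simplex S \<Longrightarrow> is_presheaf Box (fobj qua S)"
  using functor_obj[OF qua, of S] by (simp add: cubical_sets_def simplicial_sets_def)

text \<open>The map classified by the cube \<open>x\<close>. An element of \<open>fobj Y m\<close>
  is only the name of a box map, which the inverse of \<alpha> recovers before it acts on
  \<open>x\<close>.\<close>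

definition yo :: "'u cset \<Rightarrow> nat \<Rightarrow> 'u \<Rightarrow> 'u cset_map" where
  "yo L m x = Arrow (fobj Y m) L
     (\<lambda>n\<in>UNIV. \<lambda>z\<in>sec (fobj Y m) n. act L (inv_into (Hom Box n m) (\<alpha> m n) z) x)"

lemma yo_Hom:
  assumes L: "is_presheaf Box L" and x: "x \<in> sec L m"
  shows "yo L m x \<in> Hom CS (fobj Y m) L"
proof -
  let ?\<sigma> = "\<lambda>n\<in>Obj Box. \<lambda>g\<in>sec (fobj (yoneda Box) m) n. act L g x"
  have "?\<sigma> \<in> psh_maps Box (fobj (yoneda Box) m) L"
  proof (rule psh_mapsI[OF is_category_Dom_Cod[OF category_Box] presheaf_yoneda[OF category_Box]])
    fix n g assume "g \<in> sec (fobj (yoneda Box) m) n"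
    then show "act L g x \<in> sec L n" using act_in_sec[OF L, of g x] x by (simp add: sec_yoneda Hom_def)
  next
    fix f g assume "f \<in> Arr Box" "g \<in> sec (fobj (yoneda Box) m) (Cod Box f)"
    then show "act L (act (fobj (yoneda Box) m) f g) x = act L f (act L g x)"
      using act_Comp[OF L, of f g x] x by (simp add: sec_yoneda act_yoneda Hom_def)
  qed auto
  note psh_maps_along_iso[OF category_Box Y_psh presheaf_yoneda[OF category_Box] \<alpha>_map _ this]
  moreover have "inv_into (Hom Box n m) (\<alpha> m n) z \<in> Hom Box n m" if "z \<in> sec (fobj Y m) n" for n z
    using that \<alpha>_bij[of m n] by (metis bij_betw_imp_surj_on inv_into_into)
  ultimately have "fn (yo L m x) \<in> psh_maps Box (fobj Y m) L"
    using \<alpha>_bij by (simp add: sec_yoneda yo_def cong: restrict_cong)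
  then show ?thesis using L Y_psh by (simp add: HomC yo_def)
qed

lemma yo_apply: "g \<in> Hom Box n m \<Longrightarrow> fn (yo L m x) n (\<alpha> m n g) = act L g x"
  using bij_betw_inv_into_left[OF \<alpha>_bij] bij_betwE[OF \<alpha>_bij] by (simp add: yo_def)

lemma Y_HomC_eqI:
  assumes "f \<in> Hom CS (fobj Y m) L" "g \<in> Hom CS (fobj Y m) L"
    and "\<And>n u. u \<in> Hom Box n m \<Longrightarrow> fn f n (\<alpha> m n u) = fn g n (\<alpha> m n u)"
  shows "f = g"
proof (rule HomC_eqI[OF assms(1,2)])
  fix n x assume "x \<in> sec (fobj Y m) n"
  then obtain u where "u \<in> Hom Box n m" "x = \<alpha> m n u" using \<alpha>_bij[of m n] by (auto simp: bij_betw_def)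
  then show "fn f n x = fn g n x" using assms(3) by simp
qed

definition gen :: "nat \<Rightarrow> 'u" where "gen m = \<alpha> m m (Id Box m)"

lemma Id_Hom: "Id Box m \<in> Hom Box m m"
  using category_Box by (simp add: is_category_def)

lemma gen_sec: "gen m \<in> sec (fobj Y m) m"
  using bij_betwE[OF \<alpha>_bij] Id_Hom by (simp add: gen_def)

lemma yo_gen: "is_presheaf Box L \<Longrightarrow> x \<in> sec L m \<Longrightarrow> fn (yo L m x) m (gen m) = x"
  using yo_apply[OF Id_Hom] act_Id[of Box L m x] by (simp add: gen_def)

lemma Hom_Y_act:
  assumes h: "h \<in> Hom CS (fobj Y m) L" and u: "u \<in> Hom Box n m"
  shows "fn h n (\<alpha> m n u) = act L u (fn h m (gen m))"
proof -
  have u': "u \<in> Arr Box" "src u = n" "tgt u = m" using u by (auto simp: Hom_def)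
  have "Comp Box (Id Box m) u = u" using category_Box u' unfolding is_category_def by (metis Cod_Box)
  then have "\<alpha> m n u = act (fobj Y m) u (gen m)"
    using psh_maps_act[OF \<alpha>_map, of u "Id Box m" m] u' Id_Hom[of m] by (simp add: sec_yoneda act_yoneda gen_def)
  then show ?thesis using Hom_act[of h Box "fobj Y m" L u "gen m"] h u' gen_sec[of m] by (simp add: cubical_sets_def)
qed

text \<open>By naturality, the value at the universal element \<open>gen m\<close> determines all
  others; identities between maps out of \<open>fobj Y m\<close> are checked at this single
  element.\<close>

lemma yo_eq: "h \<in> Hom CS (fobj Y m) L \<Longrightarrow> h = yo L m (fn h m (gen m))"
  using yo_Hom[of L "fn h m (gen m)" m] HomC_in_sec[of h "fobj Y m" L "gen m" m] gen_sec[of m]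
  by (intro Y_HomC_eqI[of _ m L]) (auto simp: Hom_Y_act yo_apply HomC)

lemma yo_nat:
  assumes h: "h \<in> Hom CS L L'" and x: "x \<in> sec L m"
  shows "Comp CS h (yo L m x) = yo L' m (fn h m x)"
proof -
  have L: "is_presheaf Box L" using h by (simp add: HomC)
  have "fn (Comp CS h (yo L m x)) m (gen m) = fn h m x"
    using fn_CompC[of "gen m" "yo L m x" m h] gen_sec yo_gen[OF L x] by (simp add: yo_def)
  then show ?thesis using yo_eq[OF CompC[OF yo_Hom[OF L x] h]] by simp
qed

lemma yo_pull:
  assumes L: "is_presheaf Box L" and x: "x \<in> sec L (dout w)"
  shows "Comp CS (yo L (dout w) x) (farr Y (wmap w)) = yo L (din w) (pull L w x)"
proof -
  have w: "wmap w \<in> Hom Box (din w) (dout w)" by (simp add: Hom_def)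
  have Yw: "farr Y (wmap w) \<in> Hom CS (fobj Y (din w)) (fobj Y (dout w))" using functor_arr[OF Y w] .
  have "fn (farr Y (wmap w)) (din w) (gen (din w)) = \<alpha> (dout w) (din w) (Comp Box (wmap w) (Id Box (din w)))"
    using \<alpha>_nat[of "wmap w" "Id Box (din w)" "din w"] Id_Hom by (simp add: gen_def)
  also have "Comp Box (wmap w) (Id Box (din w)) = wmap w"
    using category_Box wmap_Arr[of w] unfolding is_category_def by (metis Dom_Box src_wmap)
  finally have "fn (Comp CS (yo L (dout w) x) (farr Y (wmap w))) (din w) (gen (din w)) = pull L w x"
    using fn_CompC[of "gen (din w)" "farr Y (wmap w)" "din w"] Yw gen_sec yo_apply[OF w] by (simp add: HomC)
  then show ?thesis using yo_eq[OF CompC[OF Yw yo_Hom[OF L x]]] by simp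
qed

section \<open>Simplices of \<open>tri L\<close> represented by cubes of \<open>L\<close>\<close>

definition cell :: "'u cset \<Rightarrow> nat \<Rightarrow> 'u \<Rightarrow> nat \<Rightarrow> (nat \<Rightarrow> bool list) \<Rightarrow> 'u" where
  "cell L m x = (\<lambda>k\<in>UNIV. \<lambda>s\<in>cube_chains k m. fn (farr tri (yo L m x)) k (\<beta> m k s))"

lemma \<beta>_sec: "s \<in> cube_chains k m \<Longrightarrow> \<beta> m k s \<in> sec (fobj tri (fobj Y m)) k"
  using bij_betwE[OF \<beta>_bij] by blast

lemma tri_Hom: "h \<in> Hom CS L L' \<Longrightarrow> farr tri h \<in> Hom SS (fobj tri L) (fobj tri L')"
  using functor_arr[OF tri] .

lemma precomp_\<beta>:
  assumes g: "g \<in> Hom SS (fobj tri (fobj Y m)) S"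
  shows "(\<lambda>k\<in>UNIV. \<lambda>s\<in>cube_chains k m. fn g k (\<beta> m k s)) \<in> psh_maps Simplex (nerve (cube m)) S"
  using Comp_psh_maps[OF category_Simplex presheaf_nerve \<beta>_map[of m], of "fn g" S] g
  by (simp add: HomS compose_def)

lemma cell_psh:
  assumes "is_presheaf Box L" "x \<in> sec L m"
  shows "cell L m x \<in> psh_maps Simplex (nerve (cube m)) (fobj tri L)"
  unfolding cell_def using precomp_\<beta>[OF tri_Hom[OF yo_Hom[OF assms]]] .

text \<open>These are the relations that \<open>tri L\<close> imposes on pairs of a cube and a
  simplex of it. By \<open>tri_Hom_exists\<close>, a family of maps on nerves that respects them
  descends to \<open>tri L\<close>.\<close>

lemma cell_pull:
  assumes L: "is_presheaf Box L" and x: "x \<in> sec L (dout w)" and s: "s \<in> cube_chains k (din w)"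
  shows "cell L (din w) (pull L w x) k s = cell L (dout w) x k (post k w s)"
proof -
  have w: "wmap w \<in> Hom Box (din w) (dout w)" by (simp add: Hom_def)
  have Yw: "farr Y (wmap w) \<in> Hom CS (fobj Y (din w)) (fobj Y (dout w))" using functor_arr[OF Y w] .
  have "farr tri (yo L (din w) (pull L w x)) = Comp SS (farr tri (yo L (dout w) x)) (farr tri (farr Y (wmap w)))"
    using functor_Comp[OF tri Yw yo_Hom[OF L x]] yo_pull[OF L x] by simp
  moreover have "src (farr tri (farr Y (wmap w))) = fobj tri (fobj Y (din w))"
    using tri_Hom[OF Yw] by (simp add: HomS)
  ultimately show ?thesis
    using s \<beta>_sec[OF s] post_chains[OF s] \<beta>_nat[OF s] by (simp add: cell_def fn_CompS)
qed

lemma cell_nat: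
  assumes h: "h \<in> Hom CS L L'" and x: "x \<in> sec L m" and s: "s \<in> cube_chains k m"
  shows "fn (farr tri h) k (cell L m x k s) = cell L' m (fn h m x) k s"
proof -
  have yo: "yo L m x \<in> Hom CS (fobj Y m) L" by (rule yo_Hom[OF _ x]) (use h in \<open>simp add: HomC\<close>)
  have "farr tri (yo L' m (fn h m x)) = Comp SS (farr tri h) (farr tri (yo L m x))"
    using functor_Comp[OF tri yo h] yo_nat[OF h x] by simp
  moreover have "src (farr tri (yo L m x)) = fobj tri (fobj Y m)" using tri_Hom[OF yo] by (simp add: HomS)
  ultimately show ?thesis using s \<beta>_sec[OF s] by (simp add: cell_def fn_CompS)
qed

section \<open>Cubes of \<open>qua S\<close> as simplicial maps\<close>

definition unadj :: "'u sset \<Rightarrow> nat \<Rightarrow> 'u \<Rightarrow> 'u sset_map" where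
  "unadj S n z = inv_into (Hom SS (fobj tri (fobj Y n)) S) (\<phi> (fobj Y n) S) (yo (fobj qua S) n z)"

lemma unadj:
  assumes S: "is_presheaf Simplex S" and z: "z \<in> sec (fobj qua S) n"
  shows "unadj S n z \<in> Hom SS (fobj tri (fobj Y n)) S" "\<phi> (fobj Y n) S (unadj S n z) = yo (fobj qua S) n z"
proof -
  have "yo (fobj qua S) n z \<in> \<phi> (fobj Y n) S ` Hom SS (fobj tri (fobj Y n)) S"
    using yo_Hom[OF qua_psh[OF S] z] \<phi>_bij[OF Y_psh S, of n] by (simp add: bij_betw_def)
  then show "unadj S n z \<in> Hom SS (fobj tri (fobj Y n)) S" "\<phi> (fobj Y n) S (unadj S n z) = yo (fobj qua S) n z"
    unfolding unadj_def by (rule inv_into_into, rule f_inv_into_f)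
qed

lemma unadj_eqI:
  assumes "is_presheaf Simplex S" "z \<in> sec (fobj qua S) n"
    and "g \<in> Hom SS (fobj tri (fobj Y n)) S" "\<phi> (fobj Y n) S g = yo (fobj qua S) n z"
  shows "g = unadj S n z"
  using assms unadj[OF assms(1,2)] \<phi>_bij[OF Y_psh assms(1), of n] by (metis bij_betw_def inj_onD)

text \<open>The cube \<open>z\<close> of \<open>qua S\<close> read as a simplicial map from the
  nerve of \<open>[1]\<close> to the power \<open>n\<close>. All later reasoning about
  \<open>qua\<close> takes place on shapes.\<close>

definition shape :: "'u sset \<Rightarrow> nat \<Rightarrow> 'u \<Rightarrow> nat \<Rightarrow> (nat \<Rightarrow> bool list) \<Rightarrow> 'u" where
  "shape S n z = (\<lambda>k\<in>UNIV. \<lambda>s\<in>cube_chains k n. fn (unadj S n z) k (\<beta> n k s))"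

lemma shape_psh:
  assumes "is_presheaf Simplex S" "z \<in> sec (fobj qua S) n"
  shows "shape S n z \<in> psh_maps Simplex (nerve (cube n)) S"
  unfolding shape_def using precomp_\<beta>[OF unadj(1)[OF assms]] .

lemma shape_nat:
  assumes g: "g \<in> Hom SS S S'" and z: "z \<in> sec (fobj qua S) n" and s: "s \<in> cube_chains k n"
  shows "shape S' n (fn (farr qua g) n z) k s = fn g k (shape S n z k s)"
proof -
  have S: "is_presheaf Simplex S" "is_presheaf Simplex S'" using g by (auto simp: HomS)
  have qg: "farr qua g \<in> Hom CS (fobj qua S) (fobj qua S')" using functor_arr[OF qua g] .
  note u = unadj[OF S(1) z]
  have "Comp SS g (unadj S n z) = unadj S' n (fn (farr qua g) n z)"
    using \<phi>_nat_right[OF Y_psh g u(1)] u(2) yo_nat[OF qg z] HomC_in_sec[OF qg z]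
    by (intro unadj_eqI[OF S(2)] CompS[OF u(1) g]) auto
  moreover have "src (unadj S n z) = fobj tri (fobj Y n)" using u(1) by (simp add: HomS)
  ultimately show ?thesis using s \<beta>_sec[OF s] fn_CompS[of "\<beta> n k s" "unadj S n z" k g] by (simp add: shape_def)
qed

lemma shape_pull:
  assumes S: "is_presheaf Simplex S" and z: "z \<in> sec (fobj qua S) (dout w)" and s: "s \<in> cube_chains k (din w)"
  shows "shape S (din w) (pull (fobj qua S) w z) k s = shape S (dout w) z k (post k w s)"
proof -
  have w: "wmap w \<in> Hom Box (din w) (dout w)" by (simp add: Hom_def)
  have Yw: "farr Y (wmap w) \<in> Hom CS (fobj Y (din w)) (fobj Y (dout w))" using functor_arr[OF Y w] .
  note tYw = tri_Hom[OF Yw] and u = unadj[OF S z]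
  have "Comp SS (unadj S (dout w) z) (farr tri (farr Y (wmap w))) = unadj S (din w) (pull (fobj qua S) w z)"
    using \<phi>_nat_left[OF Yw S u(1)] u(2) yo_pull[OF qua_psh[OF S] z] pull_in_sec[OF qua_psh[OF S] z]
    by (intro unadj_eqI[OF S] CompS[OF tYw u(1)]) auto
  moreover have "src (farr tri (farr Y (wmap w))) = fobj tri (fobj Y (din w))" using tYw by (simp add: HomS)
  ultimately show ?thesis
    using s \<beta>_sec[OF s] post_chains[OF s] \<beta>_nat[OF s]
      fn_CompS[of "\<beta> (din w) k s" "farr tri (farr Y (wmap w))" k "unadj S (dout w) z"] by (simp add: shape_def)
qed

text \<open>Three bijections are composed: the Yoneda lemma for \<open>fobj qua S\<close>, the
  adjunction at \<open>fobj Y n\<close>, and transport along \<beta>.\<close>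

lemma shape_bij:
  assumes S: "is_presheaf Simplex S"
  shows "bij_betw (shape S n) (sec (fobj qua S) n) (psh_maps Simplex (nerve (cube n)) S)"
  unfolding bij_betw_def
proof (intro conjI inj_onI subset_antisym subsetI)
  fix z z' assume z: "z \<in> sec (fobj qua S) n" and z': "z' \<in> sec (fobj qua S) n" and eq: "shape S n z = shape S n z'"
  have "unadj S n z = unadj S n z'"
  proof (rule HomS_eqI[OF unadj(1)[OF S z] unadj(1)[OF S z']])
    fix k y assume "y \<in> sec (fobj tri (fobj Y n)) k"
    then obtain s where "s \<in> cube_chains k n" "y = \<beta> n k s" using \<beta>_bij[of n k] by (auto simp: bij_betw_def)
    then show "fn (unadj S n z) k y = fn (unadj S n z') k y"
      using fun_cong[OF fun_cong[OF eq], of k s] by (simp add: shape_def)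
  qed
  then have "yo (fobj qua S) n z = yo (fobj qua S) n z'" using unadj(2)[OF S] z z' by metis
  then show "z = z'" using yo_gen[OF qua_psh[OF S]] z z' by metis
next
  fix \<sigma> assume "\<sigma> \<in> shape S n ` sec (fobj qua S) n"
  then show "\<sigma> \<in> psh_maps Simplex (nerve (cube n)) S" using shape_psh[OF S] by auto
next
  fix \<sigma> assume \<sigma>: "\<sigma> \<in> psh_maps Simplex (nerve (cube n)) S"
  define g where "g = Arrow (fobj tri (fobj Y n)) S
    (\<lambda>k\<in>Obj Simplex. \<lambda>y\<in>sec (fobj tri (fobj Y n)) k. \<sigma> k (inv_into (sec (nerve (cube n)) k) (\<beta> n k) y))"
  have g: "g \<in> Hom SS (fobj tri (fobj Y n)) S"
    using psh_maps_along_iso[OF category_Simplex tri_psh[OF Y_psh] presheaf_nerve \<beta>_map _ \<sigma>] \<beta>_bij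
      tri_psh[OF Y_psh] S by (simp add: HomS g_def)
  define z where "z = fn (\<phi> (fobj Y n) S g) n (gen n)"
  have \<phi>g: "\<phi> (fobj Y n) S g \<in> Hom CS (fobj Y n) (fobj qua S)"
    using \<phi>_bij[OF Y_psh S] g by (auto simp: bij_betw_def)
  have z: "z \<in> sec (fobj qua S) n" unfolding z_def by (rule HomC_in_sec[OF \<phi>g gen_sec])
  have "g = unadj S n z" using unadj_eqI[OF S z g] yo_eq[OF \<phi>g] by (simp add: z_def)
  then have "shape S n z k s = \<sigma> k s" if "s \<in> cube_chains k n" for k s
    using that \<beta>_sec[OF that] bij_betw_inv_into_left[OF \<beta>_bij that] by (simp add: shape_def g_def flip: \<open>g = unadj S n z\<close>)
  then have "shape S n z = \<sigma>" by (intro psh_maps_eqI[OF shape_psh[OF S z] \<sigma>]) simp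
  then show "\<sigma> \<in> shape S n ` sec (fobj qua S) n" using z by blast
qed

text \<open>Naturality of \<phi> in \<open>L\<close> shows that \<open>g\<close> after
  \<open>tri\<close> of \<open>yo L m x\<close> is the transpose of the map classified by \<phi>
  \<open>L S g\<close> at \<open>x\<close>. Thus transposing \<open>g\<close> amounts to recording
  its values on cells.\<close>

lemma adjunct_cell:
  assumes L: "is_presheaf Box L" and g: "g \<in> Hom SS (fobj tri L) S" and x: "x \<in> sec L m" and s: "s \<in> cube_chains k m"
  shows "fn g k (cell L m x k s) = shape S m (fn (\<phi> L S g) m x) k s"
proof -
  have S: "is_presheaf Simplex S" using g by (simp add: HomS)
  have \<phi>g: "\<phi> L S g \<in> Hom CS L (fobj qua S)" using \<phi>_bij[OF L S] g by (auto simp: bij_betw_def)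
  note yo = yo_Hom[OF L x]
  have "Comp SS g (farr tri (yo L m x)) = unadj S m (fn (\<phi> L S g) m x)"
    using \<phi>_nat_left[OF yo S g] yo_nat[OF \<phi>g x] HomC_in_sec[OF \<phi>g x]
    by (intro unadj_eqI[OF S] CompS[OF tri_Hom[OF yo] g]) auto
  moreover have "src (farr tri (yo L m x)) = fobj tri (fobj Y m)" using tri_Hom[OF yo] by (simp add: HomS)
  ultimately show ?thesis
    using s \<beta>_sec[OF s] fn_CompS[of "\<beta> m k s" "farr tri (yo L m x)" k g] by (simp add: shape_def cell_def)
qed

lemma tri_Hom_eqI:
  assumes L: "is_presheaf Box L" and g: "g \<in> Hom SS (fobj tri L) S" and g': "g' \<in> Hom SS (fobj tri L) S"
    and eq: "\<And>m x k s. x \<in> sec L m \<Longrightarrow> s \<in> cube_chains k m \<Longrightarrow> fn g k (cell L m x k s) = fn g' k (cell L m x k s)"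
  shows "g = g'"
proof -
  have S: "is_presheaf Simplex S" using g by (simp add: HomS)
  have \<phi>: "\<phi> L S g \<in> Hom CS L (fobj qua S)" "\<phi> L S g' \<in> Hom CS L (fobj qua S)"
    using \<phi>_bij[OF L S] g g' by (auto simp: bij_betw_def)
  have "\<phi> L S g = \<phi> L S g'"
  proof (rule HomC_eqI[OF \<phi>])
    fix m x assume x: "x \<in> sec L m"
    note z = HomC_in_sec[OF \<phi>(1) x] and z' = HomC_in_sec[OF \<phi>(2) x]
    have "shape S m (fn (\<phi> L S g) m x) = shape S m (fn (\<phi> L S g') m x)"
      using adjunct_cell[OF L g x] adjunct_cell[OF L g' x] eq[OF x]
      by (intro psh_maps_eqI[OF shape_psh[OF S z] shape_psh[OF S z']]) simp
    then show "fn (\<phi> L S g) m x = fn (\<phi> L S g') m x"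
      using shape_bij[OF S, of m] z z' by (auto simp: bij_betw_def dest: inj_onD)
  qed
  then show ?thesis using \<phi>_bij[OF L S] g g' by (auto simp: bij_betw_def dest: inj_onD)
qed

text \<open>With \<open>tri_Hom_eqI\<close> this presents \<open>tri L\<close> as the colimit of the
  nerves over the cubes of \<open>L\<close>, derived from the adjunction: by
  \<open>shape_bij\<close> each \<Psi> \<open>m x\<close> is the shape of a cube of
  \<open>qua S\<close>, compatibility makes these cubes a map from \<open>L\<close> to
  \<open>qua S\<close>, and its transpose is \<open>g\<close>.\<close>

lemma tri_Hom_exists:
  assumes L: "is_presheaf Box L" and S: "is_presheaf Simplex S"
    and \<Psi>: "\<And>m x. x \<in> sec L m \<Longrightarrow> \<Psi> m x \<in> psh_maps Simplex (nerve (cube m)) S"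
    and \<Psi>_pull: "\<And>w x k s. x \<in> sec L (dout w) \<Longrightarrow> s \<in> cube_chains k (din w) \<Longrightarrow>
      \<Psi> (din w) (pull L w x) k s = \<Psi> (dout w) x k (post k w s)"
  shows "\<exists>g\<in>Hom SS (fobj tri L) S. \<forall>m. \<forall>x\<in>sec L m. \<forall>k. \<forall>s\<in>cube_chains k m. fn g k (cell L m x k s) = \<Psi> m x k s"
proof -
  let ?h = "\<lambda>m x. inv_into (sec (fobj qua S) m) (shape S m) (\<Psi> m x)"
  have h: "?h m x \<in> sec (fobj qua S) m" "shape S m (?h m x) = \<Psi> m x" if "x \<in> sec L m" for m x
  proof -
    have "\<Psi> m x \<in> shape S m ` sec (fobj qua S) m" using \<Psi>[OF that] shape_bij[OF S, of m] by (simp add: bij_betw_def)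
    then show "?h m x \<in> sec (fobj qua S) m" "shape S m (?h m x) = \<Psi> m x"
      by (rule inv_into_into, rule f_inv_into_f)
  qed
  define H where "H = Arrow L (fobj qua S) (\<lambda>m\<in>Obj Box. \<lambda>x\<in>sec L m. ?h m x)"
  have "(\<lambda>m\<in>Obj Box. \<lambda>x\<in>sec L m. ?h m x) \<in> psh_maps Box L (fobj qua S)"
  proof (rule psh_mapsI[OF is_category_Dom_Cod[OF category_Box] L])
    fix f x assume "f \<in> Arr Box" "x \<in> sec L (Cod Box f)"
    then obtain w where w: "f = wmap w" and x: "x \<in> sec L (dout w)" by (auto simp: Arr_Box)
    note px = pull_in_sec[OF L x] and qp = pull_in_sec[OF qua_psh[OF S] h(1)[OF x]]
    have "shape S (din w) (?h (din w) (pull L w x)) = shape S (din w) (pull (fobj qua S) w (?h (dout w) x))"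
    proof (rule psh_maps_eqI[OF shape_psh[OF S h(1)[OF px]] shape_psh[OF S qp]])
      fix k s assume "s \<in> sec (nerve (cube (din w))) k"
      then show "shape S (din w) (?h (din w) (pull L w x)) k s = shape S (din w) (pull (fobj qua S) w (?h (dout w) x)) k s"
        using shape_pull[OF S h(1)[OF x]] h(2)[OF px] h(2)[OF x] \<Psi>_pull[OF x] by simp
    qed
    then have "?h (din w) (pull L w x) = pull (fobj qua S) w (?h (dout w) x)"
      using shape_bij[OF S, of "din w"] h(1)[OF px] qp by (auto simp: bij_betw_def dest: inj_onD)
    then show "?h (Dom Box f) (act L f x) = act (fobj qua S) f (?h (Cod Box f) x)" by (simp add: w)
  qed (auto intro: h)
  then have H: "H \<in> Hom CS L (fobj qua S)" using L qua_psh[OF S] by (simp add: HomC H_def)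
  then have "H \<in> \<phi> L S ` Hom SS (fobj tri L) S" using \<phi>_bij[OF L S] by (simp add: bij_betw_def)
  then obtain g where g: "g \<in> Hom SS (fobj tri L) S" "\<phi> L S g = H" by (rule imageE) simp
  have "fn g k (cell L m x k s) = \<Psi> m x k s" if "x \<in> sec L m" "s \<in> cube_chains k m" for m x k s
    using adjunct_cell[OF L g(1) that] h(2)[OF that(1)] that by (simp add: g(2) H_def)
  then show ?thesis using g(1) by blast
qed

end

section \<open>Maps from cubes to triangulations\<close>

lemma functor_cocone:
  assumes J: "is_category J" and K: "is_functor J C K" and F: "is_functor C D F" and cc: "is_cocone J C K L \<iota>"
  shows "is_cocone J D (F \<circ>\<^sub>F K) (fobj F L) (\<lambda>j. farr F (\<iota> j))"
  unfolding is_cocone_def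
proof (intro conjI ballI)
  show "fobj F L \<in> Obj D" using cc functor_obj[OF F] by (simp add: is_cocone_def)
  show "farr F (\<iota> j) \<in> Hom D (fobj (F \<circ>\<^sub>F K) j) (fobj F L)" if "j \<in> Obj J" for j
    using cc that functor_arr[OF F] by (simp add: is_cocone_def fcomp_def)
  fix u assume u: "u \<in> Arr J"
  then have "farr K u \<in> Hom C (fobj K (Dom J u)) (fobj K (Cod J u))" "\<iota> (Cod J u) \<in> Hom C (fobj K (Cod J u)) L"
    using cc functor_arr[OF K, of u] is_category_Dom_Cod[OF J u] by (auto simp: is_cocone_def Hom_def)
  then have "farr F (Comp C (\<iota> (Cod J u)) (farr K u)) = Comp D (farr F (\<iota> (Cod J u))) (farr F (farr K u))"
    by (rule functor_Comp[OF F])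
  then show "Comp D (farr F (\<iota> (Cod J u))) (farr (F \<circ>\<^sub>F K) u) = farr F (\<iota> (Dom J u))"
    using cc u by (simp add: is_cocone_def fcomp_def)
qed

text \<open>Such a map need not be a box map: the diagonal of a square and the minimum of two bits
  qualify. Values outside the cube are left open, so equality is always meant on lists of length
  \<open>n\<close>.\<close>

definition bmaps :: "nat \<Rightarrow> nat \<Rightarrow> (bool list \<Rightarrow> bool list) set" where
  "bmaps n m = {f. (\<forall>v. length v = n \<longrightarrow> length (f v) = m) \<and>
     (\<forall>v v'. length v = n \<longrightarrow> list_all2 (\<le>) v v' \<longrightarrow> list_all2 (\<le>) (f v) (f v')) \<and>
     f (bot_pt n) = bot_pt m \<and> f (top_pt n) = top_pt m}"

definition mapc :: "nat \<Rightarrow> (bool list \<Rightarrow> bool list) \<Rightarrow> (nat \<Rightarrow> bool list) \<Rightarrow> nat \<Rightarrow> bool list" where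
  "mapc k f s = (\<lambda>i\<in>{0..k}. f (s i))"

lemma mapc_apply [simp]: "i \<le> k \<Longrightarrow> mapc k f s i = f (s i)" by (simp add: mapc_def)

lemma mapc_chains: "f \<in> bmaps n m \<Longrightarrow> s \<in> cube_chains k n \<Longrightarrow> mapc k f s \<in> cube_chains k m"
  by (auto simp: chains_iff bmaps_def) (simp add: mapc_def)

lemma mapc_bchains: "f \<in> bmaps n m \<Longrightarrow> s \<in> bchains k n \<Longrightarrow> mapc k f s \<in> bchains k m"
  using mapc_chains[of f n m s k] by (auto simp: bchains_def bmaps_def)

lemma pre_mapc: "simplicial_op j k \<theta> \<Longrightarrow> pre j (mapc k f s) \<theta> = mapc j f (pre j s \<theta>)"
  by (auto simp: pre_def mapc_def simplicial_op_iff fun_eq_iff)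

lemma bmaps_degeneracy: "f \<in> bmaps n (din w) \<Longrightarrow> degeneracy w \<Longrightarrow> run w \<circ> f \<in> bmaps n (dout w)"
  by (auto simp: bmaps_def degeneracy_iff run_mono)

lemma post_mapc: "post k w (mapc k f s) = mapc k (run w \<circ> f) s"
  by (auto simp: post_def mapc_def fun_eq_iff)

section \<open>Capped chains and the long diagonal\<close>

definition edge :: "nat \<Rightarrow> nat \<Rightarrow> bool list" where
  "edge n = (\<lambda>i\<in>{0..1}. if i = 0 then bot_pt n else top_pt n)"

text \<open>The chain \<open>s\<close> extended by the initial and the terminal vertex of the cube.\<close>

definition cap :: "nat \<Rightarrow> nat \<Rightarrow> (nat \<Rightarrow> bool list) \<Rightarrow> nat \<Rightarrow> bool list" where
  "cap n k s = (\<lambda>i\<in>{0..Suc (Suc k)}. if i = 0 then bot_pt n else if i = Suc (Suc k) then top_pt n else s (i - 1))"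

text \<open>A 2-simplex with \<open>v\<close> at index 1; it contains the long diagonal and isolates
  a single vertex.\<close>

abbreviation vcap :: "nat \<Rightarrow> bool list \<Rightarrow> nat \<Rightarrow> bool list" where
  "vcap n v \<equiv> cap n 0 (\<lambda>i. v)"

lemma edge_bchains: "edge n \<in> bchains 1 n"
  by (auto simp: bchains_def chains_iff edge_def list_all2_le_refl bot_pt_le)

lemma cap_chains:
  assumes "\<And>i. i \<le> k \<Longrightarrow> length (s i) = n" "\<And>i j. i \<le> j \<Longrightarrow> j \<le> k \<Longrightarrow> list_all2 (\<le>) (s i) (s j)"
  shows "cap n k s \<in> bchains (Suc (Suc k)) n"
proof -
  have "list_all2 (\<le>) (cap n k s i) (cap n k s j)" if "i \<le> j" "j \<le> Suc (Suc k)" for i j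
  proof -
    have "i = 0 \<or> j = Suc (Suc k) \<or> 0 < i \<and> j \<le> Suc k" using that by auto
    then consider "i = 0" | "j = Suc (Suc k)" | "0 < i" "j \<le> Suc k" by blast
    then show ?thesis
    proof cases
      case 3
      then show ?thesis using that assms(2)[of "i - 1" "j - 1"] by (simp add: cap_def)
    qed (use that assms(1) in \<open>auto simp: cap_def bot_pt_le le_top_pt\<close>)
  qed
  then show ?thesis using assms(1) by (auto simp: bchains_def chains_iff) (auto simp: cap_def)
qed

lemma vcap_bchains: "length v = n \<Longrightarrow> vcap n v \<in> bchains 2 n"
  using cap_chains[of 0 "\<lambda>i. v" n] by (simp add: list_all2_le_refl numeral_2_eq_2)

lemma pre_bchains:
  assumes "s \<in> bchains k n" "simplicial_op j k \<theta>" "\<theta> 0 = 0" "\<theta> j = k"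
  shows "pre j s \<theta> \<in> bchains j n"
  using assms pre_chains[of s k n \<theta> j] by (simp add: bchains_def)

text \<open>Three operators that cut up a simplex: \<open>ends\<close> extracts the long diagonal
  from a chain between the end vertices. In a chain capped by \<open>cap\<close>,
  \<open>vert\<close> extracts the capped vertex \<open>i\<close> and \<open>inner\<close> removes
  the caps. The shift by one is the index shift made by \<open>cap\<close>.\<close>

definition ends :: "nat \<Rightarrow> nat \<Rightarrow> nat" where "ends k = (\<lambda>i\<in>{0..1}. if i = 0 then 0 else k)"

definition vert :: "nat \<Rightarrow> nat \<Rightarrow> nat \<Rightarrow> nat" where
  "vert k i = (\<lambda>l\<in>{0..2}. if l = 0 then 0 else if l = 1 then Suc i else Suc (Suc k))"

definition inner :: "nat \<Rightarrow> nat \<Rightarrow> nat" where "inner k = (\<lambda>i\<in>{0..k}. Suc i)"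

lemma simplicial_ops:
  "simplicial_op 1 k (ends k)" "i \<le> k \<Longrightarrow> simplicial_op 2 (Suc (Suc k)) (vert k i)"
  "simplicial_op k (Suc (Suc k)) (inner k)"
  by (auto simp: simplicial_op_iff ends_def vert_def inner_def)

lemma pre_ends: "s \<in> bchains k n \<Longrightarrow> pre 1 s (ends k) = edge n"
  by (auto simp: pre_def ends_def edge_def bchains_def fun_eq_iff)

lemma pre_vert: "i \<le> k \<Longrightarrow> pre 2 (cap n k s) (vert k i) = vcap n (s i)"
  by (auto simp: pre_def vert_def cap_def fun_eq_iff)

lemma pre_inner: "s \<in> cube_chains k n \<Longrightarrow> pre k (cap n k s) (inner k) = s"
  by (auto simp: pre_def inner_def cap_def fun_eq_iff chains_iff extensional_def)

context tri_qua
begin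

lemma cell_sec:
  "is_presheaf Box L \<Longrightarrow> x \<in> sec L m \<Longrightarrow> s \<in> cube_chains k m \<Longrightarrow> cell L m x k s \<in> sec (fobj tri L) k"
  using psh_maps_in_sec[OF cell_psh, of L x m k s] by simp

lemma psh_maps_pre:
  assumes "\<sigma> \<in> psh_maps Simplex (nerve (cube n)) S" "simplicial_op j k \<theta>" "s \<in> cube_chains k n"
  shows "\<sigma> j (pre j s \<theta>) = act S (Arrow j k \<theta>) (\<sigma> k s)"
  using psh_maps_act[OF assms(1), of "Arrow j k \<theta>" s] assms(2,3) by (simp add: Arr_Simplex)

text \<open>Cells form a simplicial subset \<open>D\<close>, and the family \<open>cell L\<close> is
  compatible as a family into \<open>D\<close>, so it induces a map from \<open>tri L\<close> to
  \<open>D\<close>. Followed by the inclusion it fixes all cells and hence is the identity by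
  \<open>tri_Hom_eqI\<close>.\<close>

lemma cell_surj:
  assumes L: "is_presheaf Box L" and y: "y \<in> sec (fobj tri L) k"
  shows "\<exists>m. \<exists>x\<in>sec L m. \<exists>s\<in>cube_chains k m. y = cell L m x k s"
proof -
  let ?T = "fobj tri L"
  define A where "A = (\<lambda>k. {y. \<exists>m. \<exists>x\<in>sec L m. \<exists>s\<in>cube_chains k m. y = cell L m x k s})"
  define D where "D = \<lparr>sec = A, act = act ?T\<rparr>"
  have 1: "A k \<subseteq> sec ?T k" for k using cell_sec[OF L] by (auto simp: A_def)
  have 2: "act ?T f y \<in> A (src f)" if f: "f \<in> Arr Simplex" and y: "y \<in> A (tgt f)" for f y
  proof -
    obtain m x s where x: "x \<in> sec L m" and s: "s \<in> cube_chains (tgt f) m" and "y = cell L m x (tgt f) s"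
      using y unfolding A_def by blast
    then have "act ?T f y = cell L m x (src f) (pre (src f) s (fn f))"
      using psh_maps_act[OF cell_psh[OF L x] f, of s] by simp
    moreover have "pre (src f) s (fn f) \<in> cube_chains (src f) m"
      using pre_chains[OF s] f by (simp add: Arr_Simplex)
    ultimately show ?thesis using x unfolding A_def by blast
  qed
  have D: "is_presheaf Simplex D" and inc: "sub_inc Simplex D ?T \<in> Hom SS D ?T"
    using sub_presheaf[OF category_Simplex tri_psh[OF L], of A] 1 2 by (simp_all add: D_def simplicial_sets_def)
  have "cell L m x \<in> psh_maps Simplex (nerve (cube m)) D" if "x \<in> sec L m" for m x
    using cell_psh[OF L that] that by (auto simp: psh_maps_def PiE_iff D_def A_def)
  then obtain g where g: "g \<in> Hom SS ?T D"
    and gc: "\<forall>m. \<forall>x\<in>sec L m. \<forall>k. \<forall>s\<in>cube_chains k m. fn g k (cell L m x k s) = cell L m x k s"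
    using tri_Hom_exists[OF L D, of "cell L"] cell_pull[OF L] by blast
  have sg: "src g = ?T" using g by (simp add: HomS)
  have idT: "sub_inc Simplex ?T ?T \<in> Hom SS ?T ?T"
    using sub_inc_refl[OF category_Simplex tri_psh[OF L]] by (simp add: simplicial_sets_def)
  have "Comp SS (sub_inc Simplex D ?T) g = sub_inc Simplex ?T ?T"
  proof (rule tri_Hom_eqI[OF L CompS[OF g inc] idT])
    fix m x k s assume x: "x \<in> sec L m" and s: "s \<in> cube_chains k m"
    note c = cell_sec[OF L x s]
    show "fn (Comp SS (sub_inc Simplex D ?T) g) k (cell L m x k s) = fn (sub_inc Simplex ?T ?T) k (cell L m x k s)"
      using gc x s c HomS_in_sec[OF g c] by (simp add: fn_CompS sg)
  qed
  then have "fn g k y = y"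
    using fn_CompS[of y g k "sub_inc Simplex D ?T"] y HomS_in_sec[OF g y] by (simp add: sg)
  then have "y \<in> A k" using HomS_in_sec[OF g y] by (simp add: D_def)
  then show ?thesis by (simp add: A_def)
qed

lemma cell_normal_exists:
  assumes L: "is_presheaf Box L" and y: "y \<in> sec (fobj tri L) k"
  obtains n c t where "nondegenerate L n c" "t \<in> bchains k n" "y = cell L n c k t"
proof -
  obtain m x s where x: "x \<in> sec L m" and s: "s \<in> cube_chains k m" and yc: "y = cell L m x k s"
    using cell_surj[OF L y] by blast
  obtain d s' p c where d: "face d" "dout d = m" and s': "s' \<in> bchains k (din d)" "s = post k d s'"
    and p: "EZ_decomposition L (din d) (pull L d x) p c"
    using normal_form_cases[OF L x s] by metis
  have p': "degeneracy p" "din p = din d" "nondegenerate L (dout p) c" "c \<in> sec L (dout p)" "pull L d x = pull L p c"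
    using p by (auto simp: EZ_decomposition_def nondegenerate_def)
  have "s' \<in> cube_chains k (din d)" using s' by (simp add: bchains_def)
  then have "y = cell L (dout p) c k (post k p s')"
    using cell_pull[OF L, of x d s' k] cell_pull[OF L p'(4), of s' k] x d s' p' yc by simp
  moreover have "post k p s' \<in> bchains k (dout p)" using post_bchains[of s' k p] s' p' by simp
  ultimately show ?thesis using that p' by blast
qed

text \<open>The map from \<open>tri L\<close> to the simplicial set of normal forms sends such a
  cell to the code of its own triple, from which all three components can be read off.\<close>

lemma cell_normal_unique:
  assumes inf: "infinite (UNIV :: 'u set)" and L: "is_presheaf Box L"
    and c: "nondegenerate L n c" and d: "nondegenerate L m d" and t: "t \<in> bchains k n" and t': "t' \<in> bchains k m"
    and eq: "cell L n c k t = cell L m d k t'"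
  shows "n = m" "c = d" "t = t'"
proof -
  obtain S :: "'u sset" and \<Psi> where S: "is_presheaf Simplex S"
    and 1: "\<And>m x. x \<in> sec L m \<Longrightarrow> \<Psi> m x \<in> psh_maps Simplex (nerve (cube m)) S"
    and 2: "\<And>w x k s. x \<in> sec L (dout w) \<Longrightarrow> s \<in> cube_chains k (din w) \<Longrightarrow>
      \<Psi> (din w) (pull L w x) k s = \<Psi> (dout w) x k (post k w s)"
    and 3: "\<And>n c m d k t t'. t \<in> bchains k n \<Longrightarrow> t' \<in> bchains k m \<Longrightarrow> nondegenerate L n c \<Longrightarrow>
      nondegenerate L m d \<Longrightarrow> \<Psi> n c k t = \<Psi> m d k t' \<Longrightarrow> n = m \<and> c = d \<and> t = t'"
    using normal_form_model[OF inf L] by metis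
  have "\<exists>g\<in>Hom SS (fobj tri L) S. \<forall>m. \<forall>x\<in>sec L m. \<forall>k. \<forall>s\<in>cube_chains k m.
      fn g k (cell L m x k s) = \<Psi> m x k s"
    by (rule tri_Hom_exists[OF L S]) (fact 1, fact 2)
  then obtain g where "g \<in> Hom SS (fobj tri L) S"
    and g: "\<forall>m. \<forall>x\<in>sec L m. \<forall>k. \<forall>s\<in>cube_chains k m. fn g k (cell L m x k s) = \<Psi> m x k s"
    by (rule bexE)
  have "c \<in> sec L n" "d \<in> sec L m" "t \<in> cube_chains k n" "t' \<in> cube_chains k m"
    using c d t t' by (auto simp: nondegenerate_def bchains_def)
  then have "\<Psi> n c k t = \<Psi> m d k t'" using g eq by metis
  then show "n = m" "c = d" "t = t'" using 3[OF t t' c d] by auto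
qed

text \<open>The argument rests on the cube having a least and a greatest vertex: every chain extends
  to one that contains the long diagonal.\<close>

lemma shape_factor:
  assumes inf: "infinite (UNIV :: 'u set)" and L: "is_presheaf Box L"
    and \<sigma>: "\<sigma> \<in> psh_maps Simplex (nerve (cube n)) (fobj tri L)"
  shows "\<exists>m c f. nondegenerate L m c \<and> f \<in> bmaps n m \<and>
    (\<forall>k. \<forall>s\<in>cube_chains k n. \<sigma> k s = cell L m c k (mapc k f s))"
proof -
  let ?T = "fobj tri L"
  have \<sigma>_sec: "\<sigma> k s \<in> sec ?T k" if "s \<in> cube_chains k n" for k s
    using psh_maps_in_sec[OF \<sigma>, of k s] that by simp
  have e: "edge n \<in> cube_chains 1 n" using edge_bchains[of n] by (simp add: bchains_def)
  obtain m c t1 where c: "nondegenerate L m c" and t1: "t1 \<in> bchains 1 m" and \<sigma>e: "\<sigma> 1 (edge n) = cell L m c 1 t1"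
    using cell_normal_exists[OF L \<sigma>_sec[OF e]] by blast
  have csec: "c \<in> sec L m" using c by (simp add: nondegenerate_def)
  note uniq = cell_normal_unique[OF inf L]
  have \<sigma>_pre: "\<sigma> j (pre j s \<theta>) = cell L m' c' j (pre j t \<theta>)"
    if "\<sigma> k s = cell L m' c' k t" "s \<in> cube_chains k n" "t \<in> cube_chains k m'" "c' \<in> sec L m'" "simplicial_op j k \<theta>"
    for j k s t \<theta> m' c'
    using psh_maps_pre[OF \<sigma> that(5,2)] psh_maps_pre[OF cell_psh[OF L that(4)] that(5,3)] that(1) by simp
  text \<open>The edge from the initial to the terminal vertex determines the carrier of every simplex
    that contains it.\<close>
  have lift: "\<exists>t\<in>bchains k m. \<sigma> k s = cell L m c k t" if s: "s \<in> bchains k n" for k s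
  proof -
    have sc: "s \<in> cube_chains k n" using s by (simp add: bchains_def)
    obtain m' c' t where c': "nondegenerate L m' c'" and t: "t \<in> bchains k m'" and \<sigma>s: "\<sigma> k s = cell L m' c' k t"
      using cell_normal_exists[OF L \<sigma>_sec[OF sc]] by blast
    have "t \<in> cube_chains k m'" "c' \<in> sec L m'" using c' t by (auto simp: nondegenerate_def bchains_def)
    from \<sigma>_pre[OF \<sigma>s sc this simplicial_ops(1)]
    have "cell L m' c' 1 (edge m') = cell L m c 1 t1" using \<sigma>e pre_ends[OF s] pre_ends[OF t] by simp
    from uniq(1,2)[OF c' c edge_bchains t1 this] show ?thesis using t \<sigma>s by auto
  qed
  \<comment> \<open>The value at \<open>v\<close> is the middle vertex of the chain that represents
    the 2-simplex from bottom through \<open>v\<close> to top; \<open>lift\<close> provides this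
    chain and \<open>uniq\<close> makes it unique.\<close>
  define f where "f = (\<lambda>v. (SOME t. t \<in> bchains 2 m \<and> \<sigma> 2 (vcap n v) = cell L m c 2 t) 1)"
  have f: "f v = t 1" if "t \<in> bchains 2 m" "\<sigma> 2 (vcap n v) = cell L m c 2 t" for v t
  proof -
    have "(SOME t. t \<in> bchains 2 m \<and> \<sigma> 2 (vcap n v) = cell L m c 2 t) = t"
      using that uniq(3)[OF c c] by (intro some_equality) auto
    then show ?thesis by (simp add: f_def)
  qed
  \<comment> \<open>The capped chain contains the long diagonal and so has carrier \<open>c\<close>.
    Its faces under \<open>vert k i\<close> identify the inner vertices of \<open>t\<close> as
    values of \<open>f\<close>, and \<open>inner\<close> then discards the caps.\<close>
  have key: "\<sigma> k s = cell L m c k (mapc k f s) \<and> mapc k f s \<in> cube_chains k m" if s: "s \<in> cube_chains k n" for k s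
  proof -
    have cap: "cap n k s \<in> bchains (Suc (Suc k)) n" by (rule cap_chains) (use s in \<open>auto simp: chains_iff\<close>)
    obtain t where t: "t \<in> bchains (Suc (Suc k)) m" and \<sigma>t: "\<sigma> (Suc (Suc k)) (cap n k s) = cell L m c (Suc (Suc k)) t"
      using lift[OF cap] by blast
    have ch: "cap n k s \<in> cube_chains (Suc (Suc k)) n" "t \<in> cube_chains (Suc (Suc k)) m" using cap t by (auto simp: bchains_def)
    have "f (s i) = t (Suc i)" if i: "i \<le> k" for i
    proof -
      have "pre 2 t (vert k i) \<in> bchains 2 m"
        by (rule pre_bchains[OF t simplicial_ops(2)[OF i]]) (simp_all add: vert_def)
      then have "f (s i) = pre 2 t (vert k i) 1"
        using f \<sigma>_pre[OF \<sigma>t ch csec simplicial_ops(2)[OF i]] pre_vert[OF i] by metis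
      then show ?thesis by (simp add: vert_def)
    qed
    then have "pre k t (inner k) = mapc k f s" by (auto simp: pre_def inner_def mapc_def fun_eq_iff)
    then show ?thesis
      using \<sigma>_pre[OF \<sigma>t ch csec simplicial_ops(3)] pre_inner[OF s] pre_chains[OF ch(2) simplicial_ops(3)] by simp
  qed
  have len: "length (f v) = m" if "length v = n" for v
  proof -
    have "(\<lambda>i\<in>{0..0}. v) \<in> cube_chains 0 n" using that by (auto simp: chains_iff list_all2_le_refl)
    then have "mapc 0 f (\<lambda>i\<in>{0..0}. v) \<in> cube_chains 0 m" using key by blast
    then show ?thesis by (auto simp: chains_iff mapc_def)
  qed
  have mono: "list_all2 (\<le>) (f v) (f v')" if "length v = n" "list_all2 (\<le>) v v'" for v v'
  proof -
    define s where "s = (\<lambda>i\<in>{0..1::nat}. if i = 0 then v else v')"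
    have "length v' = n" using that by (auto dest: list_all2_lengthD)
    then have "s \<in> cube_chains 1 n" using that by (auto simp: s_def chains_iff list_all2_le_refl)
    then have "mapc 1 f s \<in> cube_chains 1 m" using key by blast
    then have "list_all2 (\<le>) (mapc 1 f s 0) (mapc 1 f s 1)" by (simp add: chains_iff)
    then show ?thesis by (simp add: s_def)
  qed
  \<comment> \<open>For an end vertex the capping 2-simplex is a degenerate image of the long
    diagonal itself, so \<open>t1\<close> dictates the value of \<open>f\<close> there.\<close>
  have deg: "f (edge n i) = t1 i" if i: "i \<le> 1" for i
  proof -
    define \<theta> where "\<theta> = (\<lambda>l\<in>{0..2::nat}. if l = 0 then 0 else if l = 1 then i else 1)"
    have \<theta>: "simplicial_op 2 1 \<theta>" using i by (auto simp: simplicial_op_iff \<theta>_def)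
    have b: "pre 2 t1 \<theta> \<in> bchains 2 m" by (rule pre_bchains[OF t1 \<theta>]) (simp_all add: \<theta>_def)
    have "pre 2 (edge n) \<theta> = vcap n (edge n i)"
      using i by (auto simp: pre_def \<theta>_def edge_def cap_def fun_eq_iff)
    moreover have "t1 \<in> cube_chains 1 m" using t1 by (simp add: bchains_def)
    ultimately have "f (edge n i) = pre 2 t1 \<theta> 1" using f[OF b] \<sigma>_pre[OF \<sigma>e e _ csec \<theta>] by simp
    then show ?thesis by (simp add: \<theta>_def)
  qed
  have "f (bot_pt n) = bot_pt m" "f (top_pt n) = top_pt m"
    using deg[of 0] deg[of 1] t1 by (auto simp: edge_def bchains_def)
  then have "f \<in> bmaps n m" using len mono by (simp add: bmaps_def)
  then show ?thesis using c key by blast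
qed

section \<open>Cubes of \<open>qua (tri L)\<close>\<close>

definition fcell :: "'u cset \<Rightarrow> nat \<Rightarrow> 'u \<Rightarrow> nat \<Rightarrow> (bool list \<Rightarrow> bool list) \<Rightarrow> nat \<Rightarrow> (nat \<Rightarrow> bool list) \<Rightarrow> 'u" where
  "fcell L m x n f = (\<lambda>k\<in>UNIV. \<lambda>s\<in>cube_chains k n. cell L m x k (mapc k f s))"

lemma fcell_psh:
  assumes L: "is_presheaf Box L" and x: "x \<in> sec L m" and f: "f \<in> bmaps n m"
  shows "fcell L m x n f \<in> psh_maps Simplex (nerve (cube n)) (fobj tri L)"
proof -
  have "(\<lambda>k\<in>Obj Simplex. \<lambda>s\<in>sec (nerve (cube n)) k. cell L m x k (mapc k f s))
      \<in> psh_maps Simplex (nerve (cube n)) (fobj tri L)"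
  proof (rule psh_mapsI[OF is_category_Dom_Cod[OF category_Simplex] presheaf_nerve])
    fix k s assume "s \<in> sec (nerve (cube n)) k"
    then show "cell L m x k (mapc k f s) \<in> sec (fobj tri L) k" using cell_sec[OF L x] mapc_chains[OF f] by simp
  next
    fix u s assume u: "u \<in> Arr Simplex" and "s \<in> sec (nerve (cube n)) (Cod Simplex u)"
    then have "mapc (tgt u) f s \<in> cube_chains (tgt u) m" using mapc_chains[OF f] by simp
    then show "cell L m x (Dom Simplex u) (mapc (Dom Simplex u) f (act (nerve (cube n)) u s)) =
        act (fobj tri L) u (cell L m x (Cod Simplex u) (mapc (Cod Simplex u) f s))"
      using psh_maps_act[OF cell_psh[OF L x] u, of "mapc (tgt u) f s"] pre_mapc[of "fn u" "src u" "tgt u" f s] u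
      by (simp add: Arr_Simplex)
  qed auto
  then show ?thesis by (simp add: fcell_def)
qed

definition qcell :: "'u cset \<Rightarrow> nat \<Rightarrow> 'u \<Rightarrow> nat \<Rightarrow> (bool list \<Rightarrow> bool list) \<Rightarrow> 'u" where
  "qcell L m x n f = inv_into (sec (fobj qua (fobj tri L)) n) (shape (fobj tri L) n) (fcell L m x n f)"

lemma qcell:
  assumes L: "is_presheaf Box L" and x: "x \<in> sec L m" and f: "f \<in> bmaps n m"
  shows "qcell L m x n f \<in> sec (fobj qua (fobj tri L)) n" "shape (fobj tri L) n (qcell L m x n f) = fcell L m x n f"
proof -
  have "fcell L m x n f \<in> shape (fobj tri L) n ` sec (fobj qua (fobj tri L)) n"
    using fcell_psh[OF L x f] shape_bij[OF tri_psh[OF L], of n] by (simp add: bij_betw_def)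
  then show "qcell L m x n f \<in> sec (fobj qua (fobj tri L)) n" "shape (fobj tri L) n (qcell L m x n f) = fcell L m x n f"
    unfolding qcell_def by (rule inv_into_into, rule f_inv_into_f)
qed

lemma shape_inj:
  assumes "is_presheaf Simplex S" "z \<in> sec (fobj qua S) n" "z' \<in> sec (fobj qua S) n"
    and "\<And>k s. s \<in> cube_chains k n \<Longrightarrow> shape S n z k s = shape S n z' k s"
  shows "z = z'"
proof -
  have "shape S n z = shape S n z'"
    by (rule psh_maps_eqI[OF shape_psh[OF assms(1,2)] shape_psh[OF assms(1,3)]]) (use assms(4) in simp)
  then show ?thesis using shape_bij[OF assms(1), of n] assms(2,3) by (auto simp: bij_betw_def dest: inj_onD)
qed

lemma qcell_nat:
  assumes h: "h \<in> Hom CS L L'" and x: "x \<in> sec L m" and f: "f \<in> bmaps n m"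
  shows "fn (farr qua (farr tri h)) n (qcell L m x n f) = qcell L' m (fn h m x) n f"
proof -
  have L: "is_presheaf Box L" "is_presheaf Box L'" using h by (auto simp: HomC)
  note hx = HomC_in_sec[OF h x]
  note th = tri_Hom[OF h]
  have qh: "farr qua (farr tri h) \<in> Hom CS (fobj qua (fobj tri L)) (fobj qua (fobj tri L'))"
    using functor_arr[OF qua th] .
  show ?thesis
  proof (rule shape_inj[OF tri_psh[OF L(2)] HomC_in_sec[OF qh qcell(1)[OF L(1) x f]] qcell(1)[OF L(2) hx f]])
    fix k s assume s: "s \<in> cube_chains k n"
    show "shape (fobj tri L') n (fn (farr qua (farr tri h)) n (qcell L m x n f)) k s =
        shape (fobj tri L') n (qcell L' m (fn h m x) n f) k s"
      using shape_nat[OF th qcell(1)[OF L(1) x f] s] qcell(2)[OF L(1) x f] qcell(2)[OF L(2) hx f]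
        cell_nat[OF h x mapc_chains[OF f s]] s by (simp add: fcell_def)
  qed
qed

text \<open>By \<open>cell_pull\<close> both sides have the same \<open>fcell\<close>. Applied to a
  degeneracy, this moves the degenerate part of a cube into the monotone map and leaves a
  nondegenerate cube.\<close>

lemma qcell_pull:
  assumes L: "is_presheaf Box L" and x: "x \<in> sec L (dout w)" and f: "f \<in> bmaps n (din w)"
  shows "qcell L (din w) (pull L w x) n f = qcell L (dout w) x n (run w \<circ> f)"
proof -
  have "fcell L (din w) (pull L w x) n f = fcell L (dout w) x n (run w \<circ> f)"
    using cell_pull[OF L x mapc_chains[OF f]] by (auto simp: fcell_def post_mapc intro!: ext)
  then show ?thesis by (simp add: qcell_def)
qed

lemma qcell_cong:
  assumes "\<And>v. length v = n \<Longrightarrow> f v = g v"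
  shows "qcell L m x n f = qcell L m x n g"
proof -
  have "mapc k f s = mapc k g s" if "s \<in> cube_chains k n" for k s
    using that assms by (auto simp: mapc_def chains_iff)
  then have "fcell L m x n f = fcell L m x n g" by (auto simp: fcell_def intro!: ext)
  then show ?thesis by (simp add: qcell_def)
qed

lemma qcell_exists:
  assumes inf: "infinite (UNIV :: 'u set)" and L: "is_presheaf Box L" and z: "z \<in> sec (fobj qua (fobj tri L)) n"
  shows "\<exists>m x f. x \<in> sec L m \<and> f \<in> bmaps n m \<and> z = qcell L m x n f"
proof -
  obtain m c f where c: "nondegenerate L m c" and f: "f \<in> bmaps n m"
    and eq: "\<forall>k. \<forall>s\<in>cube_chains k n. shape (fobj tri L) n z k s = cell L m c k (mapc k f s)"
    using shape_factor[OF inf L shape_psh[OF tri_psh[OF L] z]] by blast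
  have csec: "c \<in> sec L m" using c by (simp add: nondegenerate_def)
  have "z = qcell L m c n f"
    by (rule shape_inj[OF tri_psh[OF L] z qcell(1)[OF L csec f]])
       (use eq qcell(2)[OF L csec f] in \<open>simp add: fcell_def\<close>)
  then show ?thesis using csec f by blast
qed

text \<open>Evaluated on the 2-simplex through \<open>v\<close>, both maps give normal cells because
  \<open>f\<close> and \<open>g\<close> fix the end vertices. Uniqueness of normal cells yields the
  carriers, and the middle vertex yields the value at \<open>v\<close>.\<close>

lemma qcell_eqD:
  assumes inf: "infinite (UNIV :: 'u set)" and L: "is_presheaf Box L"
    and c: "nondegenerate L m c" and d: "nondegenerate L m' d" and f: "f \<in> bmaps n m" and g: "g \<in> bmaps n m'"
    and eq: "qcell L m c n f = qcell L m' d n g"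
  shows "m = m'" "c = d" "\<And>v. length v = n \<Longrightarrow> f v = g v"
proof -
  have sec: "c \<in> sec L m" "d \<in> sec L m'" using c d by (auto simp: nondegenerate_def)
  have fc: "fcell L m c n f = fcell L m' d n g" using qcell(2)[OF L sec(1) f] qcell(2)[OF L sec(2) g] eq by simp
  have *: "m = m' \<and> c = d \<and> f v = g v" if v: "length v = n" for v
  proof -
    note b = vcap_bchains[OF v]
    have "cell L m c 2 (mapc 2 f (vcap n v)) = cell L m' d 2 (mapc 2 g (vcap n v))"
      using fun_cong[OF fun_cong[OF fc], of 2 "vcap n v"] b by (simp add: fcell_def bchains_def)
    note u = cell_normal_unique[OF inf L c d mapc_bchains[OF f b] mapc_bchains[OF g b] this]
    have "mapc 2 f (vcap n v) 1 = mapc 2 g (vcap n v) 1" using u(3) by simp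
    then show ?thesis using u(1,2) by (simp add: cap_def)
  qed
  show "m = m'" "c = d" using *[of "bot_pt n"] by auto
  show "f v = g v" if "length v = n" for v using *[OF that] by simp
qed

text \<open>For fixed \<open>f\<close>, \<open>qcell\<close> is natural in the cubical set, so each
  step of a zigzag of \<open>m\<close>-cubes becomes a step between \<open>n\<close>-cubes.\<close>

lemma zigzag_qcell:
  assumes K: "is_functor J CS K" and J: "is_category J" and f: "f \<in> bmaps n m" and zz: "zigzag J K m p q"
  shows "zigzag J ((qua \<circ>\<^sub>F tri) \<circ>\<^sub>F K) n (fst p, qcell (fobj K (fst p)) m (snd p) n f)
    (fst q, qcell (fobj K (fst q)) m (snd q) n f)"
  using zz
proof (induction rule: zigzag.induct)
  case (step u x)
  have Ku: "farr K u \<in> Hom CS (fobj K (Dom J u)) (fobj K (Cod J u))"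
    using functor_arr[OF K] step by (simp add: Hom_def)
  then have "is_presheaf Box (fobj K (Dom J u))" by (simp add: HomC)
  then have "qcell (fobj K (Dom J u)) m x n f \<in> sec (fobj ((qua \<circ>\<^sub>F tri) \<circ>\<^sub>F K) (Dom J u)) n"
    using qcell(1) step f by (simp add: fcomp_def)
  from zigzag.step[OF step(1) this] show ?case
    using qcell_nat[OF Ku step(2) f] by (simp add: fcomp_def)
qed (auto intro: zigzag.intros)

lemma qua_tri_cocontinuous:
  assumes inf: "infinite (UNIV :: 'u set)"
  shows "cocontinuous TYPE('u) CS CS (qua \<circ>\<^sub>F tri)"
  unfolding cocontinuous_def
proof (intro conjI allI impI)
  show QT: "is_functor CS CS (qua \<circ>\<^sub>F tri)" by (rule functor_fcomp[OF tri qua])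
  fix J :: "('u, 'u) category" and K and L :: "'u cset" and \<iota>
  assume J: "is_category J" and K: "is_functor J CS K" and col: "is_colimit J CS K L \<iota>"
  let ?Q = "qua \<circ>\<^sub>F tri"
  have cc: "is_cocone J CS K L \<iota>" using col by (simp add: is_colimit_def)
  then have L: "is_presheaf Box L" and \<iota>: "\<And>j. j \<in> Obj J \<Longrightarrow> \<iota> j \<in> Hom CS (fobj K j) L"
    by (auto simp: is_cocone_def cubical_sets_def)
  have Kp: "is_presheaf Box (fobj K j)" if "j \<in> Obj J" for j using \<iota>[OF that] by (simp add: HomC)
  have pw: "pointwise_colimit Box J K L \<iota>"
    by (rule is_colimit_pointwise[OF inf category_Box J K[unfolded cubical_sets_def] col[unfolded cubical_sets_def]])
  have surj: "\<exists>j\<in>Obj J. \<exists>x\<in>sec (fobj K j) m. c = fn (\<iota> j) m x" if "c \<in> sec L m" for m c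
    using pw that by (simp add: pointwise_colimit_def)
  have glue: "zigzag J K m (i, x) (j, y)"
    if "i \<in> Obj J" "j \<in> Obj J" "x \<in> sec (fobj K i) m" "y \<in> sec (fobj K j) m" "fn (\<iota> i) m x = fn (\<iota> j) m y" for m i j x y
    using pw that by (simp add: pointwise_colimit_def)
  have "pointwise_colimit Box J (?Q \<circ>\<^sub>F K) (fobj ?Q L) (\<lambda>j. farr ?Q (\<iota> j))"
    unfolding pointwise_colimit_def
  proof (intro conjI ballI impI)
    fix n z assume "z \<in> sec (fobj ?Q L) n"
    then obtain m c f where c: "c \<in> sec L m" and f: "f \<in> bmaps n m" and z: "z = qcell L m c n f"
      using qcell_exists[OF inf L, of z n] by (auto simp: fcomp_def)
    obtain j x where j: "j \<in> Obj J" and x: "x \<in> sec (fobj K j) m" and cx: "c = fn (\<iota> j) m x" using surj[OF c] by blast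
    have "z = fn (farr ?Q (\<iota> j)) n (qcell (fobj K j) m x n f)"
      using qcell_nat[OF \<iota>[OF j] x f] z cx by (simp add: fcomp_def)
    then show "\<exists>j\<in>Obj J. \<exists>x\<in>sec (fobj (?Q \<circ>\<^sub>F K) j) n. z = fn (farr ?Q (\<iota> j)) n x"
      using j qcell(1)[OF Kp[OF j] x f] by (auto simp: fcomp_def)
  next
    fix n i j y z
    assume i: "i \<in> Obj J" and j: "j \<in> Obj J" and y: "y \<in> sec (fobj (?Q \<circ>\<^sub>F K) i) n"
      and z: "z \<in> sec (fobj (?Q \<circ>\<^sub>F K) j) n" and eq: "fn (farr ?Q (\<iota> i)) n y = fn (farr ?Q (\<iota> j)) n z"
    text \<open>Both cubes factor through the same nondegenerate cube of \<open>L\<close>, which lifts to the diagram.\<close>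
    obtain m a f where a: "a \<in> sec (fobj K i) m" and f: "f \<in> bmaps n m" and ya: "y = qcell (fobj K i) m a n f"
      using qcell_exists[OF inf Kp[OF i], of y n] y by (auto simp: fcomp_def)
    obtain m' b g where b: "b \<in> sec (fobj K j) m'" and g: "g \<in> bmaps n m'" and zb: "z = qcell (fobj K j) m' b n g"
      using qcell_exists[OF inf Kp[OF j], of z n] z by (auto simp: fcomp_def)
    note \<iota>a = HomC_in_sec[OF \<iota>[OF i] a] and \<iota>b = HomC_in_sec[OF \<iota>[OF j] b]
    obtain p c where p: "EZ_decomposition L m (fn (\<iota> i) m a) p c" using EZ_exists[OF L \<iota>a] by blast
    obtain q d where q: "EZ_decomposition L m' (fn (\<iota> j) m' b) q d" using EZ_exists[OF L \<iota>b] by blast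
    have p': "degeneracy p" "din p = m" "nondegenerate L (dout p) c" "c \<in> sec L (dout p)" "fn (\<iota> i) m a = pull L p c"
      using p by (auto simp: EZ_decomposition_def nondegenerate_def)
    have q': "degeneracy q" "din q = m'" "nondegenerate L (dout q) d" "d \<in> sec L (dout q)" "fn (\<iota> j) m' b = pull L q d"
      using q by (auto simp: EZ_decomposition_def nondegenerate_def)
    have pf: "run p \<circ> f \<in> bmaps n (dout p)" and qg: "run q \<circ> g \<in> bmaps n (dout q)"
      using bmaps_degeneracy f g p' q' by auto
    have "qcell L m (fn (\<iota> i) m a) n f = qcell L m' (fn (\<iota> j) m' b) n g"
      using eq qcell_nat[OF \<iota>[OF i] a f] qcell_nat[OF \<iota>[OF j] b g] ya zb by (simp add: fcomp_def)
    then have "qcell L (dout p) c n (run p \<circ> f) = qcell L (dout q) d n (run q \<circ> g)"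
      using qcell_pull[OF L p'(4)] qcell_pull[OF L q'(4)] p' q' f g by simp
    note u = qcell_eqD[OF inf L p'(3) q'(3) pf qg this]
    obtain l e where l: "l \<in> Obj J" and e: "e \<in> sec (fobj K l) (dout p)" and ce: "c = fn (\<iota> l) (dout p) e"
      using surj[OF p'(4)] by blast
    have e': "e \<in> sec (fobj K l) (dout q)" using e u(1) by simp
    have \<iota>p: "fn (\<iota> l) (din r) (pull (fobj K l) r e) = pull L r c" if "dout r = dout p" for r
      using Hom_act[of "\<iota> l" Box "fobj K l" L "wmap r" e] \<iota>[OF l] e ce that by (simp add: cubical_sets_def)
    \<comment> \<open>In \<open>L\<close> the cube \<open>a\<close> and the degeneracy of
      \<open>e\<close> along \<open>p\<close> have the same image, so the colimit already glues them
      in the diagram; likewise for \<open>b\<close> and \<open>q\<close>. The two zigzags live in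
      dimensions \<open>m\<close> and \<open>m'\<close>, which may differ.\<close>
    have zp: "zigzag J K m (i, a) (l, pull (fobj K l) p e)"
      using glue[OF i l a] pull_in_sec[OF Kp[OF l] e] \<iota>p[of p] p' by simp
    have zq: "zigzag J K m' (j, b) (l, pull (fobj K l) q e)"
      using glue[OF j l b] pull_in_sec[OF Kp[OF l] e'] \<iota>p[of q] q' u by simp
    \<comment> \<open>After \<open>qcell\<close> both endpoints are \<open>n\<close>-cubes and
      coincide over \<open>l\<close>: the degeneracies pass into the monotone maps, which agree by
      \<open>u(3)\<close>.\<close>
    have "qcell (fobj K l) m (pull (fobj K l) p e) n f = qcell (fobj K l) (dout p) e n (run p \<circ> f)"
      using qcell_pull[OF Kp[OF l] e, of f n] f p' by simp
    also have "\<dots> = qcell (fobj K l) (dout p) e n (run q \<circ> g)"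
      by (rule qcell_cong) (rule u(3))
    also have "\<dots> = qcell (fobj K l) m' (pull (fobj K l) q e) n g"
      using qcell_pull[OF Kp[OF l] e', of g n] g q' u(1) by simp
    finally show "zigzag J (?Q \<circ>\<^sub>F K) n (i, y) (j, z)"
      using zigzag_qcell[OF K J f zp] zigzag_qcell[OF K J g zq] ya zb
      by (auto intro: zigzag.trans zigzag.sym)
  qed
  then show "is_colimit J CS (?Q \<circ>\<^sub>F K) (fobj ?Q L) (\<lambda>j. farr ?Q (\<iota> j))"
    using pointwise_colimit_is_colimit[OF category_Box _ _, folded cubical_sets_def]
      functor_fcomp[OF K QT] functor_cocone[OF J K QT cc] by blast
qed

end

theorem lemma7p2:
  fixes tri :: "('u cset, 'u cset_map, 'u sset, 'u sset_map) fctr"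
    and qua :: "('u sset, 'u sset_map, 'u cset, 'u cset_map) fctr"
  assumes "infinite (UNIV :: 'u set)"
    and "is_tri tri"
    and "is_qua tri qua"
  shows "cocontinuous TYPE('u) cubical_sets cubical_sets (qua \<circ>\<^sub>F tri)"
proof -
  obtain Y where Y: "is_functor Box (cubical_sets :: ('u cset, 'u cset_map) category) Y"
    and iso1: "psh_nat_iso Box Box (yoneda Box) Y" and iso2: "psh_nat_iso Box Simplex cube_nerve (tri \<circ>\<^sub>F Y)"
    using assms(2) unfolding is_tri_def by blast
  obtain \<alpha> :: "nat \<Rightarrow> nat \<Rightarrow> (nat, bool list \<Rightarrow> bool list) arrow \<Rightarrow> 'u" where
    \<alpha>: "\<forall>c\<in>Obj Box. \<alpha> c \<in> psh_maps Box (fobj (yoneda Box) c) (fobj Y c) \<and>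
           (\<forall>d\<in>Obj Box. bij_betw (\<alpha> c d) (sec (fobj (yoneda Box) c) d) (sec (fobj Y c) d))"
       "\<forall>f\<in>Arr Box. \<forall>d\<in>Obj Box. \<forall>x\<in>sec (fobj (yoneda Box) (Dom Box f)) d.
           \<alpha> (Cod Box f) d (fn (farr (yoneda Box) f) d x) = fn (farr Y f) d (\<alpha> (Dom Box f) d x)"
    using iso1 unfolding psh_nat_iso_def by blast
  obtain \<beta> :: "nat \<Rightarrow> nat \<Rightarrow> (nat \<Rightarrow> bool list) \<Rightarrow> 'u" where
    \<beta>: "\<forall>c\<in>Obj Box. \<beta> c \<in> psh_maps Simplex (fobj cube_nerve c) (fobj (tri \<circ>\<^sub>F Y) c) \<and>
           (\<forall>d\<in>Obj Simplex. bij_betw (\<beta> c d) (sec (fobj cube_nerve c) d) (sec (fobj (tri \<circ>\<^sub>F Y) c) d))"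
       "\<forall>f\<in>Arr Box. \<forall>d\<in>Obj Simplex. \<forall>x\<in>sec (fobj cube_nerve (Dom Box f)) d.
           \<beta> (Cod Box f) d (fn (farr cube_nerve f) d x) = fn (farr (tri \<circ>\<^sub>F Y) f) d (\<beta> (Dom Box f) d x)"
    using iso2 unfolding psh_nat_iso_def by blast
  have tri: "is_functor cubical_sets simplicial_sets tri" and qua: "is_functor simplicial_sets cubical_sets qua"
    using assms(3) by (auto simp: is_qua_def adjunction_def)
  obtain \<phi> :: "'u cset \<Rightarrow> 'u sset \<Rightarrow> 'u sset_map \<Rightarrow> 'u cset_map" where
    \<phi>: "\<forall>a\<in>Obj cubical_sets. \<forall>b\<in>Obj simplicial_sets.
          bij_betw (\<phi> a b) (Hom simplicial_sets (fobj tri a) b) (Hom cubical_sets a (fobj qua b))"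
       "\<forall>f\<in>Arr cubical_sets. \<forall>b\<in>Obj simplicial_sets. \<forall>k\<in>Hom simplicial_sets (fobj tri (Cod cubical_sets f)) b.
          \<phi> (Dom cubical_sets f) b (Comp simplicial_sets k (farr tri f)) = Comp cubical_sets (\<phi> (Cod cubical_sets f) b k) f"
       "\<forall>a\<in>Obj cubical_sets. \<forall>g\<in>Arr simplicial_sets. \<forall>k\<in>Hom simplicial_sets (fobj tri a) (Dom simplicial_sets g).
          \<phi> a (Cod simplicial_sets g) (Comp simplicial_sets g k) = Comp cubical_sets (farr qua g) (\<phi> a (Dom simplicial_sets g) k)"
    using assms(3) unfolding is_qua_def adjunction_def by blast
  \<comment> \<open>The two goals treated separately are the naturality of \<alpha> and \<beta>,
    where the action of a box map has to be rewritten as composition and as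
    \<open>post\<close>.\<close>
  interpret tri_qua tri qua Y \<alpha> \<beta> \<phi>
  proof (unfold_locales, goal_cases)
    case (6 u v n)
    then show ?case using \<alpha>(2)[rule_format, of u n v] farr_yoneda[of n Box v u] by (simp add: sec_yoneda)
  next
    case (9 s k w)
    have "fn (farr cube_nerve (wmap w)) k s = post k w s"
      using 9 by (auto simp: cube_nerve_def compose_def post_def chains_iff)
    then show ?case using \<beta>(2)[rule_format, of "wmap w" k s] 9 by (simp add: cube_nerve_def fcomp_def)
  qed (use tri qua Y \<alpha>(1) \<beta>(1) \<phi> in \<open>auto simp: sec_yoneda cube_nerve_def fcomp_def Hom_def cubical_sets_def simplicial_sets_def\<close>)
  show ?thesis by (rule qua_tri_cocontinuous[OF assms(1)])
qed

end
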